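(* The space $\mathcal{S}(0)$ of symmetric shift operators with shift $0$ for the symmetric Askey--Wilson polynomials $(P_m)_{m\in\mathbb{N}_0}$ is the algebra of polynomials in $L$ with coefficients in $K$: \[ \mathcal{S}(0)=K[L]. \]
   Context: Let $K=\mathbb{Q}(\sqrt{-ab},b,\sqrt{-cd},d,q^{1/2})$ be the field of rational functions in the five indeterminates $\sqrt{-ab},b,\sqrt{-cd},d,q^{1/2}$; put $a=-(\sqrt{-ab})^2/b$, $c=-(\sqrt{-cd})^2/d$, $\sqrt{abcd}=\sqrt{-ab}\,\sqrt{-cd}$. Let $*$ be the field involution of $K$ inverting the five generators. Let $\mathcal{A}=K[z,z^{-1}]$ and $\mathcal{A}_0=\{f\in\mathcal{A}: f(z)=f(z^{-1})\}$. For $f=\sum_n f_nz^n$ put $f^*=\sum_n f_n^*z^{-n}$. Write $(x;q)_\infty=\prod_{j\ge0}(1-xq^j)$ and $(x_1,\dots,x_r;q)_\infty=\prod_i(x_i;q)_\infty$. Let \[ \Delta=\frac{(z^2,qz^{-2};q)_\infty}{(az,bz,cz,dz,aqz^{-1},bqz^{-1},cz^{-1},dz^{-1};q)_\infty}, \] expanded as a power series in $z$ and $q^{1/2}z^{-1}$ with coefficients in $\mathcal{R}=\mathbb{Q}[a^{\pm1},b^{\pm1},(cq^{-1/2})^{\pm1},(dq^{-1/2})^{\pm1}]$, hence regarded as an element of $\mathcal{R}((q^{1/2}))[[z^{\pm1}]]$. With $\mathrm{ct}$ denoting the coefficient of $z^0$, put $(f,g)=\mathrm{ct}(fg^*\Delta)\in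 K\otimes_{\mathcal{R}[q^{\pm1/2}]}\mathcal{R}((q^{1/2}))$. The symmetric Askey--Wilson polynomial $P_n\in\mathcal{A}_0$ ($n\in\mathbb{N}_0$) is the unique element with $P_0=1$ and, for $n\ge1$, $P_n=z^n+z^{-n}+$ (a $K$-linear combination of $z^j+z^{-j}$, $0\le j<n$), such that $(P_n,z^m+z^{-m})=0$ for $0\le m<n$. Let $(Tf)(z)=f(q^{1/2}z)$. A symmetric difference operator is an operator $S=\sum_{n\in\mathbb{Z}}c_n(z)T^n$ with $c_n\in K(z)$, almost all zero, with $S\mathcal{A}_0\subset\mathcal{A}_0$. It is a shift operator with shift $0$ if for every $m\in\mathbb{N}_0$ there is $C\in K$ with $SP_m=CP_m$. $\mathcal{S}(0)$ is the set of these operators. The operator $L$ (the symmetric Cherednik operator $Y+Y^{-1}$ restricted to $\mathcal{A}_0$) is \[ L=\sqrt{\tfrac{q}{abcd}}\Big(A(z)(T^2-1)+A(z^{-1})(T^{-2}-1)\Big)+\sqrt{\tfrac{abcd}{q}}+\sqrt{\tfrac{q}{abcd}},\qquad A(z)=\frac{(1-az)(1-bz)(1-cz)(1-dz)}{(1-z^2)(1-qz^2)}, \] with $\sqrt{abcd/q}=\sqrt{abcd}\,q^{-1/2}$; it acts on $\mathcal{A}_0$. *)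

theory Defs
  imports
    "HOL-Library.Poly_Mapping"
    "HOL-Library.Numeral_Type"
    "HOL-Computational_Algebra.Computational_Algebra"
    "HOL-Computational_Algebra.Fraction_Field"
    "HOL-Computational_Algebra.Formal_Laurent_Series"
    "HOL-Analysis.Infinite_Products"
begin

section \<open>The ground field\<close>

text \<open>Rational functions over the rationals, in indeterminates indexed by \<^typ>\<open>'v\<close>.\<close>

type_synonym 'v ratfun = "(('v \<Rightarrow>\<^sub>0 nat) \<Rightarrow>\<^sub>0 rat) fract"

definition indet :: "'v::linorder \<Rightarrow> 'v ratfun" where
  "indet v = Fract (Poly_Mapping.single (Poly_Mapping.single v 1) 1) 1"

definition is_ring_hom :: "('r::ring_1 \<Rightarrow> 's::ring_1) \<Rightarrow> bool" where
  "is_ring_hom h \<longleftrightarrow>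
     h 1 = 1 \<and> (\<forall>x y. h (x + y) = h x + h y) \<and> (\<forall>x y. h (x * y) = h x * h y)"

type_synonym K = "5 ratfun"

definition sqrt_mab :: K where "sqrt_mab = indet 0"  \<comment> \<open>\<open>\<surd>(-ab)\<close>\<close>
definition par_b :: K where "par_b = indet 1"
definition sqrt_mcd :: K where "sqrt_mcd = indet 2"  \<comment> \<open>\<open>\<surd>(-cd)\<close>\<close>
definition par_d :: K where "par_d = indet 3"
definition q_half :: K where "q_half = indet 4"      \<comment> \<open>\<open>q\<^bsup>1/2\<^esup>\<close>\<close>

definition par_a :: K where "par_a = - (sqrt_mab ^ 2) / par_b"
definition par_c :: K where "par_c = - (sqrt_mcd ^ 2) / par_d"
definition par_q :: K where "par_q = q_half ^ 2"
definition sqrt_abcd :: K where "sqrt_abcd = sqrt_mab * sqrt_mcd"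

definition K_star :: "K \<Rightarrow> K" where
  "K_star = (THE h. is_ring_hom h \<and>
     (\<forall>x \<in> {sqrt_mab, par_b, sqrt_mcd, par_d, q_half}. h x = inverse x))"


section \<open>Laurent polynomials over the ground field\<close>

text \<open>
  The Laurent polynomial ring is the group algebra of the integers: the element with
  coefficients \<open>f\<^sub>n\<close> is the finitely supported map \<open>n \<mapsto> f\<^sub>n\<close>, with the convolution product.
\<close>

type_synonym laurent = "int \<Rightarrow>\<^sub>0 K"

definition laurent_const :: "K \<Rightarrow> laurent" where
  "laurent_const k = Poly_Mapping.single 0 k"

definition laurent_inv :: "laurent \<Rightarrow> laurent" where  \<comment> \<open>\<open>f(z\<^sup>-\<^sup>1)\<close>\<close>
  "laurent_inv f = (\<Sum>n \<in> Poly_Mapping.keys f. Poly_Mapping.single (- n) (Poly_Mapping.lookup f n))"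

definition laurent_star :: "laurent \<Rightarrow> laurent" where
  "laurent_star f =
     (\<Sum>n \<in> Poly_Mapping.keys f. Poly_Mapping.single (- n) (K_star (Poly_Mapping.lookup f n)))"

definition sym_laurent :: "laurent set" where
  "sym_laurent = {f. f = laurent_inv f}"

definition msym :: "nat \<Rightarrow> laurent" where
  "msym n = Poly_Mapping.single (int n) 1 + Poly_Mapping.single (- int n) 1"


section \<open>The weight function\<close>

text \<open>
  The weight lives in power series in \<open>z\<close> and \<open>w = q\<^bsup>1/2\<^esup> z\<^sup>-\<^sup>1\<close>; this is modelled by series in
  \<open>z\<close> (outer variable) whose coefficients are series in \<open>w\<close> (inner variable). The
  coefficients are taken in the rational function field in
  \<open>\<surd>(-ab)\<close>, \<open>b\<close>, \<open>\<surd>(-cd) q\<^bsup>-1/2\<^esup>\<close>, \<open>d q\<^bsup>-1/2\<^esup>\<close>, numbered 0 to 3, which contains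
  \<open>\<rat>[a\<^sup>\<plusminus>\<^sup>1, b\<^sup>\<plusminus>\<^sup>1, (c q\<^bsup>-1/2\<^esup>)\<^sup>\<plusminus>\<^sup>1, (d q\<^bsup>-1/2\<^esup>)\<^sup>\<plusminus>\<^sup>1]\<close>; all coefficients of the weight
  lie in that subring.
\<close>

type_synonym coef = "4 ratfun"

definition coef_a :: coef where "coef_a = - (indet 0 ^ 2) / indet 1"
definition coef_b :: coef where "coef_b = indet 1"
definition coef_c' :: coef where "coef_c' = - (indet 2 ^ 2) / indet 3"  \<comment> \<open>\<open>c q\<^bsup>-1/2\<^esup>\<close>\<close>
definition coef_d' :: coef where "coef_d' = indet 3"                    \<comment> \<open>\<open>d q\<^bsup>-1/2\<^esup>\<close>\<close>

definition qpoch_inf :: "coef fps fps \<Rightarrow> coef fps fps \<Rightarrow> coef fps fps" where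
  "qpoch_inf x Q = prodinf (\<lambda>j. 1 - x * Q ^ j)"

text \<open>
  In terms of \<open>z\<close> and \<open>w\<close>: \<open>q\<^bsup>1/2\<^esup> = zw\<close>, \<open>q z\<^sup>-\<^sup>2 = w\<^sup>2\<close>, \<open>q z\<^sup>-\<^sup>1 = q\<^bsup>1/2\<^esup> w\<close>, and
  \<open>c z\<^sup>-\<^sup>1 = (c q\<^bsup>-1/2\<^esup>) w\<close>, similarly for \<open>d\<close>.
\<close>

definition AW_weight :: "coef fps fps" where
  "AW_weight =
     (let z = fps_X; w = fps_const fps_X; p = z * w; Q = p ^ 2;
          k = (\<lambda>x. fps_const (fps_const x));
          a = k coef_a; b = k coef_b; c' = k coef_c'; d' = k coef_d';
          c = c' * p; d = d' * p
      in qpoch_inf (z ^ 2) Q * qpoch_inf (w ^ 2) Q *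
         inverse (qpoch_inf (a * z) Q * qpoch_inf (b * z) Q *
                  qpoch_inf (c * z) Q * qpoch_inf (d * z) Q *
                  qpoch_inf (a * (p * w)) Q * qpoch_inf (b * (p * w)) Q *
                  qpoch_inf (c' * w) Q * qpoch_inf (d' * w) Q))"

text \<open>
  Since \<open>z\<^sup>i w\<^sup>j = q\<^bsup>j/2\<^esup> z\<^bsup>i-j\<^esup>\<close>, the coefficient of \<open>z\<^sup>n\<close> in the weight is a power series in
  \<open>q\<^bsup>1/2\<^esup>\<close>; here \<open>q\<^bsup>1/2\<^esup>\<close> is the variable of the series.
\<close>

definition AW_weight_coeff :: "int \<Rightarrow> coef fls" where
  "AW_weight_coeff n =
     fps_to_fls (Abs_fps (\<lambda>j. if n + int j \<ge> 0
                              then fps_nth (fps_nth AW_weight (nat (n + int j))) j else 0))"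

text \<open>
  Expansion of rational functions as Laurent series in \<open>q\<^bsup>1/2\<^esup>\<close>. Write \<open>R\<close> for the ring
  \<open>\<rat>[a\<^sup>\<plusminus>\<^sup>1, b\<^sup>\<plusminus>\<^sup>1, (c q\<^bsup>-1/2\<^esup>)\<^sup>\<plusminus>\<^sup>1, (d q\<^bsup>-1/2\<^esup>)\<^sup>\<plusminus>\<^sup>1]\<close>. This map, together with the
  inclusion of \<open>R((q\<^bsup>1/2\<^esup>))\<close>, induces an injective ring homomorphism from
  \<open>K \<otimes> R((q\<^bsup>1/2\<^esup>))\<close>, with tensor product over \<open>R[q\<^sup>\<plusminus>\<^bsup>1/2\<^esup>]\<close>, to \<^typ>\<open>coef fls\<close>:
  \<open>K\<close> is a localization of the Laurent polynomial ring in its generators, which is free with basis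
  \<open>1\<close>, \<open>\<surd>(-ab)\<close>, \<open>\<surd>(-cd) q\<^bsup>-1/2\<^esup>\<close>, \<open>\<surd>(-ab) \<surd>(-cd) q\<^bsup>-1/2\<^esup>\<close> over \<open>R[q\<^sup>\<plusminus>\<^bsup>1/2\<^esup>]\<close>,
  and these four elements are linearly independent over \<open>R((q\<^bsup>1/2\<^esup>))\<close> inside
  \<^typ>\<open>coef fls\<close>. The pairing is regarded as taking values in the latter field.
\<close>

definition K_expand :: "K \<Rightarrow> coef fls" where
  "K_expand = (THE h. is_ring_hom h \<and>
     h sqrt_mab = fls_const (indet 0) \<and>
     h par_b = fls_const (indet 1) \<and>
     h sqrt_mcd = fls_const (indet 2) * fls_X \<and>
     h par_d = fls_const (indet 3) * fls_X \<and>
     h q_half = fls_X)"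

definition AW_pairing :: "laurent \<Rightarrow> laurent \<Rightarrow> coef fls" where
  "AW_pairing f g =
     (let h = f * laurent_star g
      in \<Sum>n \<in> Poly_Mapping.keys h. K_expand (Poly_Mapping.lookup h n) * AW_weight_coeff (- n))"


section \<open>Symmetric Askey--Wilson polynomials\<close>

definition is_sym_AW_poly :: "nat \<Rightarrow> laurent \<Rightarrow> bool" where
  "is_sym_AW_poly n f \<longleftrightarrow>
     f \<in> sym_laurent \<and>
     (if n = 0 then f = 1
      else (\<exists>k :: nat \<Rightarrow> K. f = msym n + (\<Sum>j<n. laurent_const (k j) * msym j)) \<and>
           (\<forall>m<n. AW_pairing f (msym m) = 0))"

definition sym_AW_poly :: "nat \<Rightarrow> laurent" where
  "sym_AW_poly n = (THE f. is_sym_AW_poly n f)"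


section \<open>Symmetric difference operators and shift operators\<close>

text \<open>
  Difference operators are modelled as the maps they induce on the field of rational functions
  in \<open>z\<close>. As the powers of \<open>T\<close> are pairwise distinct field automorphisms, they are linearly
  independent, so such a map determines its coefficients.
\<close>

type_synonym Kz = "laurent fract"

definition of_laurent :: "laurent \<Rightarrow> Kz" where
  "of_laurent f = Fract f 1"

definition Kz_const :: "K \<Rightarrow> Kz" where
  "Kz_const k = of_laurent (laurent_const k)"

definition Kz_z :: Kz where
  "Kz_z = of_laurent (Poly_Mapping.single 1 1)"

definition T_pow :: "int \<Rightarrow> Kz \<Rightarrow> Kz" where  \<comment> \<open>\<open>f(z) \<mapsto> f(q\<^bsup>n/2\<^esup> z)\<close>\<close>
  "T_pow n = (THE h. is_ring_hom h \<and> (\<forall>k. h (Kz_const k) = Kz_const k) \<and>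
                     h Kz_z = Kz_const (q_half powi n) * Kz_z)"

definition is_difference_operator :: "(Kz \<Rightarrow> Kz) \<Rightarrow> bool" where
  "is_difference_operator S \<longleftrightarrow>
     (\<exists>c :: int \<Rightarrow> Kz. finite {n. c n \<noteq> 0} \<and>
        S = (\<lambda>f. \<Sum>n \<in> {n. c n \<noteq> 0}. c n * T_pow n f))"

definition is_sym_difference_operator :: "(Kz \<Rightarrow> Kz) \<Rightarrow> bool" where
  "is_sym_difference_operator S \<longleftrightarrow>
     is_difference_operator S \<and>
     S ` of_laurent ` sym_laurent \<subseteq> of_laurent ` sym_laurent"

definition shift_operators_0 :: "(Kz \<Rightarrow> Kz) set" where
  "shift_operators_0 =
     {S. is_sym_difference_operator S \<and>
         (\<forall>m. \<exists>C :: K. S (of_laurent (sym_AW_poly m)) =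
                        Kz_const C * of_laurent (sym_AW_poly m))}"

definition AW_A :: "Kz \<Rightarrow> Kz" where
  "AW_A x = (1 - Kz_const par_a * x) * (1 - Kz_const par_b * x) *
            (1 - Kz_const par_c * x) * (1 - Kz_const par_d * x) /
            ((1 - x ^ 2) * (1 - Kz_const par_q * x ^ 2))"

definition AW_L :: "Kz \<Rightarrow> Kz" where
  "AW_L f =
     (let r = sqrt_abcd / q_half  \<comment> \<open>\<open>\<surd>(abcd/q)\<close>\<close>
      in Kz_const (inverse r) *
           (AW_A Kz_z * (T_pow 2 f - f) + AW_A (inverse Kz_z) * (T_pow (-2) f - f))
         + Kz_const (r + inverse r) * f)"

definition polys_in_operator :: "(Kz \<Rightarrow> Kz) \<Rightarrow> (Kz \<Rightarrow> Kz) set" where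
  "polys_in_operator M =
     range (\<lambda>p :: K poly. \<lambda>f. \<Sum>i\<le>degree p. Kz_const (coeff p i) * (M ^^ i) f)"

end

theory Submission
  imports Defs
begin

text \<open>
  The operator \<open>L\<close> is triangular on symmetric Laurent polynomials, with pairwise distinct
  eigenvalues \<open>r q\<^sup>n + r\<^sup>-\<^sup>1 q\<^sup>-\<^sup>n\<close>, \<open>r = \<surd>(abcd/q)\<close>, and self-adjoint for the bilinear form
  \<open>ct (f g \<Delta>)\<close>, so its monic eigenfunctions are orthogonal. The form is nondegenerate, as one sees
  by setting \<open>q\<^bsup>1/2\<^esup> = 0\<close>, where \<open>\<Delta>\<close> becomes \<open>(1 - z\<^sup>2) / ((1 - a z) (1 - b z))\<close>. Hence
  the eigenfunctions are the Askey--Wilson polynomials.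

  For self-adjointness, \<open>\<Delta>\<close> is related to two weights with an exact symmetry:
  \<open>(1 - a z) (1 - b z) \<Delta> / (1 - z\<^sup>2)\<close> is invariant under \<open>z \<mapsto> z\<^sup>-\<^sup>1\<close>, and
  \<open>(1 - c z\<^sup>-\<^sup>1) (1 - d z\<^sup>-\<^sup>1) \<Delta> / (1 - q z\<^sup>-\<^sup>2)\<close> is invariant under \<open>z \<mapsto> q z\<^sup>-\<^sup>1\<close>.
  Both substitutions act on monomials \<open>z\<^sup>i w\<^sup>j\<close>, \<open>w = q\<^bsup>1/2\<^esup> z\<^sup>-\<^sup>1\<close>, by linear involutions of
  the exponents.

  A shift operator \<open>S\<close> with shift \<open>0\<close> commutes with \<open>L\<close>. If \<open>c(z) T\<^sup>N\<close> is its leading term, comparing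
  leading terms of \<open>S L = L S\<close> gives \<open>c(z) A(q\<^bsup>N/2\<^esup> z) = A(z) c(q z)\<close>. For odd \<open>N\<close> this is
  impossible: summed along the orbit \<open>a\<^sup>-\<^sup>1 q\<^sup>k\<close>, the vanishing orders of \<open>A(q\<^bsup>N/2\<^esup> z)\<close> and
  \<open>A(z)\<close> differ by one. For \<open>N = 2 k\<close> the solutions are the multiples of the leading coefficient of
  \<open>L\<^sup>k\<close>, so that the order of \<open>S\<close> can be lowered by subtracting a multiple of \<open>L\<^sup>k\<close>.
\<close>

unbundle no vec_syntax

section \<open>Ring homomorphisms on rational functions\<close>

text \<open>Two weights are needed because \<open>\<Delta>\<close> itself is not invariant under z
  -> z^-1. With M = (1 - a z)(1 - b z) one has z^2 M(z^-1) = M - (1 - a b)(1 - z^2). Hence the main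
  part of (L f) g - f (L g) is antisymmetric under z -> z^-1 against the first weight, and the
  defect, which carries 1 - a b, is antisymmetric under z -> q z^-1 against the second. Everything
  is a formal series, and neither substitution preserves the quadrant of exponents. Only
  q-Pochhammer products that a substitution exchanges in pairs can be kept; the first factors of the
  unpaired ones are split off, and these are exactly the factors by which the invariant weights
  differ from \<open>\<Delta>\<close>. Commutation of S with L is known only on symmetric Laurent
  polynomials. It becomes an identity of coefficients because a difference operator that kills all
  of them is zero. The same fact gives c_(-n)(z) = c_n(z^-1) for the coefficients of S, so that
  removing the leading term also removes the trailing one and the order really drops.\<close>

lemma is_ring_homD:
  assumes "is_ring_hom h"
  shows "h 1 = 1" "h (x + y) = h x + h y" "h (x * y) = h x * h y"
    "h 0 = 0" "h (- x) = - h x" "h (x - y) = h x - h y" "h (x ^ n) = h x ^ n"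
    "h (sum f A) = (\<Sum>x\<in>A. h (f x))" "h (of_nat n) = of_nat n" "h (of_int k) = of_int k"
proof -
  show h1: "h 1 = 1" and add: "\<And>x y. h (x + y) = h x + h y" and mult: "\<And>x y. h (x * y) = h x * h y"
    using assms by (auto simp: is_ring_hom_def)
  show h0: "h 0 = 0" using add[of 0 0] by simp
  show uminus: "h (- x) = - h x" for x using add[of x "- x"] h0 by (simp add: eq_neg_iff_add_eq_0 add.commute)
  show "h (x - y) = h x - h y" using add[of x "- y"] uminus[of y] by simp
  show "h (x ^ n) = h x ^ n" by (induction n) (simp_all add: h1 mult)
  show "h (sum f A) = (\<Sum>x\<in>A. h (f x))" by (induction A rule: infinite_finite_induct) (simp_all add: h0 add)
  show nat: "h (of_nat n) = of_nat n" for n by (induction n) (simp_all add: h0 h1 add)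
  show "h (of_int k) = of_int k" by (cases k) (simp_all add: nat uminus h1 add del: of_nat_Suc)
qed

lemma is_ring_hom_prod:
  fixes h :: "'a::comm_ring_1 \<Rightarrow> 'b::comm_ring_1"
  assumes "is_ring_hom h"
  shows "h (prod f A) = (\<Prod>x\<in>A. h (f x))"
  by (induction A rule: infinite_finite_induct) (simp_all add: is_ring_homD[OF assms])

lemma is_ring_hom_compose: "is_ring_hom f \<Longrightarrow> is_ring_hom g \<Longrightarrow> is_ring_hom (\<lambda>x. f (g x))"
  by (simp add: is_ring_hom_def)

lemma is_ring_hom_field:
  fixes h :: "'a::field \<Rightarrow> 'b::field"
  assumes "is_ring_hom h"
  shows "h x = 0 \<longleftrightarrow> x = 0" "h x = h y \<longleftrightarrow> x = y" "h (inverse x) = inverse (h x)"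
    "h (x / y) = h x / h y" "h (x powi k) = h x powi k"
proof -
  show zero: "h x = 0 \<longleftrightarrow> x = 0" for x
  proof
    assume "h x = 0"
    then have "h (x * inverse x) = 0" using is_ring_homD[OF assms] by simp
    then show "x = 0" using is_ring_homD(1)[OF assms] by (cases "x = 0") auto
  qed (simp add: is_ring_homD[OF assms])
  show "h x = h y \<longleftrightarrow> x = y"
    using zero[of "x - y"] by (simp add: is_ring_homD[OF assms])
  show inv: "h (inverse x) = inverse (h x)" for x
  proof (cases "x = 0")
    case False
    then have "h x * h (inverse x) = 1"
      using is_ring_homD(1,3)[OF assms] by (metis right_inverse)
    then show ?thesis by (simp add: inverse_unique)
  qed (simp add: is_ring_homD[OF assms])
  show "h (x / y) = h x / h y" by (simp add: divide_inverse inv is_ring_homD[OF assms])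
  show "h (x powi k) = h x powi k" by (simp add: power_int_def inv is_ring_homD[OF assms])
qed

section \<open>Evaluation homomorphisms and their extension to fraction fields\<close>

definition eval_poly_mapping :: "('r \<Rightarrow> 's) \<Rightarrow> ('m \<Rightarrow> 's) \<Rightarrow> ('m \<Rightarrow>\<^sub>0 'r::comm_ring_1) \<Rightarrow> 's::comm_ring_1" where
  "eval_poly_mapping h t p = (\<Sum>m\<in>Poly_Mapping.keys p. h (Poly_Mapping.lookup p m) * t m)"

lemma eval_poly_mapping_superset:
  assumes "h 0 = 0" "finite A" "Poly_Mapping.keys p \<subseteq> A"
  shows "eval_poly_mapping h t p = (\<Sum>m\<in>A. h (Poly_Mapping.lookup p m) * t m)"
  unfolding eval_poly_mapping_def using assms
  by (intro sum.mono_neutral_left) (auto simp: in_keys_iff)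

lemma eval_poly_mapping_single [simp]:
  "h 0 = 0 \<Longrightarrow> eval_poly_mapping h t (Poly_Mapping.single m c) = h c * t m"
  by (subst eval_poly_mapping_superset[of _ "{m}"]) auto

lemma poly_mapping_sum_single:
  "p = (\<Sum>m\<in>Poly_Mapping.keys p. Poly_Mapping.single m (Poly_Mapping.lookup p m))"
  by (rule poly_mapping_eqI)
     (auto simp: lookup_sum lookup_single when_def sum.delta in_keys_iff not_in_keys_iff_lookup_eq_zero)

text \<open>Reduces identities that are additive in a polynomial to single terms; the homomorphism
  and constant term identities below are mostly proved this way.\<close>

lemma poly_mapping_additive_induct [case_names single add]:
  fixes p :: "'m \<Rightarrow>\<^sub>0 'r::comm_monoid_add"
  assumes single: "\<And>m c. P (Poly_Mapping.single m c)" and add: "\<And>p q. P p \<Longrightarrow> P q \<Longrightarrow> P (p + q)"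
  shows "P p"
proof -
  have "P (\<Sum>m\<in>A. Poly_Mapping.single m (Poly_Mapping.lookup p m))" if "finite A" for A
    using that single[of undefined 0] by (induction A rule: finite_induct) (auto intro: single add)
  from this[of "Poly_Mapping.keys p"] show ?thesis
    by (simp add: poly_mapping_sum_single[symmetric])
qed

lemma eval_poly_mapping_add:
  assumes "\<And>x y. h (x + y) = h x + h y"
  shows "eval_poly_mapping h t (p + q) = eval_poly_mapping h t p + eval_poly_mapping h t q"
proof -
  have h0: "h 0 = 0" using assms[of 0 0] by simp
  let ?A = "Poly_Mapping.keys p \<union> Poly_Mapping.keys q"
  have "eval_poly_mapping h t p = (\<Sum>m\<in>?A. h (Poly_Mapping.lookup p m) * t m)"
    "eval_poly_mapping h t q = (\<Sum>m\<in>?A. h (Poly_Mapping.lookup q m) * t m)"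
    "eval_poly_mapping h t (p + q) = (\<Sum>m\<in>?A. h (Poly_Mapping.lookup (p + q) m) * t m)"
    using keys_add[of p q] by (auto intro!: eval_poly_mapping_superset h0)
  then show ?thesis by (simp add: lookup_add assms distrib_right sum.distrib)
qed

lemma is_ring_hom_eval_poly_mapping:
  fixes t :: "'m::comm_monoid_add \<Rightarrow> 's::comm_ring_1" and h :: "'r::comm_ring_1 \<Rightarrow> 's"
  assumes h: "is_ring_hom h" and t: "t 0 = 1" "\<And>m n. t (m + n) = t m * t n"
  shows "is_ring_hom (eval_poly_mapping h t)"
proof -
  note hD = is_ring_homD[OF h]
  let ?e = "eval_poly_mapping h t"
  have add: "?e (p + q) = ?e p + ?e q" for p q
    by (rule eval_poly_mapping_add) (rule hD)
  have single: "?e (Poly_Mapping.single m c * q) = ?e (Poly_Mapping.single m c) * ?e q" for m c q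
    by (induction q rule: poly_mapping_additive_induct)
       (simp_all add: mult_single hD t(2) add distrib_left mult.assoc mult.left_commute)
  have "?e (p * q) = ?e p * ?e q" for p q
    by (induction p rule: poly_mapping_additive_induct) (simp_all add: single add distrib_right)
  moreover have "?e 1 = 1" unfolding single_one[symmetric] by (simp add: hD t del: single_one)
  ultimately show ?thesis by (simp add: is_ring_hom_def add)
qed

text \<open>The value is computed from a chosen representation as a fraction. For an injective
  homomorphism \<open>h\<close> it does not depend on the choice, by
  \<open>fract_lift_Fract\<close>.\<close>

definition fract_lift :: "('r::idom \<Rightarrow> 'f::field) \<Rightarrow> 'r fract \<Rightarrow> 'f" where
  "fract_lift h x = (let ab = SOME ab. snd ab \<noteq> 0 \<and> x = Fract (fst ab) (snd ab) in h (fst ab) / h (snd ab))"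

lemma fract_lift_Fract:
  fixes h :: "'r::idom \<Rightarrow> 'f::field"
  assumes h: "is_ring_hom h" "\<And>x. h x = 0 \<Longrightarrow> x = 0" and b: "b \<noteq> 0"
  shows "fract_lift h (Fract a b) = h a / h b"
proof -
  define ab where "ab = (SOME ab. snd ab \<noteq> 0 \<and> Fract a b = Fract (fst ab) (snd ab))"
  have "snd ab \<noteq> 0 \<and> Fract a b = Fract (fst ab) (snd ab)"
    unfolding ab_def by (rule someI[of _ "(a, b)"]) (simp add: b)
  then have ab: "snd ab \<noteq> 0" "a * snd ab = fst ab * b"
    using b by (auto simp: eq_fract)
  then have "h a * h (snd ab) = h (fst ab) * h b"
    by (metis is_ring_homD(3)[OF h(1)])
  moreover have "h b \<noteq> 0" "h (snd ab) \<noteq> 0" using h(2) b ab(1) by auto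
  ultimately show ?thesis
    unfolding fract_lift_def ab_def[symmetric] Let_def by (simp add: field_simps)
qed

lemma is_ring_hom_fract_lift:
  fixes h :: "'r::idom \<Rightarrow> 'f::field"
  assumes h: "is_ring_hom h" "\<And>x. h x = 0 \<Longrightarrow> x = 0"
  shows "is_ring_hom (fract_lift h)"
  unfolding is_ring_hom_def
proof (intro conjI allI)
  note L = fract_lift_Fract[OF h]
  show "fract_lift h 1 = 1" unfolding One_fract_def by (simp add: L is_ring_homD[OF h(1)])
  fix x y :: "'r fract"
  obtain a b where x: "x = Fract a b" "b \<noteq> 0" by (cases x)
  obtain c d where y: "y = Fract c d" "d \<noteq> 0" by (cases y)
  have nz: "h b \<noteq> 0" "h d \<noteq> 0" using h(2) x y by auto
  show "fract_lift h (x + y) = fract_lift h x + fract_lift h y"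
    using nz x y by (simp add: L is_ring_homD[OF h(1)] field_simps)
  show "fract_lift h (x * y) = fract_lift h x * fract_lift h y"
    using x y by (simp add: L is_ring_homD[OF h(1)])
qed

lemma fract_hom_eqI:
  fixes f g :: "'r::idom fract \<Rightarrow> 'f::field"
  assumes "is_ring_hom f" "is_ring_hom g" "\<And>a. f (Fract a 1) = g (Fract a 1)"
  shows "f = g"
proof
  fix x :: "'r fract"
  obtain a b where x: "x = Fract a b" "b \<noteq> 0" by (cases x)
  then have "x = Fract a 1 / Fract b 1" by simp
  then show "f x = g x"
    by (simp only: is_ring_hom_field(4)[OF assms(1)] is_ring_hom_field(4)[OF assms(2)] assms(3))
qed

lemma is_ring_hom_Fract: "is_ring_hom (\<lambda>a :: 'r::idom. Fract a 1)"
  by (simp add: is_ring_hom_def One_fract_def)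

lemma Fract_1_eq_0_iff: "Fract a 1 = 0 \<longleftrightarrow> a = 0"
  by (simp add: Zero_fract_def eq_fract)

lemma is_ring_hom_single_0: "is_ring_hom (Poly_Mapping.single (0 :: 'm::comm_monoid_add) :: 'r::comm_ring_1 \<Rightarrow> _)"
  by (simp add: is_ring_hom_def single_add mult_single)

definition rat_const :: "rat \<Rightarrow> 'v::linorder ratfun" where
  "rat_const r = Fract (Poly_Mapping.single 0 r) 1"

lemma is_ring_hom_rat_const: "is_ring_hom rat_const"
  unfolding rat_const_def by (intro is_ring_hom_compose[OF is_ring_hom_Fract is_ring_hom_single_0])

definition exponent :: "('v::finite \<Rightarrow> nat) \<Rightarrow> 'v \<Rightarrow>\<^sub>0 nat" where
  "exponent k = (\<Sum>v\<in>UNIV. Poly_Mapping.single v (k v))"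

lemma lookup_exponent [simp]: "Poly_Mapping.lookup (exponent k) v = k v"
  by (simp add: exponent_def lookup_sum lookup_single when_def)

lemma exponent_lookup [simp]: "exponent (Poly_Mapping.lookup m) = m"
  by (rule poly_mapping_eqI) simp

lemma indet_power: "indet v ^ n = Fract (Poly_Mapping.single (Poly_Mapping.single v n) 1) 1"
  by (induction n) (simp_all add: indet_def One_fract_def mult_single flip: single_add)

lemma prod_indet_power:
  fixes k :: "'v::{finite,linorder} \<Rightarrow> nat"
  shows "(\<Prod>v\<in>UNIV. indet v ^ k v) = Fract (Poly_Mapping.single (exponent k) 1) 1"
proof -
  have "(\<Prod>v\<in>A. indet v ^ k v) = Fract (Poly_Mapping.single (\<Sum>v\<in>A. Poly_Mapping.single v (k v)) 1) 1" for A
    by (induction A rule: infinite_finite_induct) (simp_all add: indet_power One_fract_def mult_single)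
  then show ?thesis by (simp add: exponent_def)
qed

lemma ratfun_monomial:
  fixes k :: "'v::{finite,linorder} \<Rightarrow> nat"
  shows "Fract (Poly_Mapping.single (exponent k) r) 1 = rat_const r * (\<Prod>v\<in>UNIV. indet v ^ k v)"
  by (simp add: prod_indet_power rat_const_def mult_single)

lemma rat_hom_unique:
  fixes f g :: "rat \<Rightarrow> 'f::field"
  assumes f: "is_ring_hom f" and g: "is_ring_hom g"
  shows "f r = g r"
proof (cases r)
  case (Fract a b)
  then have "r = of_int a / of_int b" by (simp add: Fract_of_int_quotient)
  then show ?thesis
    by (simp add: is_ring_hom_field(4)[OF f] is_ring_hom_field(4)[OF g] is_ring_homD[OF f] is_ring_homD[OF g])
qed

lemma ratfun_hom_eqI:
  fixes f g :: "'v::{finite,linorder} ratfun \<Rightarrow> 'f::field"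
  assumes f: "is_ring_hom f" and g: "is_ring_hom g" and eq: "\<And>v. f (indet v) = g (indet v)"
  shows "f = g"
proof (rule fract_hom_eqI[OF f g])
  fix a :: "('v \<Rightarrow>\<^sub>0 nat) \<Rightarrow>\<^sub>0 rat"
  show "f (Fract a 1) = g (Fract a 1)"
  proof (induction a rule: poly_mapping_additive_induct)
    case (single m c)
    have "f (rat_const c) = g (rat_const c)"
      by (rule rat_hom_unique[OF is_ring_hom_compose[OF f is_ring_hom_rat_const]
            is_ring_hom_compose[OF g is_ring_hom_rat_const]])
    then show ?case
      using ratfun_monomial[of "Poly_Mapping.lookup m" c]
      by (simp only: exponent_lookup is_ring_homD(3,7)[OF f] is_ring_homD(3,7)[OF g]
          is_ring_hom_prod[OF f] is_ring_hom_prod[OF g] eq)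
  next
    case (add p q)
    have "Fract (p + q) 1 = Fract p 1 + Fract q 1" by simp
    with add show ?case by (simp only: is_ring_homD(2)[OF f] is_ring_homD(2)[OF g])
  qed
qed

definition monomial_eval :: "('v::finite \<Rightarrow> 'f) \<Rightarrow> ('v \<Rightarrow>\<^sub>0 nat) \<Rightarrow> 'f::comm_ring_1" where
  "monomial_eval g m = (\<Prod>v\<in>UNIV. g v ^ Poly_Mapping.lookup m v)"

lemma is_ring_hom_eval_monomials:
  assumes "is_ring_hom h"
  shows "is_ring_hom (eval_poly_mapping h (monomial_eval g))"
  by (rule is_ring_hom_eval_poly_mapping[OF assms])
     (simp_all add: monomial_eval_def lookup_add power_add prod.distrib)

lemma monomial_eval_single: "monomial_eval g (Poly_Mapping.single v 1) = g v"
proof -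
  have "monomial_eval g (Poly_Mapping.single v 1) = (\<Prod>u\<in>UNIV. if u = v then g u else 1)"
    unfolding monomial_eval_def by (intro prod.cong) (auto simp: lookup_single when_def)
  then show ?thesis by simp
qed

text \<open>Algebraic independence of the images \<open>g v\<close>, in the form \<open>inj\<close>,
  is what lets the evaluation extend to fractions. It is applied to the inverted indeterminates and
  to the generators of the expansion in q^(1/2).\<close>

lemma ratfun_hom_exists:
  fixes g :: "'v::{finite,linorder} \<Rightarrow> 'f::field" and h :: "rat \<Rightarrow> 'f"
  assumes h: "is_ring_hom h"
    and inj: "\<And>p. eval_poly_mapping h (monomial_eval g) p = 0 \<Longrightarrow> p = 0"
  shows "\<exists>H. is_ring_hom H \<and> (\<forall>v. H (indet v) = g v)"
proof (intro exI conjI allI)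
  note hom = is_ring_hom_eval_monomials[OF h, of g]
  show "is_ring_hom (fract_lift (eval_poly_mapping h (monomial_eval g)))"
    by (rule is_ring_hom_fract_lift[OF hom inj])
  show "fract_lift (eval_poly_mapping h (monomial_eval g)) (indet v) = g v" for v
    unfolding indet_def
    by (subst fract_lift_Fract[OF hom inj])
       (simp_all add: is_ring_homD[OF hom] is_ring_homD[OF h] monomial_eval_single[unfolded One_nat_def])
qed

lemma Fract_sum: "Fract (sum f A) 1 = (\<Sum>x\<in>A. Fract (f x) 1)"
  by (rule is_ring_homD(8)[OF is_ring_hom_Fract])

lemma ratfun_monomials_independent:
  fixes e :: "'i \<Rightarrow> 'v::{finite,linorder} \<Rightarrow> nat"
  assumes "finite A" "inj_on e A" "(\<Sum>i\<in>A. rat_const (r i) * (\<Prod>v\<in>UNIV. indet v ^ e i v)) = 0" "i \<in> A"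
  shows "r i = 0"
proof -
  have "Fract (\<Sum>i\<in>A. Poly_Mapping.single (exponent (e i)) (r i)) 1 = 0"
    using assms(3) by (simp add: Fract_sum ratfun_monomial)
  then have "Poly_Mapping.lookup (\<Sum>i\<in>A. Poly_Mapping.single (exponent (e i)) (r i)) (exponent (e i)) = 0"
    by (simp only: Fract_1_eq_0_iff lookup_zero)
  moreover have "exponent (e j) = exponent (e i) \<longleftrightarrow> j = i" if "j \<in> A" for j
  proof
    assume "exponent (e j) = exponent (e i)"
    then have "e j = e i" by (metis ext lookup_exponent)
    then show "j = i" using assms(2,4) that by (auto dest: inj_onD)
  qed simp
  then have "Poly_Mapping.lookup (\<Sum>i\<in>A. Poly_Mapping.single (exponent (e i)) (r i)) (exponent (e i))
      = (\<Sum>j\<in>A. if j = i then r j else 0)"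
    unfolding lookup_sum lookup_single when_def by (intro sum.cong) auto
  ultimately show ?thesis using assms(1,4) by simp
qed

lemma indet_neq_0: "indet v \<noteq> 0"
proof -
  have "Poly_Mapping.lookup (Poly_Mapping.single (Poly_Mapping.single v (1::nat)) (1::rat)) (Poly_Mapping.single v 1) \<noteq> 0"
    by (simp add: lookup_single)
  then show ?thesis unfolding indet_def Fract_1_eq_0_iff by (metis lookup_zero)
qed

text \<open>A relation among the inverse indeterminates, multiplied by a high power \<open>B\<close>
  of every indeterminate, becomes a polynomial relation with exponents \<open>B - m\<close>, which
  are still pairwise distinct.\<close>

lemma ratfun_invert_hom:
  "\<exists>H. is_ring_hom H \<and> (\<forall>v. H (indet v) = inverse (indet v :: 'v::{finite,linorder} ratfun))"
proof (rule ratfun_hom_exists[OF is_ring_hom_rat_const])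
  fix p :: "('v \<Rightarrow>\<^sub>0 nat) \<Rightarrow>\<^sub>0 rat"
  assume p: "eval_poly_mapping rat_const (monomial_eval (\<lambda>v. inverse (indet v :: 'v ratfun))) p = 0"
  define B where "B = (\<Sum>m\<in>Poly_Mapping.keys p. \<Sum>v\<in>UNIV. Poly_Mapping.lookup m v)"
  have B: "Poly_Mapping.lookup m v \<le> B" if "m \<in> Poly_Mapping.keys p" for m v
  proof -
    have "Poly_Mapping.lookup m v \<le> (\<Sum>v\<in>UNIV. Poly_Mapping.lookup m v)" by (rule member_le_sum) auto
    also have "\<dots> \<le> B" unfolding B_def using that by (intro member_le_sum) auto
    finally show ?thesis .
  qed
  define e where "e m v = B - Poly_Mapping.lookup m v" for m :: "'v \<Rightarrow>\<^sub>0 nat" and v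
  have mono: "(\<Prod>v\<in>UNIV. indet v ^ B) * monomial_eval (\<lambda>v. inverse (indet v :: 'v ratfun)) m
      = (\<Prod>v\<in>UNIV. indet v ^ e m v)" if "m \<in> Poly_Mapping.keys p" for m
    unfolding monomial_eval_def prod.distrib[symmetric] e_def
    using B[OF that] by (intro prod.cong) (simp_all add: power_diff indet_neq_0 field_simps)
  have "(\<Sum>m\<in>Poly_Mapping.keys p. rat_const (Poly_Mapping.lookup p m) * (\<Prod>v\<in>UNIV. indet v ^ e m v :: 'v ratfun))
      = (\<Prod>v\<in>UNIV. indet v ^ B) * eval_poly_mapping rat_const (monomial_eval (\<lambda>v. inverse (indet v))) p"
    unfolding eval_poly_mapping_def sum_distrib_left using mono by (intro sum.cong) (simp_all add: mult_ac)
  also have "\<dots> = 0" using p by simp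
  finally have sum0: "(\<Sum>m\<in>Poly_Mapping.keys p. rat_const (Poly_Mapping.lookup p m) * (\<Prod>v\<in>UNIV. indet v ^ e m v :: 'v ratfun)) = 0" .
  have inj: "inj_on e (Poly_Mapping.keys p)"
  proof (rule inj_onI, rule poly_mapping_eqI)
    fix m n v assume "m \<in> Poly_Mapping.keys p" "n \<in> Poly_Mapping.keys p" "e m = e n"
    then show "Poly_Mapping.lookup m v = Poly_Mapping.lookup n v"
      using B[of m v] B[of n v] by (auto simp: e_def fun_eq_iff dest!: spec[of _ v])
  qed
  have "Poly_Mapping.keys p = {}"
    using ratfun_monomials_independent[OF _ inj sum0] by (metis equals0I finite_keys in_keys_iff)
  then show "p = 0" by simp
qed

section \<open>The involution of the ground field and the expansion in q^(1/2)\<close>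

lemma UNIV_5: "(UNIV :: 5 set) = {0, 1, 2, 3, 4}"
proof -
  have "x \<in> {0, 1, 2, 3, 4}" for x :: 5
  proof (cases x rule: bit1.cases)
    case (1 z)
    from 1(2,3) have z: "z = 0 \<or> z = 1 \<or> z = 2 \<or> z = 3 \<or> z = 4" by simp presburger
    show ?thesis unfolding 1(1) using z by (elim disjE) simp_all
  qed
  then show ?thesis by blast
qed

lemma UNIV_4: "(UNIV :: 4 set) = {0, 1, 2, 3}"
proof -
  have "x \<in> {0, 1, 2, 3}" for x :: 4
  proof (cases x rule: bit0.cases)
    case (1 z)
    from 1(2,3) have z: "z = 0 \<or> z = 1 \<or> z = 2 \<or> z = 3" by simp presburger
    show ?thesis unfolding 1(1) using z by (elim disjE) simp_all
  qed
  then show ?thesis by blast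
qed

lemma prod_UNIV_5: "(\<Prod>v\<in>(UNIV :: 5 set). f v) = f 0 * f 1 * f 2 * f 3 * (f 4 :: 'a::comm_monoid_mult)"
  unfolding UNIV_5 by (subst prod.insert, simp, simp)+ (simp add: mult.assoc)

lemma prod_UNIV_4: "(\<Prod>v\<in>(UNIV :: 4 set). f v) = f 0 * f 1 * f 2 * (f 3 :: 'a::comm_monoid_mult)"
  unfolding UNIV_4 by (subst prod.insert, simp, simp)+ (simp add: mult.assoc)

text \<open>The definite description is met: a homomorphism with the required values exists, and the
  values on the generators determine it. \<open>K_expand\<close> and \<open>T_pow\<close> are
  treated in the same way.\<close>

lemma is_ring_hom_K_star: "is_ring_hom K_star"
proof -
  obtain H :: "K \<Rightarrow> K" where H: "is_ring_hom H" "\<And>v. H (indet v) = inverse (indet v)"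
    using ratfun_invert_hom by blast
  let ?P = "\<lambda>h. is_ring_hom h \<and> (\<forall>x\<in>{sqrt_mab, par_b, sqrt_mcd, par_d, q_half}. h x = inverse x)"
  have "?P H" using H by (simp add: sqrt_mab_def par_b_def sqrt_mcd_def par_d_def q_half_def)
  moreover have "h = H" if "?P h" for h
  proof (rule ratfun_hom_eqI)
    fix v :: 5
    have "v \<in> {0, 1, 2, 3, 4}" using UNIV_5 by blast
    then show "h (indet v) = H (indet v)"
      using that H(2) by (auto simp: sqrt_mab_def par_b_def sqrt_mcd_def par_d_def q_half_def)
  qed (use that H in auto)
  ultimately have "?P K_star" unfolding K_star_def by (rule theI)
  then show ?thesis by blast
qed

definition K_expand_gen :: "5 \<Rightarrow> coef fls" where
  "K_expand_gen v = (if v = 0 then fls_const (indet 0) else if v = 1 then fls_const (indet 1)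
     else if v = 2 then fls_const (indet 2) * fls_X else if v = 3 then fls_const (indet 3) * fls_X
     else fls_X)"

text \<open>Monomials are sorted by the power \<open>d\<close> of \<open>fls_X\<close> in their
  image. Where \<open>d\<close> is fixed, the exponents of the first four indeterminates determine
  that of \<open>q_half\<close>, so the images stay independent.\<close>

lemma K_expand_inj:
  assumes "eval_poly_mapping (\<lambda>r. fls_const (rat_const r :: coef)) (monomial_eval K_expand_gen) p = 0"
  shows "p = 0"
proof (rule ccontr)
  assume "p \<noteq> 0"
  then have "\<exists>m. m \<in> Poly_Mapping.keys p" unfolding ex_in_conv by simp
  then obtain m0 where m0: "m0 \<in> Poly_Mapping.keys p" ..
  define d where "d m = Poly_Mapping.lookup m 2 + Poly_Mapping.lookup m 3 + Poly_Mapping.lookup m 4"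
    for m :: "5 \<Rightarrow>\<^sub>0 nat"
  define e :: "(5 \<Rightarrow>\<^sub>0 nat) \<Rightarrow> 4 \<Rightarrow> nat" where
    "e m v = Poly_Mapping.lookup m (if v = 0 then 0 else if v = 1 then 1 else if v = 2 then 2 else 3)" for m v
  define A where "A = {m \<in> Poly_Mapping.keys p. d m = d m0}"
  have mono: "monomial_eval K_expand_gen m = fls_const (\<Prod>v\<in>UNIV. indet v ^ e m v) * fls_X ^ d m" for m
  proof -
    define p where "p i = Poly_Mapping.lookup m i" for i
    have 1: "monomial_eval K_expand_gen m = fls_const (indet 0) ^ p 0 * fls_const (indet 1) ^ p 1 *
      (fls_const (indet 2) * fls_X) ^ p 2 * (fls_const (indet 3) * fls_X) ^ p 3 * fls_X ^ p 4"
      by (simp add: monomial_eval_def prod_UNIV_5 K_expand_gen_def p_def)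
    have 2: "(\<Prod>v\<in>UNIV. indet v ^ e m v :: coef) = indet 0 ^ p 0 * indet 1 ^ p 1 * indet 2 ^ p 2 * indet 3 ^ p 3"
      by (simp add: prod_UNIV_4 e_def p_def)
    show ?thesis
      unfolding 1 2 d_def p_def[symmetric] fls_const_mult_const[symmetric] fls_const_power[symmetric]
        power_add power_mult_distrib by (simp only: mult_ac)
  qed
  have nth: "fls_nth (fls_const c * fls_X ^ n) (int k) = (if n = k then c else 0)" for c :: coef and n k
    by (simp add: fls_X_power_conv_shift_1)
  have "(\<Sum>m\<in>A. rat_const (Poly_Mapping.lookup p m) * (\<Prod>v\<in>UNIV. indet v ^ e m v :: coef))
      = (\<Sum>m\<in>Poly_Mapping.keys p. if d m = d m0 then rat_const (Poly_Mapping.lookup p m) * (\<Prod>v\<in>UNIV. indet v ^ e m v) else 0)"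
    unfolding A_def by (simp add: sum.inter_filter)
  also have "\<dots> = fls_nth (eval_poly_mapping (\<lambda>r. fls_const (rat_const r :: coef)) (monomial_eval K_expand_gen) p) (int (d m0))"
    unfolding eval_poly_mapping_def mono mult.assoc[symmetric] fls_const_mult_const fls_nth_sum nth ..
  also have "\<dots> = 0" using assms by simp
  finally have sum0: "(\<Sum>m\<in>A. rat_const (Poly_Mapping.lookup p m) * (\<Prod>v\<in>UNIV. indet v ^ e m v :: coef)) = 0" .
  have "inj_on e A"
  proof (rule inj_onI, rule poly_mapping_eqI)
    fix m n :: "5 \<Rightarrow>\<^sub>0 nat" and v :: 5
    assume mn: "m \<in> A" "n \<in> A" "e m = e n"
    have eq: "Poly_Mapping.lookup m 0 = Poly_Mapping.lookup n 0" "Poly_Mapping.lookup m 1 = Poly_Mapping.lookup n 1"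
      "Poly_Mapping.lookup m 2 = Poly_Mapping.lookup n 2" "Poly_Mapping.lookup m 3 = Poly_Mapping.lookup n 3"
      using fun_cong[OF mn(3), of 0] fun_cong[OF mn(3), of 1] fun_cong[OF mn(3), of 2] fun_cong[OF mn(3), of 3]
      by (simp_all add: e_def)
    moreover have "Poly_Mapping.lookup m 4 = Poly_Mapping.lookup n 4"
      using mn(1,2) eq by (simp add: A_def d_def)
    moreover have "v \<in> {0, 1, 2, 3, 4}" using UNIV_5 by blast
    ultimately show "Poly_Mapping.lookup m v = Poly_Mapping.lookup n v" by auto
  qed
  moreover have "finite A" "m0 \<in> A" using m0 by (simp_all add: A_def)
  ultimately have "Poly_Mapping.lookup p m0 = 0"
    using ratfun_monomials_independent[OF _ _ sum0] by blast
  then show False using m0 by (simp add: in_keys_iff)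
qed

lemma K_expand:
  shows is_ring_hom_K_expand: "is_ring_hom K_expand"
    and K_expand_sqrt_mab: "K_expand sqrt_mab = fls_const (indet 0)"
    and K_expand_par_b: "K_expand par_b = fls_const (indet 1)"
    and K_expand_sqrt_mcd: "K_expand sqrt_mcd = fls_const (indet 2) * fls_X"
    and K_expand_par_d: "K_expand par_d = fls_const (indet 3) * fls_X"
    and K_expand_q_half: "K_expand q_half = fls_X"
proof -
  note defs = sqrt_mab_def par_b_def sqrt_mcd_def par_d_def q_half_def
  have "is_ring_hom (fls_const :: coef \<Rightarrow> coef fls)"
    by (simp add: is_ring_hom_def fls_plus_const fls_const_mult_const)
  then have "is_ring_hom (\<lambda>r. fls_const (rat_const r :: coef))"
    by (rule is_ring_hom_compose[OF _ is_ring_hom_rat_const])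
  from ratfun_hom_exists[OF this K_expand_inj]
  obtain H :: "K \<Rightarrow> coef fls" where H: "is_ring_hom H" "\<And>v. H (indet v) = K_expand_gen v" by blast
  let ?P = "\<lambda>h. is_ring_hom h \<and> h sqrt_mab = fls_const (indet 0) \<and> h par_b = fls_const (indet 1) \<and>
     h sqrt_mcd = fls_const (indet 2) * fls_X \<and> h par_d = fls_const (indet 3) * fls_X \<and> h q_half = fls_X"
  have "?P H" using H by (simp add: defs K_expand_gen_def)
  moreover have "h = H" if "?P h" for h
  proof (rule ratfun_hom_eqI)
    fix v :: 5
    have "v \<in> {0, 1, 2, 3, 4}" using UNIV_5 by blast
    then show "h (indet v) = H (indet v)"
      using that H(2) by (auto simp: defs K_expand_gen_def)
  qed (use that H in auto)
  ultimately have P: "?P K_expand" unfolding K_expand_def by (rule theI)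
  then show "is_ring_hom K_expand" "K_expand sqrt_mab = fls_const (indet 0)"
    "K_expand par_b = fls_const (indet 1)" "K_expand sqrt_mcd = fls_const (indet 2) * fls_X"
    "K_expand par_d = fls_const (indet 3) * fls_X" "K_expand q_half = fls_X" by blast+
qed

lemma K_expand_par_a: "K_expand par_a = fls_const coef_a"
  and K_expand_par_c: "K_expand par_c = fls_const coef_c' * fls_X"
  and K_expand_par_b': "K_expand par_b = fls_const coef_b"
  and K_expand_par_d': "K_expand par_d = fls_const coef_d' * fls_X"
  and K_expand_par_q: "K_expand par_q = fls_X ^ 2"
proof -
  have "fls_const (x / y) = fls_const x / fls_const y" for x y :: coef
    by (simp add: divide_inverse fls_inverse_const flip: fls_const_mult_const)
  then show "K_expand par_a = fls_const coef_a" "K_expand par_c = fls_const coef_c' * fls_X"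
    "K_expand par_b = fls_const coef_b" "K_expand par_d = fls_const coef_d' * fls_X"
    "K_expand par_q = fls_X ^ 2"
    by (simp_all add: par_a_def par_c_def par_q_def coef_a_def coef_b_def coef_c'_def coef_d'_def
        K_expand is_ring_homD[OF is_ring_hom_K_expand] is_ring_hom_field(4)[OF is_ring_hom_K_expand]
        power_mult_distrib fls_const_power power2_eq_square indet_neq_0
        del: fls_const_mult_const add: fls_const_mult_const[symmetric] fls_const_uminus[symmetric])
qed

section \<open>The substitutions z -> c z and z -> z^-1 on Laurent polynomials and rational
  functions\<close>

definition tau :: "K \<Rightarrow> laurent \<Rightarrow> laurent" where
  "tau c = eval_poly_mapping (Poly_Mapping.single 0) (\<lambda>n. Poly_Mapping.single n (c powi n))"

lemma lookup_tau: "Poly_Mapping.lookup (tau c f) k = c powi k * Poly_Mapping.lookup f k"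
  by (auto simp: tau_def eval_poly_mapping_def mult_single lookup_sum lookup_single when_def
      sum.delta not_in_keys_iff_lookup_eq_zero)

lemma is_ring_hom_tau: "c \<noteq> 0 \<Longrightarrow> is_ring_hom (tau c)"
  unfolding tau_def
  by (rule is_ring_hom_eval_poly_mapping[OF is_ring_hom_single_0]) (simp_all add: mult_single power_int_add)

lemma laurent_inv_eq: "laurent_inv = eval_poly_mapping (Poly_Mapping.single 0) (\<lambda>n. Poly_Mapping.single (- n) 1)"
  by (simp add: fun_eq_iff laurent_inv_def eval_poly_mapping_def mult_single)

lemma is_ring_hom_laurent_inv: "is_ring_hom laurent_inv"
  unfolding laurent_inv_eq
  by (rule is_ring_hom_eval_poly_mapping[OF is_ring_hom_single_0]) (simp_all add: mult_single)

lemma lookup_laurent_inv: "Poly_Mapping.lookup (laurent_inv f) k = Poly_Mapping.lookup f (- k)"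
proof -
  have "Poly_Mapping.lookup (laurent_inv f) k = (\<Sum>n\<in>Poly_Mapping.keys f. if n = - k then Poly_Mapping.lookup f n else 0)"
    unfolding laurent_inv_def lookup_sum lookup_single when_def by (intro sum.cong) auto
  then show ?thesis by (simp add: sum.delta' not_in_keys_iff_lookup_eq_zero)
qed

lemma laurent_inv_inv [simp]: "laurent_inv (laurent_inv f) = f"
  by (rule poly_mapping_eqI) (simp add: lookup_laurent_inv)

lemma laurent_inv_single [simp]: "laurent_inv (Poly_Mapping.single n c) = Poly_Mapping.single (- n) c"
  by (rule poly_mapping_eqI) (auto simp: lookup_laurent_inv lookup_single when_def)

lemma tau_single [simp]: "tau c (Poly_Mapping.single n x) = Poly_Mapping.single n (c powi n * x)"
  by (rule poly_mapping_eqI) (auto simp: lookup_tau lookup_single when_def)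

lemma is_ring_hom_of_laurent: "is_ring_hom of_laurent"
  unfolding of_laurent_def by (rule is_ring_hom_Fract)

lemma of_laurent_eq_0_iff: "of_laurent f = 0 \<longleftrightarrow> f = 0"
  by (simp add: of_laurent_def Fract_1_eq_0_iff)

lemma of_laurent_eq_iff: "of_laurent f = of_laurent g \<longleftrightarrow> f = g"
  by (simp add: of_laurent_def eq_fract)

lemma is_ring_hom_Kz_const: "is_ring_hom Kz_const"
  unfolding Kz_const_def laurent_const_def
  by (rule is_ring_hom_compose[OF is_ring_hom_of_laurent is_ring_hom_single_0])

lemma Kz_z_neq_0: "Kz_z \<noteq> 0"
  unfolding Kz_z_def of_laurent_eq_0_iff by (metis lookup_single_eq lookup_zero one_neq_zero)

lemma of_laurent_single: "of_laurent (Poly_Mapping.single k c) = Kz_const c * Kz_z powi k"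
proof -
  note D = is_ring_homD[OF is_ring_hom_of_laurent]
  have nat: "of_laurent (Poly_Mapping.single (int n) 1) = Kz_z ^ n" for n
  proof (induction n)
    case (Suc n)
    have "Poly_Mapping.single (int (Suc n)) (1::K) = Poly_Mapping.single 1 1 * Poly_Mapping.single (int n) 1"
      by (simp add: mult_single add.commute)
    then show ?case by (simp only: D(3) Suc Kz_z_def power_Suc)
  qed (simp add: D)
  have "of_laurent (Poly_Mapping.single k 1) = Kz_z powi k"
  proof (cases "k \<ge> 0")
    case True
    then show ?thesis using nat[of "nat k"] by (simp add: power_int_def)
  next
    case False
    have "of_laurent (Poly_Mapping.single k 1) * of_laurent (Poly_Mapping.single (- k) 1) = 1"
      by (simp add: D flip: D(3) add: mult_single)
    moreover have "of_laurent (Poly_Mapping.single (- k) 1) = Kz_z ^ nat (- k)"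
      using nat[of "nat (- k)"] False by simp
    ultimately show ?thesis using False Kz_z_neq_0
      by (simp add: power_int_def field_simps power_inverse)
  qed
  moreover have "of_laurent (Poly_Mapping.single k c) = Kz_const c * of_laurent (Poly_Mapping.single k 1)"
    by (simp add: Kz_const_def laurent_const_def mult_single flip: D(3))
  ultimately show ?thesis by simp
qed

lemma Kz_hom_eqI:
  assumes f: "is_ring_hom f" and g: "is_ring_hom g"
    and const: "\<And>k. f (Kz_const k) = g (Kz_const k)" and z: "f Kz_z = g Kz_z"
  shows "f = (g :: Kz \<Rightarrow> Kz)"
proof (rule fract_hom_eqI[OF f g])
  fix a :: laurent
  have "f (of_laurent a) = g (of_laurent a)"
    by (induction a rule: poly_mapping_additive_induct)
       (simp_all add: of_laurent_single is_ring_homD[OF is_ring_hom_of_laurent]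
        is_ring_homD(2,3)[OF f] is_ring_homD(2,3)[OF g] is_ring_hom_field(5)[OF f] is_ring_hom_field(5)[OF g] const z)
  then show "f (Fract a 1) = g (Fract a 1)" by (simp add: of_laurent_def)
qed

lemma q_half_neq_0: "q_half \<noteq> 0"
  by (simp add: q_half_def indet_neq_0)

lemma tau_eq_0_iff: "c \<noteq> 0 \<Longrightarrow> tau c f = 0 \<longleftrightarrow> f = 0"
  by (auto simp: poly_mapping_eq_iff fun_eq_iff lookup_tau)

lemma laurent_inv_eq_0_iff: "laurent_inv f = 0 \<longleftrightarrow> f = 0"
  by (metis is_ring_homD(4)[OF is_ring_hom_laurent_inv] laurent_inv_inv)

lemma of_laurent_lift:
  assumes h: "is_ring_hom h" and inj: "\<And>f. h f = 0 \<Longrightarrow> f = 0"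
  shows "is_ring_hom (fract_lift (\<lambda>f. of_laurent (h f)))"
    and "fract_lift (\<lambda>f. of_laurent (h f)) (of_laurent f) = of_laurent (h f)"
proof -
  have hom: "is_ring_hom (\<lambda>f. of_laurent (h f))"
    by (rule is_ring_hom_compose[OF is_ring_hom_of_laurent h])
  have inj': "f = 0" if "of_laurent (h f) = 0" for f
    using that inj by (simp add: of_laurent_eq_0_iff)
  show "is_ring_hom (fract_lift (\<lambda>f. of_laurent (h f)))"
    by (rule is_ring_hom_fract_lift[OF hom inj'])
  show "fract_lift (\<lambda>f. of_laurent (h f)) (of_laurent f) = of_laurent (h f)"
    unfolding of_laurent_def[of f] using fract_lift_Fract[OF hom inj', of 1 f]
    by (simp add: is_ring_homD(1)[OF hom])
qed

lemma T_pow: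
  shows is_ring_hom_T_pow: "is_ring_hom (T_pow n)"
    and T_pow_of_laurent: "T_pow n (of_laurent f) = of_laurent (tau (q_half powi n) f)"
proof -
  let ?P = "\<lambda>h. is_ring_hom h \<and> (\<forall>k. h (Kz_const k) = Kz_const k) \<and> h Kz_z = Kz_const (q_half powi n) * Kz_z"
  let ?H = "fract_lift (\<lambda>f. of_laurent (tau (q_half powi n) f))"
  have nz: "q_half powi n \<noteq> 0" by (simp add: q_half_neq_0)
  have inj: "f = 0" if "tau (q_half powi n) f = 0" for f using that tau_eq_0_iff[OF nz] by simp
  note L = of_laurent_lift[OF is_ring_hom_tau[OF nz] inj]
  have PH: "?P ?H"
    using L(1) by (auto simp: Kz_const_def laurent_const_def Kz_z_def L(2) mult_single
        simp flip: is_ring_homD(3)[OF is_ring_hom_of_laurent])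
  moreover have "h = ?H" if "?P h" for h
    using that PH by (intro Kz_hom_eqI) auto
  ultimately have "T_pow n = ?H" unfolding T_pow_def by (intro the_equality)
  then show "is_ring_hom (T_pow n)" "T_pow n (of_laurent f) = of_laurent (tau (q_half powi n) f)"
    by (simp_all add: L)
qed

lemma T_pow_const [simp]: "T_pow n (Kz_const k) = Kz_const k"
  and T_pow_z [simp]: "T_pow n Kz_z = Kz_const (q_half powi n) * Kz_z"
  by (simp_all add: Kz_const_def laurent_const_def Kz_z_def T_pow_of_laurent mult_single
        flip: is_ring_homD(3)[OF is_ring_hom_of_laurent])

definition Kz_inv :: "Kz \<Rightarrow> Kz" where
  "Kz_inv = fract_lift (\<lambda>f. of_laurent (laurent_inv f))"

lemma Kz_inv:
  shows is_ring_hom_Kz_inv: "is_ring_hom Kz_inv"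
    and Kz_inv_of_laurent: "Kz_inv (of_laurent f) = of_laurent (laurent_inv f)"
  unfolding Kz_inv_def
  by (rule of_laurent_lift[OF is_ring_hom_laurent_inv], simp add: laurent_inv_eq_0_iff)+

lemma Kz_inv_const [simp]: "Kz_inv (Kz_const k) = Kz_const k"
  and Kz_inv_z [simp]: "Kz_inv Kz_z = inverse Kz_z"
  using of_laurent_single[of "-1" 1]
  by (simp_all add: Kz_const_def laurent_const_def Kz_z_def Kz_inv_of_laurent
      is_ring_homD[OF is_ring_hom_of_laurent])

lemma T_pow_T_pow: "T_pow m (T_pow n x) = T_pow (m + n) x"
proof -
  have "(\<lambda>x. T_pow m (T_pow n x)) = T_pow (m + n)"
    by (rule Kz_hom_eqI[OF is_ring_hom_compose[OF is_ring_hom_T_pow is_ring_hom_T_pow] is_ring_hom_T_pow])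
       (simp_all add: is_ring_homD[OF is_ring_hom_T_pow] power_int_add q_half_neq_0
         is_ring_homD[OF is_ring_hom_Kz_const] mult_ac)
  then show ?thesis by (rule fun_cong)
qed

lemma T_pow_0 [simp]: "T_pow 0 x = x"
proof -
  have "T_pow 0 = (\<lambda>x. x)"
    by (rule Kz_hom_eqI[OF is_ring_hom_T_pow])
       (simp_all add: is_ring_hom_def is_ring_homD[OF is_ring_hom_Kz_const])
  then show ?thesis by (rule fun_cong)
qed

lemma Kz_inv_T_pow: "Kz_inv (T_pow n x) = T_pow (- n) (Kz_inv x)"
proof -
  have "(\<lambda>x. Kz_inv (T_pow n x)) = (\<lambda>x. T_pow (- n) (Kz_inv x))"
    by (rule Kz_hom_eqI[OF is_ring_hom_compose[OF is_ring_hom_Kz_inv is_ring_hom_T_pow]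
          is_ring_hom_compose[OF is_ring_hom_T_pow is_ring_hom_Kz_inv]])
       (simp_all add: is_ring_homD[OF is_ring_hom_Kz_inv] is_ring_hom_field(3)[OF is_ring_hom_T_pow]
         power_int_minus is_ring_hom_field(3)[OF is_ring_hom_Kz_const])
  then show ?thesis by (rule fun_cong)
qed

section \<open>Symmetries of the weight\<close>

text \<open>Extending the coefficients by zero to all integer exponents lets the reflections act,
  since they move exponents out of the quadrant.\<close>

definition ext2 :: "'a::zero fps fps \<Rightarrow> int \<times> int \<Rightarrow> 'a" where
  "ext2 F v = (if 0 \<le> fst v \<and> 0 \<le> snd v then fps_nth (fps_nth F (nat (fst v))) (nat (snd v)) else 0)"

lemma ext2_quadrant: "ext2 F v \<noteq> 0 \<Longrightarrow> 0 \<le> fst v \<and> 0 \<le> snd v"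
  by (auto simp: ext2_def split: if_splits)

lemma ext2_diff: "ext2 (F - G) v = ext2 F v - ext2 (G :: 'a::comm_ring_1 fps fps) v"
  and ext2_one: "ext2 (1 :: 'a fps fps) v = (if v = 0 then 1 else 0)"
  by (auto simp: ext2_def fps_one_def zero_prod_def prod_eq_iff)

lemma ext2_mult_box:
  fixes F G :: "'a::comm_ring_1 fps fps"
  shows "ext2 (F * G) v = (\<Sum>u \<in> {0..fst v} \<times> {0..snd v}. ext2 F u * ext2 G (v - u))"
proof (cases "0 \<le> fst v \<and> 0 \<le> snd v")
  case True
  define m n where "m = nat (fst v)" and "n = nat (snd v)"
  have v: "v = (int m, int n)" using True by (auto simp: m_def n_def prod_eq_iff)
  have "ext2 (F * G) v = (\<Sum>i=0..m. \<Sum>j=0..n. F $ i $ j * G $ (m - i) $ (n - j))"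
    by (simp add: ext2_def v fps_mult_nth fps_sum_nth)
  also have "\<dots> = (\<Sum>(i, j) \<in> {0..m} \<times> {0..n}. F $ i $ j * G $ (m - i) $ (n - j))"
    by (simp add: sum.cartesian_product)
  also have "\<dots> = (\<Sum>u \<in> {0..fst v} \<times> {0..snd v}. ext2 F u * ext2 G (v - u))"
    by (rule sum.reindex_bij_witness[of _ "\<lambda>u. (nat (fst u), nat (snd u))" "\<lambda>u. (int (fst u), int (snd u))"])
       (auto simp: v ext2_def nat_diff_distrib')
  finally show ?thesis .
qed (auto simp: ext2_def)

lemma ext2_convolution_subset:
  "{u. ext2 F u \<noteq> 0 \<and> ext2 G (v - u) \<noteq> (0::'a::zero)} \<subseteq> {0..fst v} \<times> {0..snd v}"
proof
  fix u assume "u \<in> {u. ext2 F u \<noteq> 0 \<and> ext2 G (v - u) \<noteq> 0}"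
  then show "u \<in> {0..fst v} \<times> {0..snd v}"
    using ext2_quadrant[of F u] ext2_quadrant[of G "v - u"] by (simp add: mem_Times_iff)
qed

lemma finite_ext2_convolution:
  "finite {u. ext2 F u \<noteq> 0 \<and> ext2 G (v - u) \<noteq> (0::'a::zero)}"
  by (rule finite_subset[OF ext2_convolution_subset]) simp

lemma ext2_mult:
  fixes F G :: "'a::comm_ring_1 fps fps"
  shows "ext2 (F * G) v =
    (\<Sum>u \<in> {u. ext2 F u \<noteq> 0 \<and> ext2 G (v - u) \<noteq> 0}. ext2 F u * ext2 G (v - u))"
  unfolding ext2_mult_box
  by (intro sum.mono_neutral_right ext2_convolution_subset) auto

text \<open>
  The degree \<open>lev\<close> is constant on orbits of \<open>rho\<close> and positive on the exponents other than \<open>0\<close>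
  that occur in an invariant series: inverses of invariant series are treated by induction on it.
\<close>

locale quadrant_reflection =
  fixes rho :: "int \<times> int \<Rightarrow> int \<times> int" and lev :: "int \<times> int \<Rightarrow> int"
  assumes rho_rho [simp]: "rho (rho v) = v"
    and rho_diff: "rho (u - v) = rho u - rho v"
    and lev_diff: "lev (u - v) = lev u - lev v"
    and lev_rho [simp]: "lev (rho v) = lev v"
    and lev_nonneg: "0 \<le> fst v \<Longrightarrow> 0 \<le> snd v \<Longrightarrow> 0 \<le> lev v"
    and lev_pos: "0 \<le> fst v \<Longrightarrow> 0 \<le> snd v \<Longrightarrow> 0 \<le> fst (rho v) \<Longrightarrow> 0 \<le> snd (rho v) \<Longrightarrow> v \<noteq> 0 \<Longrightarrow> 0 < lev v"
begin

text \<open>As a relation between power series this also demands that no nonzero coefficient of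
  \<open>F\<close> be reflected out of the quadrant.\<close>

definition reflects :: "'a::comm_ring_1 fps fps \<Rightarrow> 'a fps fps \<Rightarrow> bool" where
  "reflects F G \<longleftrightarrow> (\<forall>v. ext2 G v = ext2 F (rho v))"

lemma reflectsD: "reflects F G \<Longrightarrow> ext2 G v = ext2 F (rho v)"
  unfolding reflects_def by blast

lemma reflects_sym: "reflects F G \<Longrightarrow> reflects G F"
  unfolding reflects_def by (metis rho_rho)

lemma rho_0 [simp]: "rho 0 = 0"
  using rho_diff[of 0 0] by simp

lemma rho_eq_0_iff [simp]: "rho v = 0 \<longleftrightarrow> v = 0"
  by (metis rho_0 rho_rho)

lemma reflects_one: "reflects 1 1"
  by (simp add: reflects_def ext2_one)

lemma reflects_diff: "reflects F F' \<Longrightarrow> reflects G G' \<Longrightarrow> reflects (F - G) (F' - G')"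
  by (simp add: reflects_def ext2_diff)

lemma reflects_mult:
  assumes "reflects F F'" "reflects G G'"
  shows "reflects (F * G) (F' * G')"
  unfolding reflects_def
proof
  fix v
  show "ext2 (F' * G') v = ext2 (F * G) (rho v)"
    unfolding ext2_mult
    by (rule sum.reindex_bij_witness[of _ rho rho])
       (auto simp: reflectsD[OF assms(1)] reflectsD[OF assms(2)] rho_diff)
qed

lemma reflects_pair:
  assumes "reflects X Y"
  shows "reflects ((1 - X) * (1 - Y)) ((1 - X) * (1 - Y))"
  using reflects_mult[OF reflects_diff[OF reflects_one assms]
      reflects_diff[OF reflects_one reflects_sym[OF assms]]]
  by (simp add: mult.commute)

text \<open>\<open>F * G = 1\<close> determines the coefficients of \<open>G\<close> recursively. An
  exponent \<open>u\<close> of the invariant series \<open>F\<close> has both \<open>u\<close> and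
  \<open>rho u\<close> in the quadrant, hence \<open>lev u > 0\<close> for
  \<open>u \<noteq> 0\<close>, and the recursion refers to smaller levels only.\<close>

lemma reflects_inverse:
  fixes F G :: "'a::field fps fps"
  assumes F: "reflects F F" and FG: "F * G = 1"
  shows "reflects G G"
proof -
  have F00: "ext2 F 0 \<noteq> 0"
  proof -
    have "ext2 (F * G) 0 = ext2 F 0 * ext2 G 0"
      by (simp add: ext2_mult_box zero_prod_def)
    with FG show ?thesis by (auto simp: ext2_one)
  qed
  define T where "T v = {u. u \<noteq> 0 \<and> ext2 F u \<noteq> 0 \<and> ext2 G (v - u) \<noteq> 0}" for v
  have recur: "ext2 F 0 * ext2 G v = ext2 (1 :: 'a fps fps) v - (\<Sum>u\<in>T v. ext2 F u * ext2 G (v - u))" for v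
  proof -
    have fin: "finite (T v)"
      by (rule finite_subset[OF _ finite_ext2_convolution[of F G v]]) (auto simp: T_def)
    have "ext2 (F * G) v = (\<Sum>u\<in>insert 0 (T v). ext2 F u * ext2 G (v - u))"
      unfolding ext2_mult using fin by (intro sum.mono_neutral_left) (auto simp: T_def)
    also have "\<dots> = ext2 F 0 * ext2 G v + (\<Sum>u\<in>T v. ext2 F u * ext2 G (v - u))"
      using fin by (subst sum.insert) (auto simp: T_def)
    finally show ?thesis using FG by (simp add: algebra_simps)
  qed
  have "ext2 G (rho v) = ext2 G v" for v
  proof (induction "nat (lev v)" arbitrary: v rule: less_induct)
    case less
    have pos: "0 < lev u" if "u \<noteq> 0" "ext2 F u \<noteq> 0" for u
      using that ext2_quadrant[of F u] ext2_quadrant[of F "rho u"] reflectsD[OF F, of u]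
      by (intro lev_pos) auto
    \<comment> \<open>The exponent \<open>v - u\<close> may leave the quadrant. That one of the two
      coefficients is nonzero gives \<open>0 \<le> lev (v - u)\<close>, so the measure truncated by
      \<open>nat\<close> still decreases strictly.\<close>
    have IH: "ext2 G (rho (v - u)) = ext2 G (v - u)"
      if "u \<noteq> 0" "ext2 F u \<noteq> 0" "ext2 G (v - u) \<noteq> 0 \<or> ext2 G (rho (v - u)) \<noteq> 0" for u
    proof (rule less.hyps)
      have "0 \<le> lev (v - u)"
        using that(3) ext2_quadrant[of G] lev_nonneg lev_rho by metis
      then show "nat (lev (v - u)) < nat (lev v)"
        using pos[OF that(1,2)] by (simp add: lev_diff)
    qed
    have step: "u \<in> T v \<longleftrightarrow> rho u \<in> T (rho v)" for u
      using IH[of u] reflectsD[OF F, of u] by (auto simp: T_def rho_diff)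
    have "(\<Sum>u\<in>T (rho v). ext2 F u * ext2 G (rho v - u)) = (\<Sum>u\<in>T v. ext2 F u * ext2 G (v - u))"
    proof (rule sum.reindex_bij_witness[of _ rho rho])
      fix u assume "u \<in> T (rho v)"
      then show "rho u \<in> T v" using step[of "rho u"] by simp
      then show "ext2 F (rho u) * ext2 G (v - rho u) = ext2 F u * ext2 G (rho v - u)"
        using IH[of "rho u"] reflectsD[OF F, of u] by (simp add: T_def rho_diff)
    qed (auto simp: step)
    then have "ext2 F 0 * ext2 G (rho v) = ext2 F 0 * ext2 G v"
      unfolding recur by (simp add: ext2_one)
    then show ?case using F00 by simp
  qed
  then show ?thesis by (simp add: reflects_def)
qed

lemma reflects_LIMSEQ:
  assumes "f \<longlonglongrightarrow> F" "\<And>n. reflects (f n) (f n)"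
  shows "reflects F F"
proof -
  have "ext2 F v = ext2 F (rho v)" for v
  proof -
    have ev: "eventually (\<lambda>n. ext2 (f n) u = ext2 F u) sequentially" for u
      using assms(1) unfolding tendsto_fps_iff ext2_def
      by (auto elim!: allE[of _ "nat (fst u)"] eventually_mono)
    have "eventually (\<lambda>n. ext2 F v = ext2 F (rho v)) sequentially"
      using ev[of v] ev[of "rho v"] by eventually_elim (use reflectsD[OF assms(2)] in metis)
    then show ?thesis by simp
  qed
  then show ?thesis by (simp add: reflects_def)
qed

end

text \<open>In z^i w^j = q^(j/2) z^(i-j), replacing z by z^-1 keeps j and negates i - j, which gives
  (i, j) -> (2 j - i, j). Replacing z by q z^-1 gives (i, j) -> (i, 2 i - j).\<close>

interpretation inv_z: quadrant_reflection "\<lambda>v. (2 * snd v - fst v, snd v)" snd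
  by unfold_locales (auto simp: prod_eq_iff)

interpretation q_inv_z: quadrant_reflection "\<lambda>v. (fst v, 2 * fst v - snd v)" fst
  by unfold_locales (auto simp: prod_eq_iff)

section \<open>Infinite q-Pochhammer products as limits of power series\<close>

lemma LIMSEQ_mult_fps:
  fixes f g :: "nat \<Rightarrow> 'a::comm_ring_1 fps"
  assumes "f \<longlonglongrightarrow> F" "g \<longlonglongrightarrow> G"
  shows "(\<lambda>n. f n * g n) \<longlonglongrightarrow> F * G"
  unfolding tendsto_fps_iff
proof
  fix m
  have "eventually (\<lambda>n. \<forall>i\<in>{0..m}. f n $ i = F $ i) sequentially"
    "eventually (\<lambda>n. \<forall>i\<in>{0..m}. g n $ i = G $ i) sequentially"
    using assms unfolding tendsto_fps_iff by (auto intro!: eventually_ball_finite)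
  then show "eventually (\<lambda>n. (f n * g n) $ m = (F * G) $ m) sequentially"
    by eventually_elim (auto simp: fps_mult_nth intro!: sum.cong)
qed

text \<open>Convergence means that each coefficient in the outer variable z becomes stationary.
  Therefore \<open>Q\<close> must have no term free of z, while for \<open>x\<close> a vanishing
  constant term suffices: it makes the limit nonzero, as \<open>has_prod\<close> demands.\<close>

lemma qpoch_LIMSEQ:
  assumes x: "x $ 0 $ 0 = 0" and Q: "Q $ 0 = 0"
  shows "(\<lambda>n. \<Prod>j<n. 1 - x * Q ^ j) \<longlonglongrightarrow> qpoch_inf x Q"
    and "qpoch_inf x Q $ 0 $ 0 = 1"
proof -
  define P where "P n = (\<Prod>j<n. 1 - x * Q ^ j)" for n
  have Qpow: "(F * Q ^ n) $ i = 0" if "i < n" for F n i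
  proof -
    have "\<forall>k<n. (Q ^ n) $ k = 0" by (rule startsby_zero_power_prefix) (rule Q)
    then show ?thesis using that by (auto simp: fps_mult_nth intro!: sum.neutral)
  qed
  have step: "P (Suc n) $ i = P n $ i" if "i < n" for n i
    using Qpow[OF that, of "P n * x"] by (simp add: P_def algebra_simps)
  define G where "G = Abs_fps (\<lambda>i. P (Suc i) $ i)"
  have stable: "P n $ i = G $ i" if "Suc i \<le> n" for n i
    using that by (induction n rule: dec_induct) (auto simp: G_def step)
  have lim: "P \<longlonglongrightarrow> G"
    unfolding tendsto_fps_iff eventually_sequentially using stable by blast
  have G00: "G $ 0 $ 0 = 1"
    unfolding stable[of 0 1, symmetric, simplified] using x by (simp add: P_def)
  then have "G \<noteq> 0" by auto
  moreover have "(\<lambda>n. \<Prod>j\<le>n. 1 - x * Q ^ j) \<longlonglongrightarrow> G"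
    using LIMSEQ_Suc[OF lim] by (simp add: P_def lessThan_Suc_atMost)
  ultimately have "(\<lambda>j. 1 - x * Q ^ j) has_prod G"
    by (simp add: has_prod_def raw_has_prod_def)
  then have "qpoch_inf x Q = G"
    unfolding qpoch_inf_def by (rule has_prod_unique[symmetric])
  with lim G00 show "(\<lambda>n. \<Prod>j<n. 1 - x * Q ^ j) \<longlonglongrightarrow> qpoch_inf x Q" "qpoch_inf x Q $ 0 $ 0 = 1"
    by (simp_all add: P_def[abs_def])
qed

lemma qpoch_split:
  assumes x: "x $ 0 $ 0 = 0" and Q: "Q $ 0 = 0"
  shows "qpoch_inf x Q = (1 - x) * qpoch_inf (x * Q) Q"
proof -
  have "(\<lambda>n. (1 - x) * (\<Prod>j<n. 1 - x * Q * Q ^ j)) \<longlonglongrightarrow> (1 - x) * qpoch_inf (x * Q) Q"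
    by (intro LIMSEQ_mult_fps qpoch_LIMSEQ(1) tendsto_const) (simp_all add: Q fps_mult_nth)
  moreover have "(1 - x) * (\<Prod>j<n. 1 - x * Q * Q ^ j) = (\<Prod>j<Suc n. 1 - x * Q ^ j)" for n
    by (subst prod.lessThan_Suc_shift) (simp add: algebra_simps)
  ultimately have "(\<lambda>n. \<Prod>j<Suc n. 1 - x * Q ^ j) \<longlonglongrightarrow> (1 - x) * qpoch_inf (x * Q) Q"
    by (simp only:)
  with LIMSEQ_Suc[OF qpoch_LIMSEQ(1)[OF x Q]] show ?thesis by (rule LIMSEQ_unique)
qed

text \<open>The reflection exchanges the j-th factors of the two products, so each partial product
  is invariant.\<close>

lemma (in quadrant_reflection) reflects_qpoch_mult:
  assumes "x $ 0 $ 0 = 0" "y $ 0 $ 0 = 0" "Q $ 0 = 0" "\<And>j. reflects (x * Q ^ j) (y * Q ^ j)"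
  shows "reflects (qpoch_inf x Q * qpoch_inf y Q) (qpoch_inf x Q * qpoch_inf y Q)"
proof (rule reflects_LIMSEQ)
  show "(\<lambda>n. (\<Prod>j<n. 1 - x * Q ^ j) * (\<Prod>j<n. 1 - y * Q ^ j)) \<longlonglongrightarrow> qpoch_inf x Q * qpoch_inf y Q"
    by (intro LIMSEQ_mult_fps qpoch_LIMSEQ(1) assms)
  show "reflects ((\<Prod>j<n. 1 - x * Q ^ j) * (\<Prod>j<n. 1 - y * Q ^ j))
      ((\<Prod>j<n. 1 - x * Q ^ j) * (\<Prod>j<n. 1 - y * Q ^ j))" for n
  proof (induction n)
    case (Suc n)
    from reflects_mult[OF Suc reflects_pair[OF assms(4)[of n]]] show ?case
      by (simp add: mult_ac)
  qed (simp add: reflects_one)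
qed

section \<open>Monomials in z and w, and the coefficients of the weight\<close>

abbreviation zz :: "coef fps fps" where "zz \<equiv> fps_X"
abbreviation ww :: "coef fps fps" where "ww \<equiv> fps_const fps_X"
abbreviation kk :: "coef \<Rightarrow> coef fps fps" where "kk x \<equiv> fps_const (fps_const x)"

lemma ext2_monomial:
  "ext2 (kk x * (zz ^ i * ww ^ j)) v = (if v = (int i, int j) then x else 0)"
proof -
  have "kk x * (zz ^ i * ww ^ j) = fps_const (fps_const x * fps_X ^ j) * fps_X ^ i"
    by (simp add: fps_const_power mult_ac flip: fps_const_mult)
  then have "(kk x * (zz ^ i * ww ^ j)) $ m $ n = (if m = i \<and> n = j then x else 0)" for m n
    by (simp add: fps_X_power_nth)
  then show ?thesis by (auto simp: ext2_def prod_eq_iff)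
qed

lemma ext2_const_mult: "ext2 (kk x * F) v = x * ext2 F v"
  by (simp add: ext2_def)

lemma ext2_z_mult: "ext2 (zz * F) (m, n) = ext2 F (m - 1, n)"
  by (auto simp: ext2_def nat_diff_distrib)

lemma ext2_w_mult: "ext2 (ww * F) (m, n) = ext2 F (m, n - 1)"
  by (auto simp: ext2_def nat_diff_distrib)

text \<open>The coefficient of \<open>z\<^sup>n\<close>, obtained from \<open>z\<^bsup>n+j\<^esup> w\<^sup>j = q\<^bsup>j/2\<^esup> z\<^sup>n\<close>.\<close>

definition weight_coeff :: "coef fps fps \<Rightarrow> int \<Rightarrow> coef fls" where
  "weight_coeff F n = fps_to_fls (Abs_fps (\<lambda>j. ext2 F (n + int j, int j)))"

lemma weight_coeff_nth: "fls_nth (weight_coeff F n) j = ext2 F (n + j, j)"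
  by (simp add: weight_coeff_def ext2_def)

lemma AW_weight_coeff_eq: "AW_weight_coeff = weight_coeff AW_weight"
  by (auto simp: AW_weight_coeff_def weight_coeff_def ext2_def fun_eq_iff intro!: arg_cong[of _ _ Abs_fps])

lemma weight_coeff_diff: "weight_coeff (F - G) n = weight_coeff F n - weight_coeff G n"
  and weight_coeff_const: "weight_coeff (kk x * F) n = fls_const x * weight_coeff F n"
  and weight_coeff_z: "weight_coeff (zz * F) n = weight_coeff F (n - 1)"
  and weight_coeff_w: "weight_coeff (ww * F) n = fls_X * weight_coeff F (n + 1)"
  by (simp_all add: fls_eq_iff weight_coeff_nth ext2_diff ext2_const_mult ext2_z_mult
      ext2_w_mult fls_X_times_conv_shift add_ac diff_add_eq add_diff_eq)

lemma weight_coeff_inv_z: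
  assumes "inv_z.reflects F F"
  shows "weight_coeff F (- n) = weight_coeff F n"
proof -
  have "ext2 F (- n + j, j) = ext2 F (n + j, j)" for j
    using inv_z.reflectsD[OF assms, of "(n + j, j)"] by (simp add: algebra_simps)
  then show ?thesis by (simp add: fls_eq_iff weight_coeff_nth)
qed

lemma weight_coeff_q_inv_z:
  assumes "q_inv_z.reflects F F"
  shows "weight_coeff F (- n) = fls_X powi (2 * n) * weight_coeff F n"
proof -
  have "ext2 F (- n + j, j) = ext2 F (n + (j - 2 * n), j - 2 * n)" for j
    using q_inv_z.reflectsD[OF assms, of "(- n + j, j)"] by (simp add: algebra_simps)
  then show ?thesis by (simp add: fls_eq_iff weight_coeff_nth fls_X_intpow_times_conv_shift)
qed

definition mon :: "coef \<Rightarrow> nat \<Rightarrow> nat \<Rightarrow> coef fps fps" where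
  "mon x i j = kk x * (zz ^ i * ww ^ j)"

lemma mon_mult: "mon x i j * mon y k l = mon (x * y) (i + k) (j + l)"
  by (simp add: mon_def power_add mult_ac flip: fps_const_mult)

lemma mon_power: "mon x i j ^ n = mon (x ^ n) (n * i) (n * j)"
  by (induction n) (simp_all add: mon_mult add_ac, simp add: mon_def)

lemma mon_nth_0_0: "mon x i j $ 0 $ 0 = (if i = 0 \<and> j = 0 then x else 0)"
  using ext2_monomial[of x i j 0] by (simp add: ext2_def mon_def zero_prod_def)

lemma mon_nth_0: "i > 0 \<Longrightarrow> mon x i j $ 0 = 0"
  by (cases i) (simp_all add: mon_def mult_ac)

definition QQ :: "coef fps fps" where "QQ = mon 1 2 2"

lemma QQ_nth_0 [simp]: "QQ $ 0 = 0"
  by (simp add: QQ_def mon_nth_0)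

lemma mon_QQ_power: "mon x i j * QQ ^ n = mon x (i + 2 * n) (j + 2 * n)"
  by (simp add: QQ_def mon_power mon_mult mult.commute)

lemma mon_QQ: "mon x i j * QQ = mon x (i + 2) (j + 2)"
  by (simp add: QQ_def mon_mult)

text \<open>Every factor of the weight has this form, with q = z^2 w^2; for instance c z = c' z^2 w
  and a q z^-1 = a z w^2.\<close>

definition qp :: "coef \<Rightarrow> nat \<Rightarrow> nat \<Rightarrow> coef fps fps" where
  "qp x i j = qpoch_inf (mon x i j) QQ"

lemma qp_split:
  assumes "i + j > 0"
  shows "qp x i j = (1 - mon x i j) * qp x (i + 2) (j + 2)"
proof -
  have "mon x i j $ 0 $ 0 = 0" using assms by (auto simp: mon_nth_0_0)
  from qpoch_split[OF this QQ_nth_0] show ?thesis by (simp add: qp_def mon_QQ)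
qed

lemma qp_nth_0_0: "i + j > 0 \<Longrightarrow> qp x i j $ 0 $ 0 = 1"
  unfolding qp_def by (intro qpoch_LIMSEQ(2)) (auto simp: mon_nth_0_0)

text \<open>The exponents (1, 0) and (2, 0) leave the quadrant under z -> z^-1, and (0, 1) and (0,
  2) leave it under z -> q z^-1. Once its first factor is split off, each of these products has a
  partner.\<close>

lemma qp_splits:
  "qp x 1 0 = (1 - mon x 1 0) * qp x 3 2" "qp x 0 1 = (1 - mon x 0 1) * qp x 2 3"
  "qp x 2 0 = (1 - mon x 2 0) * qp x 4 2" "qp x 0 2 = (1 - mon x 0 2) * qp x 2 4"
  using qp_split[of 1 0 x] qp_split[of 0 1 x] qp_split[of 2 0 x] qp_split[of 0 2 x]
  by (simp_all add: eval_nat_numeral)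

lemma inv_z_reflects_qp:
  assumes "i + j > 0" "i \<le> 2 * j"
  shows "inv_z.reflects (qp x i j * qp x (2 * j - i) j) (qp x i j * qp x (2 * j - i) j)"
  unfolding qp_def
proof (rule inv_z.reflects_qpoch_mult)
  show "inv_z.reflects (mon x i j * QQ ^ n) (mon x (2 * j - i) j * QQ ^ n)" for n
    unfolding inv_z.reflects_def mon_QQ_power unfolding mon_def ext2_monomial
    using assms by (auto simp: of_nat_diff)
qed (use assms in \<open>auto simp: mon_nth_0_0\<close>)

lemma q_inv_z_reflects_qp:
  assumes "i + j > 0" "j \<le> 2 * i"
  shows "q_inv_z.reflects (qp x i j * qp x i (2 * i - j)) (qp x i j * qp x i (2 * i - j))"
  unfolding qp_def
proof (rule q_inv_z.reflects_qpoch_mult)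
  show "q_inv_z.reflects (mon x i j * QQ ^ n) (mon x i (2 * i - j) * QQ ^ n)" for n
    unfolding q_inv_z.reflects_def mon_QQ_power unfolding mon_def ext2_monomial
    using assms by (auto simp: of_nat_diff)
qed (use assms in \<open>auto simp: mon_nth_0_0\<close>)

lemma inv_z_reflects_pairs:
  "inv_z.reflects (qp x 3 2 * qp x 1 2) (qp x 3 2 * qp x 1 2)"
  "inv_z.reflects (qp x 2 1 * qp x 0 1) (qp x 2 1 * qp x 0 1)"
  "inv_z.reflects (qp x 4 2 * qp x 0 2) (qp x 4 2 * qp x 0 2)"
  using inv_z_reflects_qp[of 3 2 x] inv_z_reflects_qp[of 2 1 x] inv_z_reflects_qp[of 4 2 x]
  by simp_all

lemma q_inv_z_reflects_pairs:
  "q_inv_z.reflects (qp x 1 0 * qp x 1 2) (qp x 1 0 * qp x 1 2)"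
  "q_inv_z.reflects (qp x 2 1 * qp x 2 3) (qp x 2 1 * qp x 2 3)"
  "q_inv_z.reflects (qp x 2 0 * qp x 2 4) (qp x 2 0 * qp x 2 4)"
  using q_inv_z_reflects_qp[of 1 0 x] q_inv_z_reflects_qp[of 2 1 x] q_inv_z_reflects_qp[of 2 0 x]
  by (simp_all add: eval_nat_numeral)

lemma fps_fps_inverse:
  fixes F :: "'a::field fps fps"
  assumes "F $ 0 $ 0 \<noteq> 0"
  shows "F * inverse F = 1"
proof -
  have "F $ 0 * inverse (F $ 0) = 1"
    using assms by (subst mult.commute) (rule inverse_mult_eq_1)
  then show ?thesis
    unfolding fps_inverse_def by (rule fps_right_inverse)
qed

definition AW_denom :: "coef fps fps" where
  "AW_denom = qp coef_a 1 0 * qp coef_b 1 0 * qp coef_c' 2 1 * qp coef_d' 2 1 *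
     qp coef_a 1 2 * qp coef_b 1 2 * qp coef_c' 0 1 * qp coef_d' 0 1"

lemma AW_weight_eq: "AW_weight = qp 1 2 0 * qp 1 0 2 * inverse AW_denom"
  by (simp add: AW_weight_def AW_denom_def qp_def Let_def mon_def QQ_def power2_eq_square mult_ac
      flip: fps_const_mult)

lemma AW_denom_inverse: "AW_denom * inverse AW_denom = 1"
  by (rule fps_fps_inverse) (simp add: AW_denom_def qp_nth_0_0)

text \<open>The quotient of the weight by 1 - z^2, written without division.\<close>

definition AW_weight_half :: "coef fps fps" where
  "AW_weight_half = qp 1 4 2 * qp 1 0 2 * inverse AW_denom"

definition AW_weight_sym :: "coef fps fps" where
  "AW_weight_sym = (1 - mon coef_a 1 0) * ((1 - mon coef_b 1 0) * AW_weight_half)"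

definition AW_weight_q_sym :: "coef fps fps" where
  "AW_weight_q_sym = qp 1 2 0 * qp 1 2 4 *
     ((1 - mon coef_c' 0 1) * ((1 - mon coef_d' 0 1) * inverse AW_denom))"

lemma AW_weight_half: "AW_weight = (1 - mon 1 2 0) * AW_weight_half"
  by (simp only: AW_weight_eq AW_weight_half_def qp_splits(3) mult_ac)

lemma AW_weight_q_sym:
  "(1 - mon coef_c' 0 1) * ((1 - mon coef_d' 0 1) * AW_weight) = (1 - mon 1 0 2) * AW_weight_q_sym"
  by (simp only: AW_weight_eq AW_weight_q_sym_def qp_splits(4) mult_ac)

text \<open>The factors 1 - a z and 1 - b z cancel the unpaired factors of the denominator. What
  remains is the inverse of a product \<open>D\<close> of reflected pairs.\<close>

lemma inv_z_reflects_AW_weight_sym: "inv_z.reflects AW_weight_sym AW_weight_sym"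
proof -
  define D where "D = (qp coef_a 3 2 * qp coef_a 1 2) * ((qp coef_b 3 2 * qp coef_b 1 2) *
    ((qp coef_c' 2 1 * qp coef_c' 0 1) * (qp coef_d' 2 1 * qp coef_d' 0 1)))"
  define I where "I = (1 - mon coef_a 1 0) * ((1 - mon coef_b 1 0) * inverse AW_denom)"
  have "AW_denom = (1 - mon coef_a 1 0) * ((1 - mon coef_b 1 0) * D)"
    by (simp only: AW_denom_def D_def qp_splits(1) mult_ac)
  then have "D * I = AW_denom * inverse AW_denom"
    by (simp add: I_def mult_ac)
  then have DI: "D * I = 1" by (simp add: AW_denom_inverse)
  have "inv_z.reflects D D"
    unfolding D_def
    by (rule inv_z.reflects_mult[OF inv_z_reflects_pairs(1) inv_z.reflects_mult[OF inv_z_reflects_pairs(1)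
          inv_z.reflects_mult[OF inv_z_reflects_pairs(2) inv_z_reflects_pairs(2)]]])
  then have "inv_z.reflects I I" using DI by (rule inv_z.reflects_inverse)
  then have "inv_z.reflects (qp 1 4 2 * qp 1 0 2 * I) (qp 1 4 2 * qp 1 0 2 * I)"
    by (rule inv_z.reflects_mult[OF inv_z_reflects_pairs(3)])
  then show ?thesis by (simp add: AW_weight_sym_def AW_weight_half_def I_def mult_ac)
qed

lemma q_inv_z_reflects_AW_weight_q_sym: "q_inv_z.reflects AW_weight_q_sym AW_weight_q_sym"
proof -
  define D where "D = (qp coef_a 1 0 * qp coef_a 1 2) * ((qp coef_b 1 0 * qp coef_b 1 2) *
    ((qp coef_c' 2 1 * qp coef_c' 2 3) * (qp coef_d' 2 1 * qp coef_d' 2 3)))"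
  define I where "I = (1 - mon coef_c' 0 1) * ((1 - mon coef_d' 0 1) * inverse AW_denom)"
  have "AW_denom = (1 - mon coef_c' 0 1) * ((1 - mon coef_d' 0 1) * D)"
    by (simp only: AW_denom_def D_def qp_splits(2) mult_ac)
  then have "D * I = AW_denom * inverse AW_denom"
    by (simp add: I_def mult_ac)
  then have DI: "D * I = 1" by (simp add: AW_denom_inverse)
  have "q_inv_z.reflects D D"
    unfolding D_def
    by (rule q_inv_z.reflects_mult[OF q_inv_z_reflects_pairs(1) q_inv_z.reflects_mult[OF q_inv_z_reflects_pairs(1)
          q_inv_z.reflects_mult[OF q_inv_z_reflects_pairs(2) q_inv_z_reflects_pairs(2)]]])
  then have "q_inv_z.reflects I I" using DI by (rule q_inv_z.reflects_inverse)
  then have "q_inv_z.reflects (qp 1 2 0 * qp 1 2 4 * I) (qp 1 2 0 * qp 1 2 4 * I)"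
    by (rule q_inv_z.reflects_mult[OF q_inv_z_reflects_pairs(3)])
  then show ?thesis by (simp add: AW_weight_q_sym_def I_def mult_ac)
qed

text \<open>At q^(1/2) = 0 only the terms z^n w^0 remain. The reflection exchanges (n, 0) with (-n,
  0), and one of them lies outside the quadrant unless n = 0.\<close>

lemma AW_weight_sym_at_0: "fls_nth (weight_coeff AW_weight_sym n) 0 = (if n = 0 then 1 else 0)"
proof -
  have "ext2 AW_weight_sym (n, 0) = 0" if "n \<noteq> 0"
    using that inv_z.reflectsD[OF inv_z_reflects_AW_weight_sym, of "(n, 0)"]
    by (cases "n > 0") (simp_all add: ext2_def)
  moreover have "ext2 AW_weight_sym (0, 0) = 1"
  proof -
    have "AW_weight_sym $ 0 $ 0 = (AW_denom * inverse AW_denom) $ 0 $ 0"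
      using qp_nth_0_0[of 4 2 1] qp_nth_0_0[of 0 2 1]
      by (simp add: AW_weight_sym_def AW_weight_half_def mon_nth_0 AW_denom_def qp_nth_0_0)
    then show ?thesis by (simp add: AW_denom_inverse ext2_def)
  qed
  ultimately show ?thesis by (simp add: weight_coeff_nth)
qed

section \<open>Self-adjointness of the Askey--Wilson operator\<close>

lemma ratfun_two_neq_0: "(2 :: 'v::{finite,linorder} ratfun) \<noteq> 0"
proof -
  have "(rat_const (of_nat 2) :: 'v ratfun) = of_nat 2"
    by (rule is_ring_homD(9)[OF is_ring_hom_rat_const])
  moreover have "(rat_const (of_nat 2) :: 'v ratfun) \<noteq> 0"
    by (simp add: is_ring_hom_field(1)[OF is_ring_hom_rat_const])
  ultimately show ?thesis by simp
qed

lemma coef_fls_two_neq_0: "(2 :: coef fls) \<noteq> 0"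
proof -
  have "K_expand (of_nat 2) = of_nat 2" by (rule is_ring_homD(9)[OF is_ring_hom_K_expand])
  moreover have "K_expand (of_nat 2) \<noteq> 0"
    using is_ring_hom_field(1)[OF is_ring_hom_K_expand] ratfun_two_neq_0 by simp
  ultimately show ?thesis by simp
qed

section \<open>Constant terms of Laurent polynomials against a weight\<close>

definition ct :: "coef fps fps \<Rightarrow> laurent \<Rightarrow> coef fls" where
  "ct F = eval_poly_mapping K_expand (\<lambda>k. weight_coeff F (- k))"

lemma AW_pairing_eq_ct: "AW_pairing f g = ct AW_weight (f * laurent_star g)"
  by (simp add: AW_pairing_def ct_def eval_poly_mapping_def Let_def AW_weight_coeff_eq)

lemma ct_add: "ct F (f + g) = ct F f + ct F g"
  unfolding ct_def by (rule eval_poly_mapping_add) (rule is_ring_homD(2)[OF is_ring_hom_K_expand])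

lemma ct_single: "ct F (Poly_Mapping.single k c) = K_expand c * weight_coeff F (- k)"
  by (simp add: ct_def is_ring_homD[OF is_ring_hom_K_expand])

lemma ct_0 [simp]: "ct F 0 = 0"
  by (simp add: ct_def eval_poly_mapping_def)

lemma ct_uminus: "ct F (- f) = - ct F f"
  using ct_add[of F f "- f"] by (simp add: eq_neg_iff_add_eq_0 add.commute)

lemma ct_diff: "ct F (f - g) = ct F f - ct F g"
  using ct_add[of F f "- g"] by (simp add: ct_uminus)

lemma ct_const: "ct F (laurent_const c * f) = K_expand c * ct F f"
  by (induction f rule: poly_mapping_additive_induct)
     (simp_all add: laurent_const_def mult_single ct_single ct_add distrib_left is_ring_homD[OF is_ring_hom_K_expand])

lemma ct_sum: "ct F (sum f A) = (\<Sum>x\<in>A. ct F (f x))"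
  by (induction A rule: infinite_finite_induct) (simp_all add: ct_add)

lemma weight_coeff_mon:
  "weight_coeff (mon x i j * F) n = fls_const x * fls_X ^ j * weight_coeff F (n - int i + int j)"
proof -
  have z: "weight_coeff (zz ^ i * F) n = weight_coeff F (n - int i)" for F n
    by (induction i arbitrary: n) (simp_all add: mult.assoc weight_coeff_z diff_diff_eq)
  have w: "weight_coeff (ww ^ j * F) n = fls_X ^ j * weight_coeff F (n + int j)" for F n
  proof (induction j arbitrary: n)
    case (Suc j)
    have "ww ^ Suc j * F = ww * (ww ^ j * F)" by (simp only: power_Suc mult.assoc)
    then show ?case by (simp only: weight_coeff_w Suc) (simp add: algebra_simps)
  qed simp
  show ?thesis by (simp only: mon_def mult.assoc weight_coeff_const z w)
qed

text \<open>Since z^i w^j = q^(j/2) z^(i-j), a monomial factor of the weight can be moved to the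
  Laurent polynomial, where its power of q^(1/2) is absorbed into the constant
  \<open>c\<close>.\<close>

lemma ct_mon:
  assumes "K_expand c = fls_const x * fls_X ^ j"
  shows "ct (mon x i j * F) h = ct F (Poly_Mapping.single (int i - int j) c * h)"
proof (induction h rule: poly_mapping_additive_induct)
  case (single k y)
  have "- k - int i + int j = - (int i - int j + k)" by simp
  then show ?case
    unfolding ct_single mult_single weight_coeff_mon is_ring_homD(3)[OF is_ring_hom_K_expand] assms
    by (simp only: mult_ac)
qed (simp_all add: ct_add distrib_left)

lemma ct_weight_diff: "ct (F - G) h = ct F h - ct G h"
  by (induction h rule: poly_mapping_additive_induct) (simp_all add: ct_single ct_add weight_coeff_diff algebra_simps)

lemma ct_one_minus_mon:
  assumes "K_expand c = fls_const x * fls_X ^ j"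
  shows "ct ((1 - mon x i j) * F) h = ct F ((1 - Poly_Mapping.single (int i - int j) c) * h)"
  by (simp add: left_diff_distrib ct_weight_diff ct_mon[OF assms] ct_diff)

lemma ct_AW_weight: "ct AW_weight h = ct AW_weight_half ((1 - Poly_Mapping.single 2 1) * h)"
  unfolding AW_weight_half by (subst ct_one_minus_mon[of 1]) (simp_all add: is_ring_homD[OF is_ring_hom_K_expand])

lemma ct_AW_weight_sym:
  "ct AW_weight_sym h = ct AW_weight_half ((1 - Poly_Mapping.single 1 par_a) * (1 - Poly_Mapping.single 1 par_b) * h)"
  unfolding AW_weight_sym_def
  by (subst ct_one_minus_mon[of par_a], simp add: K_expand_par_a, subst ct_one_minus_mon[of par_b])
     (simp_all add: K_expand_par_b' mult_ac)

lemma ct_AW_weight_q_sym: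
  "ct AW_weight ((1 - Poly_Mapping.single (-1) par_c) * (1 - Poly_Mapping.single (-1) par_d) * h)
    = ct AW_weight_q_sym ((1 - Poly_Mapping.single (-2) par_q) * h)"
proof -
  have "ct ((1 - mon coef_c' 0 1) * ((1 - mon coef_d' 0 1) * AW_weight)) h
      = ct AW_weight ((1 - Poly_Mapping.single (-1) par_c) * (1 - Poly_Mapping.single (-1) par_d) * h)"
    by (subst ct_one_minus_mon[of par_c], simp add: K_expand_par_c, subst ct_one_minus_mon[of par_d])
       (simp_all add: K_expand_par_d' mult_ac)
  moreover have "ct ((1 - mon 1 0 2) * AW_weight_q_sym) h = ct AW_weight_q_sym ((1 - Poly_Mapping.single (-2) par_q) * h)"
    by (subst ct_one_minus_mon[of par_q]) (simp_all add: K_expand_par_q)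
  ultimately show ?thesis by (simp only: AW_weight_q_sym)
qed

lemma ct_inv_z: "ct AW_weight_sym (laurent_inv h) = ct AW_weight_sym h"
  using weight_coeff_inv_z[OF inv_z_reflects_AW_weight_sym]
  by (induction h rule: poly_mapping_additive_induct)
     (simp_all add: ct_single ct_add is_ring_homD[OF is_ring_hom_laurent_inv])

lemma par_q_neq_0: "par_q \<noteq> 0"
  by (simp add: par_q_def q_half_neq_0)

lemma ct_q_inv_z: "ct AW_weight_q_sym (laurent_inv (tau par_q h)) = ct AW_weight_q_sym h"
proof (induction h rule: poly_mapping_additive_induct)
  case (single k c)
  have "K_expand (par_q powi k) = fls_X powi (2 * k)"
    by (simp only: is_ring_hom_field(5)[OF is_ring_hom_K_expand] K_expand_par_q power_int_mult power_int_numeral)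
  then show ?case
    using weight_coeff_q_inv_z[OF q_inv_z_reflects_AW_weight_q_sym, of k]
    by (simp add: ct_single is_ring_homD[OF is_ring_hom_K_expand] mult_ac)
qed (simp_all add: ct_add is_ring_homD[OF is_ring_hom_laurent_inv] is_ring_homD[OF is_ring_hom_tau[OF par_q_neq_0]])

lemma ct_q_antisymmetric:
  assumes "laurent_inv (tau par_q t) = - t"
  shows "ct AW_weight_q_sym t = 0"
proof -
  have "2 * ct AW_weight_q_sym t = 0"
    using ct_q_inv_z[of t] by (simp add: assms ct_uminus)
  then show ?thesis using coef_fls_two_neq_0 by simp
qed

abbreviation Z :: "int \<Rightarrow> laurent" where "Z n \<equiv> Poly_Mapping.single n 1"

definition AW_M :: laurent where
  "AW_M = (1 - Poly_Mapping.single 1 par_a) * (1 - Poly_Mapping.single 1 par_b)"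

definition AW_C :: laurent where
  "AW_C = (1 - Poly_Mapping.single 1 par_c) * (1 - Poly_Mapping.single 1 par_d)"

definition AW_N :: laurent where "AW_N = AW_M * AW_C"

lemma Z_inv_AW_M: "Z 2 * laurent_inv AW_M = AW_M - laurent_const (1 - par_a * par_b) * (1 - Z 2)"
  by (simp add: AW_M_def laurent_const_def is_ring_homD[OF is_ring_hom_laurent_inv] algebra_simps mult_single
      single_diff)

text \<open>Self-adjointness in abstract form: \<open>h\<close> will be r ((L f) g - f (L g)), and
  \<open>W\<close> will be f(q z) g(z) - f(z) g(q z). With Y = M V the constant term splits into
  V(z) - V(z^-1) against the first invariant weight and (1 - a b) V(z^-1) against the original one.
  The latter is a multiple of the constant term of W(z^-1) against the second invariant weight, and
  W(z^-1) changes sign under z -> q z^-1.\<close>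

lemma ct_symmetric_difference_0:
  assumes h: "(1 - Z 2) * h = Y - Z 2 * laurent_inv Y" and Y: "Y = AW_N * Z (-1) * X"
    and X: "laurent_inv (tau par_q (laurent_inv W)) = - laurent_inv W" "W = (Z (-1) - Poly_Mapping.single 1 par_q) * X"
  shows "ct AW_weight h = 0"
proof -
  note D = is_ring_homD[OF is_ring_hom_laurent_inv]
  define V where "V = AW_C * Z (-1) * X"
  have inv_V: "laurent_inv V = (1 - Poly_Mapping.single (-1) par_c) * (1 - Poly_Mapping.single (-1) par_d) * (Z 1 * laurent_inv X)"
    by (simp add: V_def AW_C_def D mult_ac)
  have "ct AW_weight (laurent_inv V) = ct AW_weight_q_sym ((1 - Poly_Mapping.single (-2) par_q) * (Z 1 * laurent_inv X))"
    unfolding inv_V by (rule ct_AW_weight_q_sym)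
  also have "(1 - Poly_Mapping.single (-2) par_q) * (Z 1 * laurent_inv X) = laurent_inv W"
    by (simp add: X(2) D algebra_simps mult_single flip: mult.assoc)
  also have "ct AW_weight_q_sym (laurent_inv W) = 0"
    by (rule ct_q_antisymmetric) (rule X(1))
  finally have *: "ct AW_weight (laurent_inv V) = 0" .
  have "Y - Z 2 * laurent_inv Y = AW_M * V - Z 2 * laurent_inv AW_M * laurent_inv V"
    by (simp add: Y V_def AW_N_def D mult_ac)
  also have "\<dots> = AW_M * V - AW_M * laurent_inv V + laurent_const (1 - par_a * par_b) * ((1 - Z 2) * laurent_inv V)"
    unfolding Z_inv_AW_M by (simp add: algebra_simps)
  finally have "ct AW_weight h = ct AW_weight_half (AW_M * V) - ct AW_weight_half (AW_M * laurent_inv V)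
     + K_expand (1 - par_a * par_b) * ct AW_weight (laurent_inv V)"
    unfolding ct_AW_weight h by (simp add: ct_add ct_diff ct_const)
  also have "\<dots> = 0"
    using ct_inv_z[of V] * by (simp add: ct_AW_weight_sym AW_M_def)
  finally show ?thesis .
qed

definition AW_r :: K where "AW_r = sqrt_abcd / q_half"

lemma AW_r_neq_0: "AW_r \<noteq> 0"
  by (simp add: AW_r_def sqrt_abcd_def sqrt_mab_def sqrt_mcd_def indet_neq_0 q_half_neq_0)

section \<open>Symmetric Laurent polynomials and two divisibility statements\<close>

lemma sym_laurentD: "f \<in> sym_laurent \<Longrightarrow> laurent_inv f = f"
  by (simp add: sym_laurent_def)

lemma laurent_const_hom: "is_ring_hom laurent_const"
  unfolding laurent_const_def by (rule is_ring_hom_single_0)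

lemma sym_laurent_closed:
  shows "f \<in> sym_laurent \<Longrightarrow> g \<in> sym_laurent \<Longrightarrow> f + g \<in> sym_laurent"
    and "f \<in> sym_laurent \<Longrightarrow> g \<in> sym_laurent \<Longrightarrow> f - g \<in> sym_laurent"
    and "f \<in> sym_laurent \<Longrightarrow> g \<in> sym_laurent \<Longrightarrow> f * g \<in> sym_laurent"
    and "laurent_const c \<in> sym_laurent" and "msym n \<in> sym_laurent" and "0 \<in> sym_laurent" "1 \<in> sym_laurent"
  by (simp_all add: sym_laurent_def is_ring_homD[OF is_ring_hom_laurent_inv] laurent_const_def msym_def add.commute)

lemma sym_laurent_sum: "(\<And>x. x \<in> A \<Longrightarrow> f x \<in> sym_laurent) \<Longrightarrow> sum f A \<in> sym_laurent"
  by (induction A rule: infinite_finite_induct) (simp_all add: sym_laurent_closed)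

text \<open>Single terms are not symmetric in general, so induction over terms is applied to
  \<open>h\<close>, here half of \<open>f\<close>, instead of \<open>f\<close>.\<close>

lemma sym_laurent_symmetrization:
  assumes "f \<in> sym_laurent" obtains h where "f = h + laurent_inv h"
proof
  show "f = laurent_const (1 / 2) * f + laurent_inv (laurent_const (1 / 2) * f)"
  proof -
    have "laurent_const (1 / 2) + laurent_const (1 / 2) = 1"
      using ratfun_two_neq_0[where 'v = 5]
      by (simp add: laurent_const_def flip: single_add)
    then have "f = (laurent_const (1 / 2) + laurent_const (1 / 2)) * f" by simp
    moreover have "laurent_inv (laurent_const (1 / 2)) = laurent_const (1 / 2)"
      using sym_laurent_closed(4) by (rule sym_laurentD)
    ultimately show ?thesis
      by (simp add: is_ring_homD[OF is_ring_hom_laurent_inv] sym_laurentD[OF assms] distrib_right)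
  qed
qed

text \<open>For m_n = z^n + z^-n one has m_n(q z) - m_n(z) = (q^-n - 1) z^-n (1 - (q z^2)^n); the
  sum is the geometric quotient of the last factor by 1 - q z^2.\<close>

definition q_quotient :: "nat \<Rightarrow> laurent" where
  "q_quotient n = Poly_Mapping.single (1 - int n) (inverse par_q ^ n - 1) * (\<Sum>i<n. Poly_Mapping.single 2 par_q ^ i)"

lemma q_quotient:
  "tau par_q (msym n) - msym n = (Z (-1) - Poly_Mapping.single 1 par_q) * q_quotient n"
proof -
  let ?x = "Poly_Mapping.single 2 par_q :: laurent"
  have xn: "?x ^ n = Poly_Mapping.single (2 * int n) (par_q ^ n)" for n
    by (induction n) (simp_all add: mult_single algebra_simps)
  have "(Z (-1) - Poly_Mapping.single 1 par_q) * q_quotient n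
     = Poly_Mapping.single (1 - int n) (inverse par_q ^ n - 1) * Z (-1) * ((1 - ?x) * (\<Sum>i<n. ?x ^ i))"
  proof -
    have "Z (-1) - Poly_Mapping.single 1 par_q = Z (-1) * (1 - ?x)"
      by (simp add: right_diff_distrib mult_single)
    then show ?thesis unfolding q_quotient_def by (simp only: mult_ac)
  qed
  also have "\<dots> = Poly_Mapping.single (- int n) (inverse par_q ^ n - 1) * (1 - ?x ^ n)"
    by (subst one_diff_power_eq[symmetric]) (simp add: mult_single)
  also have "\<dots> = tau par_q (msym n) - msym n"
    using par_q_neq_0
    by (simp add: xn msym_def is_ring_homD[OF is_ring_hom_tau[OF par_q_neq_0]] algebra_simps mult_single
        power_int_minus power_inverse single_diff)
  finally show ?thesis ..
qed

lemma msym_neg: "h = Poly_Mapping.single n c \<Longrightarrow> h + laurent_inv h = laurent_const c * msym (nat \<bar>n\<bar>)"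
  by (cases "n \<ge> 0") (simp_all add: msym_def laurent_const_def algebra_simps mult_single)

text \<open>At the zeros of z^-1 - q z one has q z = z^-1, where f(q z) and f(z) agree by symmetry.
  This cancels the factor 1 - q z^2 in the denominator of A.\<close>

lemma q_difference_divisible:
  assumes "f \<in> sym_laurent"
  obtains E where "tau par_q f - f = (Z (-1) - Poly_Mapping.single 1 par_q) * E"
proof -
  note D = is_ring_homD[OF is_ring_hom_tau[OF par_q_neq_0]]
  have "\<exists>E. tau par_q (h + laurent_inv h) - (h + laurent_inv h) = (Z (-1) - Poly_Mapping.single 1 par_q) * E" for h
  proof (induction h rule: poly_mapping_additive_induct)
    case (single n c)
    have "tau par_q (laurent_const c) = laurent_const c" by (simp add: laurent_const_def)
    then have *: "tau par_q (laurent_const c * msym (nat \<bar>n\<bar>)) - laurent_const c * msym (nat \<bar>n\<bar>)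
        = laurent_const c * (tau par_q (msym (nat \<bar>n\<bar>)) - msym (nat \<bar>n\<bar>))"
      by (simp add: D algebra_simps)
    show ?case unfolding msym_neg[OF refl] * q_quotient
      by (rule exI[of _ "laurent_const c * q_quotient (nat \<bar>n\<bar>)"]) (simp only: mult.left_commute)
  next
    case (add f g)
    then obtain E F where
      EF: "tau par_q (f + laurent_inv f) - (f + laurent_inv f) = (Z (-1) - Poly_Mapping.single 1 par_q) * E"
      "tau par_q (g + laurent_inv g) - (g + laurent_inv g) = (Z (-1) - Poly_Mapping.single 1 par_q) * F" by auto
    have "tau par_q (f + g + laurent_inv (f + g)) - (f + g + laurent_inv (f + g))
        = (tau par_q (f + laurent_inv f) - (f + laurent_inv f)) + (tau par_q (g + laurent_inv g) - (g + laurent_inv g))"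
      by (simp add: D is_ring_homD[OF is_ring_hom_laurent_inv])
    also have "\<dots> = (Z (-1) - Poly_Mapping.single 1 par_q) * (E + F)"
      unfolding EF by (simp only: distrib_left)
    finally have "tau par_q (f + g + laurent_inv (f + g)) - (f + g + laurent_inv (f + g))
        = (Z (-1) - Poly_Mapping.single 1 par_q) * (E + F)" .
    then show ?case by blast
  qed
  then show ?thesis using sym_laurent_symmetrization[OF assms] that by metis
qed

lemma Z_power: "Z k ^ n = Z (int n * k)"
  by (induction n) (simp_all add: mult_single algebra_simps)

lemma one_minus_Z_neq_0: "k \<noteq> 0 \<Longrightarrow> 1 - Poly_Mapping.single k c \<noteq> (0 :: laurent)"
proof
  assume "k \<noteq> 0" "1 - Poly_Mapping.single k c = 0"
  then have "Poly_Mapping.lookup (1 - Poly_Mapping.single k c) 0 = (0::K)" by simp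
  with \<open>k \<noteq> 0\<close> show False by (simp add: lookup_minus lookup_one lookup_single)
qed

text \<open>This clears the other denominator 1 - z^2 in the action of L. For a single term with k
  at most 1 it is the geometric sum in z^k - z^(2-k) = z^k (1 - z^(2(1-k))); for larger k the two
  terms exchange roles.\<close>

lemma antisymmetric_divisible:
  obtains u where "(1 - Z 2) * u = Y - Z 2 * laurent_inv Y" "u \<in> sym_laurent"
proof -
  note D = is_ring_homD[OF is_ring_hom_laurent_inv]
  have low: "\<exists>u. (1 - Z 2) * u = Poly_Mapping.single k c - Poly_Mapping.single (2 - k) c" if "k \<le> 1" for k c
  proof
    have "(1 - Z 2) * (Poly_Mapping.single k c * (\<Sum>i<nat (1 - k). Z 2 ^ i))
      = Poly_Mapping.single k c * ((1 - Z 2) * (\<Sum>i<nat (1 - k). Z 2 ^ i))" by (simp add: mult_ac)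
    also have "\<dots> = Poly_Mapping.single k c * (1 - Z 2 ^ nat (1 - k))" by (simp only: one_diff_power_eq)
    also have "\<dots> = Poly_Mapping.single k c - Poly_Mapping.single (2 - k) c"
      unfolding Z_power using that by (simp add: algebra_simps mult_single)
    finally show "(1 - Z 2) * (Poly_Mapping.single k c * (\<Sum>i<nat (1 - k). Z 2 ^ i))
      = Poly_Mapping.single k c - Poly_Mapping.single (2 - k) c" .
  qed
  have "\<exists>u. (1 - Z 2) * u = Y - Z 2 * laurent_inv Y"
  proof (induction Y rule: poly_mapping_additive_induct)
    case (single k c)
    show ?case
    proof (cases "k \<le> 1")
      case True
      then show ?thesis using low[of k c] by (simp add: mult_single)
    next
      case False
      then obtain u where "(1 - Z 2) * u = Poly_Mapping.single (2 - k) c - Poly_Mapping.single k c"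
        using low[of "2 - k" c] by auto
      then have "(1 - Z 2) * (- u) = Poly_Mapping.single k c - Z 2 * laurent_inv (Poly_Mapping.single k c)"
        by (simp add: mult_single)
      then show ?thesis by blast
    qed
  next
    case (add f g)
    then obtain u v where "(1 - Z 2) * u = f - Z 2 * laurent_inv f" "(1 - Z 2) * v = g - Z 2 * laurent_inv g" by auto
    then have "(1 - Z 2) * (u + v) = (f + g) - Z 2 * laurent_inv (f + g)"
      unfolding distrib_left D by simp
    then show ?case by blast
  qed
  then obtain u where u: "(1 - Z 2) * u = Y - Z 2 * laurent_inv Y" by blast
  have "Z 2 * (1 - Z (-2)) = Z 2 - 1" by (simp add: right_diff_distrib mult_single)
  moreover have "- Z 2 * laurent_inv ((1 - Z 2) * u) = - (Z 2 * (1 - Z (-2))) * laurent_inv u"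
    by (simp add: D mult.assoc)
  ultimately have "(1 - Z 2) * laurent_inv u = - Z 2 * laurent_inv ((1 - Z 2) * u)"
    by simp
  also have "\<dots> = (1 - Z 2) * u"
    unfolding u by (simp add: D right_diff_distrib mult.assoc[symmetric] mult_single)
  finally have "laurent_inv u = u"
    using one_minus_Z_neq_0[of 2 1] mult_left_cancel[of "1 - Z 2" "laurent_inv u" u] by simp
  then have "u \<in> sym_laurent" unfolding sym_laurent_def mem_Collect_eq by (rule sym)
  with u show ?thesis by (rule that)
qed

section \<open>The operator L on symmetric Laurent polynomials\<close>

lemma of_laurent_Z: "of_laurent (Z 1) = Kz_z" "of_laurent (Z (-1)) = inverse Kz_z" "of_laurent (Z 2) = Kz_z ^ 2"
  using of_laurent_single[of 1 1] of_laurent_single[of "-1" 1] of_laurent_single[of 2 1]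
  by (simp_all add: is_ring_homD[OF is_ring_hom_Kz_const])

lemma one_minus_Kz_z_squared_neq_0: "1 - Kz_const c * Kz_z ^ 2 \<noteq> 0"
proof -
  have "1 - Kz_const c * Kz_z ^ 2 = of_laurent (1 - Poly_Mapping.single 2 c)"
    by (simp add: is_ring_homD[OF is_ring_hom_of_laurent] of_laurent_single)
  then show ?thesis using one_minus_Z_neq_0[of 2 c] by (simp add: of_laurent_eq_0_iff)
qed

lemma AW_A_z: "AW_A Kz_z = of_laurent AW_N / ((1 - Kz_z ^ 2) * (1 - Kz_const par_q * Kz_z ^ 2))"
  by (simp add: AW_A_def AW_N_def AW_M_def AW_C_def is_ring_homD[OF is_ring_hom_of_laurent] of_laurent_single mult.assoc)

lemma Kz_inv_AW_A: "Kz_inv (AW_A x) = AW_A (Kz_inv x)"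
  by (simp add: AW_A_def is_ring_homD[OF is_ring_hom_Kz_inv] is_ring_hom_field(4)[OF is_ring_hom_Kz_inv])

lemma q_half_powi_2: "q_half powi 2 = par_q"
  by (simp add: par_q_def)

text \<open>The half A(z) (T^2 - 1) f equals Y / (1 - z^2) with Y = N z^-1 E. The other half is its
  image under z -> z^-1, since f is symmetric, and the two add up to \<open>u\<close>.\<close>

lemma AW_L_of_laurent:
  assumes f: "f \<in> sym_laurent"
    and E: "tau par_q f - f = (Z (-1) - Poly_Mapping.single 1 par_q) * E"
    and u: "(1 - Z 2) * u = AW_N * Z (-1) * E - Z 2 * laurent_inv (AW_N * Z (-1) * E)"
  shows "AW_L (of_laurent f) = of_laurent (laurent_const (inverse AW_r) * u + laurent_const (AW_r + inverse AW_r) * f)"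
proof -
  note O = is_ring_homD[OF is_ring_hom_of_laurent] and I = is_ring_homD[OF is_ring_hom_Kz_inv]
    and I' = is_ring_hom_field[OF is_ring_hom_Kz_inv]
  define F Y where "F = of_laurent f" and "Y = AW_N * Z (-1) * E"
  have nz: "1 - Kz_z ^ 2 \<noteq> 0" "1 - Kz_const par_q * Kz_z ^ 2 \<noteq> 0"
    using one_minus_Kz_z_squared_neq_0[of 1] one_minus_Kz_z_squared_neq_0[of par_q]
    by (simp_all add: is_ring_homD[OF is_ring_hom_Kz_const])
  have "T_pow 2 F - F = of_laurent (tau par_q f - f)"
    by (simp add: F_def T_pow_of_laurent q_half_powi_2 O par_q_def)
  also have "\<dots> = inverse Kz_z * (1 - Kz_const par_q * Kz_z ^ 2) * of_laurent E"
    unfolding E using Kz_z_neq_0 by (simp add: O of_laurent_Z(2) of_laurent_single is_ring_homD[OF is_ring_hom_Kz_const] field_simps power2_eq_square)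
  finally have 1: "AW_A Kz_z * (T_pow 2 F - F) = of_laurent Y / (1 - Kz_z ^ 2)"
    unfolding AW_A_z Y_def using nz by (simp add: O of_laurent_Z)
  have "Kz_inv F = F" by (simp add: F_def Kz_inv_of_laurent sym_laurentD[OF f])
  then have "AW_A (inverse Kz_z) * (T_pow (-2) F - F) = Kz_inv (AW_A Kz_z * (T_pow 2 F - F))"
    by (simp add: I Kz_inv_AW_A Kz_inv_T_pow)
  also have "\<dots> = of_laurent (laurent_inv Y) / (1 - inverse Kz_z ^ 2)"
    unfolding 1 by (simp add: I I' Kz_inv_of_laurent)
  also have "\<dots> = - (Kz_z ^ 2) * of_laurent (laurent_inv Y) / (1 - Kz_z ^ 2)"
  proof -
    have "1 - inverse Kz_z ^ 2 = - ((1 - Kz_z ^ 2) / Kz_z ^ 2)"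
      using Kz_z_neq_0 by (simp add: field_simps)
    then show ?thesis using nz Kz_z_neq_0 by (simp add: field_simps)
  qed
  finally have "AW_A Kz_z * (T_pow 2 F - F) + AW_A (inverse Kz_z) * (T_pow (-2) F - F)
      = of_laurent (Y - Z 2 * laurent_inv Y) / (1 - Kz_z ^ 2)"
    unfolding 1 by (simp add: O of_laurent_Z diff_divide_distrib)
  also have "\<dots> = of_laurent u"
    unfolding Y_def u[symmetric] using nz by (simp add: O of_laurent_Z)
  finally show ?thesis
    unfolding AW_L_def Let_def AW_r_def[symmetric] F_def[symmetric] by (simp add: O Kz_const_def F_def)
qed

lemma AW_L_sym_laurent:
  assumes "f \<in> sym_laurent"
  shows "\<exists>g\<in>sym_laurent. AW_L (of_laurent f) = of_laurent g"
proof -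
  obtain E where E: "tau par_q f - f = (Z (-1) - Poly_Mapping.single 1 par_q) * E"
    using q_difference_divisible[OF assms] .
  obtain u where u: "(1 - Z 2) * u = AW_N * Z (-1) * E - Z 2 * laurent_inv (AW_N * Z (-1) * E)" "u \<in> sym_laurent"
    using antisymmetric_divisible .
  have "laurent_const (inverse AW_r) * u + laurent_const (AW_r + inverse AW_r) * f \<in> sym_laurent"
    by (intro sym_laurent_closed u(2) assms)
  with AW_L_of_laurent[OF assms E u(1)] show ?thesis by blast
qed

text \<open>Intended for symmetric \<open>f\<close>, where such a \<open>g\<close> exists by
  \<open>AW_L_sym_laurent\<close>; it is unique because \<open>of_laurent\<close> is
  injective.\<close>

definition lau_L :: "laurent \<Rightarrow> laurent" where
  "lau_L f = (SOME g. AW_L (of_laurent f) = of_laurent g)"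

lemma lau_L_eqI: "AW_L (of_laurent f) = of_laurent g \<Longrightarrow> lau_L f = g"
  unfolding lau_L_def by (rule some_equality) (simp_all add: of_laurent_eq_iff)

lemma lau_L:
  assumes "f \<in> sym_laurent"
  shows "AW_L (of_laurent f) = of_laurent (lau_L f)" "lau_L f \<in> sym_laurent"
  using AW_L_sym_laurent[OF assms] lau_L_eqI by auto

lemma AW_L_add: "AW_L (x + y) = AW_L x + AW_L y"
  by (simp add: AW_L_def Let_def is_ring_homD[OF is_ring_hom_T_pow] algebra_simps)

lemma AW_L_const: "AW_L (Kz_const c * x) = Kz_const c * AW_L x"
proof -
  have "T_pow n (Kz_const c * x) - Kz_const c * x = Kz_const c * (T_pow n x - x)" for n
    by (simp add: is_ring_homD[OF is_ring_hom_T_pow] right_diff_distrib)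
  then show ?thesis by (simp only: AW_L_def Let_def distrib_left mult_ac)
qed

lemma lau_L_add: "f \<in> sym_laurent \<Longrightarrow> g \<in> sym_laurent \<Longrightarrow> lau_L (f + g) = lau_L f + lau_L g"
  by (rule lau_L_eqI) (simp add: is_ring_homD[OF is_ring_hom_of_laurent] AW_L_add lau_L)

lemma lau_L_const: "f \<in> sym_laurent \<Longrightarrow> lau_L (laurent_const c * f) = laurent_const c * lau_L f"
  using AW_L_const[of c "of_laurent f"]
  by (intro lau_L_eqI) (simp add: is_ring_homD[OF is_ring_hom_of_laurent] lau_L Kz_const_def)

lemma lau_L_0: "lau_L 0 = 0"
  by (rule lau_L_eqI)
     (simp add: AW_L_def Let_def is_ring_homD[OF is_ring_hom_T_pow] is_ring_homD[OF is_ring_hom_of_laurent])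

lemma lau_L_sum: "(\<And>x. x \<in> A \<Longrightarrow> f x \<in> sym_laurent) \<Longrightarrow> lau_L (sum f A) = (\<Sum>x\<in>A. lau_L (f x))"
  by (induction A rule: infinite_finite_induct) (simp_all add: lau_L_0 lau_L_add sym_laurent_sum)

lemma laurent_inv_tau: "laurent_inv (tau c f) = tau (inverse c) (laurent_inv f)"
  by (rule poly_mapping_eqI) (simp add: lookup_laurent_inv lookup_tau power_int_minus power_int_inverse)

lemma tau_tau_inverse: "c \<noteq> 0 \<Longrightarrow> tau c (tau (inverse c) f) = f"
  by (rule poly_mapping_eqI) (simp add: lookup_tau power_int_inverse)

lemma lau_L_self_adjoint:
  assumes f: "f \<in> sym_laurent" and g: "g \<in> sym_laurent"
  shows "ct AW_weight (lau_L f * g) = ct AW_weight (f * lau_L g)"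
proof -
  note I = is_ring_homD[OF is_ring_hom_laurent_inv] and fs = sym_laurentD[OF f] and gs = sym_laurentD[OF g]
    and T = is_ring_homD[OF is_ring_hom_tau[OF par_q_neq_0]]
  let ?d = "Z (-1) - Poly_Mapping.single 1 par_q"
  obtain E where E: "tau par_q f - f = ?d * E" using q_difference_divisible[OF f] .
  obtain F where F: "tau par_q g - g = ?d * F" using q_difference_divisible[OF g] .
  obtain u where u: "(1 - Z 2) * u = AW_N * Z (-1) * E - Z 2 * laurent_inv (AW_N * Z (-1) * E)"
    using antisymmetric_divisible .
  obtain v where v: "(1 - Z 2) * v = AW_N * Z (-1) * F - Z 2 * laurent_inv (AW_N * Z (-1) * F)"
    using antisymmetric_divisible .
  \<comment> \<open>\<open>X\<close> is chosen so that (z^-1 - q z) X = f(q z) g(z) - f(z) g(q z),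
    the products f(z) g(z) cancelling.\<close>
  define X W h where "X = E * g - f * F" and "W = ?d * X" and "h = u * g - f * v"
  have "(1 - Z 2) * h = ((1 - Z 2) * u) * g - f * ((1 - Z 2) * v)"
    by (simp add: h_def right_diff_distrib mult_ac)
  also have "\<dots> = AW_N * Z (-1) * X - Z 2 * laurent_inv (AW_N * Z (-1) * X)"
    unfolding u v X_def by (simp add: I fs gs algebra_simps)
  finally have h: "(1 - Z 2) * h = AW_N * Z (-1) * X - Z 2 * laurent_inv (AW_N * Z (-1) * X)" .
  have "W = (?d * E) * g - f * (?d * F)"
    by (simp add: W_def X_def right_diff_distrib mult_ac)
  then have W: "W = tau par_q f * g - f * tau par_q g"
    unfolding E[symmetric] F[symmetric] by (simp add: algebra_simps)
  have "laurent_inv (tau par_q (laurent_inv W)) = - laurent_inv W"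
    unfolding W by (simp add: I T laurent_inv_tau fs gs tau_tau_inverse par_q_neq_0)
  then have 0: "ct AW_weight h = 0"
    by (rule ct_symmetric_difference_0[OF h refl]) (simp add: W_def)
  have "lau_L f * g - f * lau_L g = laurent_const (inverse AW_r) * h"
    unfolding lau_L_eqI[OF AW_L_of_laurent[OF f E u]] lau_L_eqI[OF AW_L_of_laurent[OF g F v]] h_def
    by (simp add: algebra_simps)
  then have "ct AW_weight (lau_L f * g - f * lau_L g) = 0" by (simp add: ct_const 0)
  then show ?thesis by (simp add: ct_diff)
qed

section \<open>Lowest terms and the triangularity of L\<close>

lemma lookup_single_mult: "Poly_Mapping.lookup (Poly_Mapping.single l c * g) k = c * Poly_Mapping.lookup (g :: laurent) (k - l)"
proof (induction g rule: poly_mapping_additive_induct)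
  case (single m x)
  show ?case by (auto simp: mult_single lookup_single when_def)
qed (simp add: distrib_left lookup_add)

lemma lookup_const_mult [simp]: "Poly_Mapping.lookup (laurent_const c * g) k = c * Poly_Mapping.lookup g k"
  by (simp add: laurent_const_def lookup_single_mult)

lemma lookup_mult_sum:
  "Poly_Mapping.lookup (f * g) k = (\<Sum>l\<in>Poly_Mapping.keys f. Poly_Mapping.lookup f l * Poly_Mapping.lookup (g :: laurent) (k - l))"
proof -
  have "f * g = (\<Sum>l\<in>Poly_Mapping.keys f. Poly_Mapping.single l (Poly_Mapping.lookup f l) * g)"
    by (subst poly_mapping_sum_single[of f]) (rule sum_distrib_right)
  then show ?thesis by (simp add: lookup_sum lookup_single_mult)
qed

text \<open>The value \<open>x\<close> may be 0. For symmetric elements lowest coefficients carry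
  the same information as leading ones.\<close>

definition lowest :: "int \<Rightarrow> K \<Rightarrow> laurent \<Rightarrow> bool" where
  "lowest i x f \<longleftrightarrow> (\<forall>k<i. Poly_Mapping.lookup f k = 0) \<and> Poly_Mapping.lookup f i = x"

lemma lowest_mult:
  assumes f: "lowest i x f" and g: "lowest j y g"
  shows "lowest (i + j) (x * y) (f * g)"
  unfolding lowest_def
proof (intro conjI allI impI)
  fix k assume "k < i + j"
  then show "Poly_Mapping.lookup (f * g) k = 0"
    unfolding lookup_mult_sum
    by (intro sum.neutral ballI) (use f g in \<open>force simp: lowest_def\<close>)
next
  have "Poly_Mapping.lookup f l * Poly_Mapping.lookup g (i + j - l) = (if l = i then x * y else 0)" for l
    using f g by (cases l i rule: linorder_cases) (auto simp: lowest_def)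
  then show "Poly_Mapping.lookup (f * g) (i + j) = x * y"
    using f by (auto simp: lookup_mult_sum lowest_def not_in_keys_iff_lookup_eq_zero)
qed

lemma lowest_single: "lowest k c (Poly_Mapping.single k c)"
  and lowest_one_minus_pos: "k > 0 \<Longrightarrow> lowest 0 1 (1 - Poly_Mapping.single k c)"
  and lowest_one_minus_neg: "k < 0 \<Longrightarrow> lowest k (- c) (1 - Poly_Mapping.single k c)"
  by (auto simp: lowest_def lookup_single when_def lookup_minus lookup_one)

text \<open>The coefficients satisfy u_k = u_(k-2) + W_k, and a smallest exponent of
  \<open>u\<close> below \<open>i\<close> would violate this.\<close>

lemma lowest_divide:
  assumes u: "(1 - Z 2) * u = W" and W: "lowest i x W"
  shows "lowest i x u"
proof -
  have rec: "Poly_Mapping.lookup u k = Poly_Mapping.lookup u (k - 2) + Poly_Mapping.lookup W k" for k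
    unfolding u[symmetric] by (simp add: left_diff_distrib lookup_minus lookup_single_mult)
  have low: "Poly_Mapping.lookup u k = 0" if "k < i" for k
  proof (rule ccontr)
    assume k: "Poly_Mapping.lookup u k \<noteq> 0"
    then have ne: "Poly_Mapping.keys u \<noteq> {}" by (auto simp: in_keys_iff)
    define l where "l = Min (Poly_Mapping.keys u)"
    have "l \<in> Poly_Mapping.keys u" unfolding l_def using ne by (intro Min_in) simp_all
    moreover have "l \<le> k" unfolding l_def using k by (intro Min_le) (simp_all add: in_keys_iff)
    moreover have "l - 2 \<notin> Poly_Mapping.keys u"
    proof
      assume "l - 2 \<in> Poly_Mapping.keys u"
      then have "l \<le> l - 2" unfolding l_def by (intro Min_le) simp_all
      then show False by simp
    qed
    ultimately show False
      using rec[of l] W \<open>k < i\<close> by (simp add: lowest_def in_keys_iff)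
  qed
  then show ?thesis using rec[of i] W low[of "i - 2"] by (simp add: lowest_def)
qed

definition AW_eigenvalue :: "nat \<Rightarrow> K" where
  "AW_eigenvalue n = AW_r * par_q ^ n + inverse AW_r * inverse par_q ^ n"

lemma abcd_eq: "par_a * par_b * (par_c * par_d) = AW_r ^ 2 * par_q"
  by (simp add: par_a_def par_b_def par_c_def par_d_def AW_r_def sqrt_abcd_def par_q_def q_half_neq_0
      sqrt_mab_def sqrt_mcd_def indet_neq_0 field_simps)

lemma lowest_AW_N: "lowest 0 1 AW_N" "lowest (- 4) (AW_r ^ 2 * par_q) (laurent_inv AW_N)"
proof -
  have "lowest (0 + 0 + (0 + 0)) (1 * 1 * (1 * 1)) AW_N"
    unfolding AW_N_def AW_M_def AW_C_def by (intro lowest_mult lowest_one_minus_pos) simp_all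
  then show "lowest 0 1 AW_N" by simp
  have "lowest (- 1 + - 1 + (- 1 + - 1)) (- par_a * - par_b * (- par_c * - par_d)) (laurent_inv AW_N)"
    unfolding AW_N_def AW_M_def AW_C_def is_ring_homD[OF is_ring_hom_laurent_inv] laurent_inv_single
    by (intro lowest_mult lowest_one_minus_neg) simp_all
  then show "lowest (- 4) (AW_r ^ 2 * par_q) (laurent_inv AW_N)" by (simp add: abcd_eq)
qed

text \<open>At z^-n the element Y contributes c = q^-n - 1, and z^2 Y(z^-1) contributes r^2 q^n c
  because a b c d = r^2 q. The eigenvalue is r^-1 (c - r^2 q^n c) + r + r^-1. For n = 0 the
  geometric sums are empty; that case is \<open>lau_L_1\<close>.\<close>

lemma lowest_lau_L_msym:
  assumes "n > 0"
  shows "lowest (- int n) (AW_eigenvalue n) (lau_L (msym n))"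
proof -
  note I = is_ring_homD[OF is_ring_hom_laurent_inv]
  define c where "c = inverse par_q ^ n - 1"
  let ?x = "Poly_Mapping.single 2 par_q :: laurent" and ?y = "Poly_Mapping.single (-2) par_q :: laurent"
  have xn: "?x ^ i = Poly_Mapping.single (2 * int i) (par_q ^ i)" "?y ^ i = Poly_Mapping.single (- 2 * int i) (par_q ^ i)" for i
    by (induction i) (simp_all add: mult_single algebra_simps)
  have lx: "lowest 0 1 (\<Sum>i<n. ?x ^ i)"
    using assms by (auto simp: xn lowest_def lookup_sum lookup_single when_def sum.delta intro!: sum.neutral)
  have ly: "lowest (- 2 * int (n - 1)) (par_q ^ (n - 1)) (\<Sum>i<n. ?y ^ i)"
    unfolding lowest_def
  proof (intro conjI allI impI)
    fix k :: int assume "k < - 2 * int (n - 1)"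
    then show "Poly_Mapping.lookup (\<Sum>i<n. ?y ^ i) k = 0"
      by (auto simp: xn lookup_sum lookup_single when_def intro!: sum.neutral)
  next
    have "Poly_Mapping.lookup (\<Sum>i<n. ?y ^ i) (- 2 * int (n - 1)) = (\<Sum>i<n. if i = n - 1 then par_q ^ i else 0)"
      unfolding lookup_sum xn(2) lookup_single when_def by (intro sum.cong) auto
    then show "Poly_Mapping.lookup (\<Sum>i<n. ?y ^ i) (- 2 * int (n - 1)) = par_q ^ (n - 1)"
      using assms by simp
  qed
  obtain u where u: "(1 - Z 2) * u = AW_N * Z (-1) * q_quotient n - Z 2 * laurent_inv (AW_N * Z (-1) * q_quotient n)"
    using antisymmetric_divisible .
  have "lowest (0 + - 1 + ((1 - int n) + 0)) (1 * 1 * (c * 1)) (AW_N * Z (-1) * q_quotient n)"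
    unfolding q_quotient_def c_def[symmetric] by (intro lowest_mult lowest_AW_N lowest_single lx)
  then have 1: "lowest (- int n) c (AW_N * Z (-1) * q_quotient n)" by simp
  have "lowest (2 + (- 4 + 1 + (- (1 - int n) + - 2 * int (n - 1)))) (1 * (AW_r ^ 2 * par_q * 1 * (c * par_q ^ (n - 1))))
     (Z 2 * laurent_inv (AW_N * Z (-1) * q_quotient n))"
    unfolding q_quotient_def c_def[symmetric] I laurent_inv_single
    using lowest_single[of 1 1] by (intro lowest_mult lowest_AW_N lowest_single ly) simp
  then have 2: "lowest (- int n) (AW_r ^ 2 * par_q ^ n * c) (Z 2 * laurent_inv (AW_N * Z (-1) * q_quotient n))"
    using assms by (cases n) (simp_all add: algebra_simps)
  have "lowest (- int n) (c - AW_r ^ 2 * par_q ^ n * c) u"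
    by (rule lowest_divide[OF u]) (use 1 2 in \<open>simp add: lowest_def lookup_minus\<close>)
  moreover have "lowest (- int n) 1 (msym n)"
    using assms by (auto simp: lowest_def msym_def lookup_add lookup_single when_def)
  moreover have "inverse AW_r * (c - AW_r ^ 2 * par_q ^ n * c) + (AW_r + inverse AW_r) = AW_eigenvalue n"
    using AW_r_neq_0 par_q_neq_0
    by (simp add: c_def AW_eigenvalue_def field_simps power2_eq_square)
  ultimately show ?thesis
    unfolding lau_L_eqI[OF AW_L_of_laurent[OF sym_laurent_closed(5) q_quotient u]]
    by (simp add: lowest_def lookup_add)
qed

lemma lau_L_1: "lau_L 1 = laurent_const (AW_eigenvalue 0)"
proof -
  have "tau par_q 1 - 1 = (Z (-1) - Poly_Mapping.single 1 par_q) * 0"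
    by (simp add: is_ring_homD[OF is_ring_hom_tau[OF par_q_neq_0]])
  from lau_L_eqI[OF AW_L_of_laurent[OF sym_laurent_closed(7) this, of 0]] show ?thesis
    by (simp add: AW_eigenvalue_def is_ring_homD[OF is_ring_hom_laurent_inv])
qed

section \<open>Genericity of the parameters and distinctness of the eigenvalues\<close>

lemma K_monomial_eq_1:
  assumes "sqrt_mab powi i * par_b powi j * sqrt_mcd powi k * par_d powi l * q_half powi m = 1"
  shows "i = 0 \<and> j = 0 \<and> k = 0 \<and> l = 0 \<and> m = 0"
proof -
  define e where "e v = (if v = 0 then i else if v = 1 then j else if v = 2 then k else if v = 3 then l else m)" for v :: 5
  have "(\<Prod>v\<in>UNIV. indet v powi e v) = (1 :: K)"
    unfolding prod_UNIV_5 using assms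
    by (simp add: e_def sqrt_mab_def par_b_def sqrt_mcd_def par_d_def q_half_def)
  \<comment> \<open>Negative exponents are moved to the other side, so that two genuine monomials
    are compared.\<close>
  moreover have "(\<Prod>v\<in>UNIV. indet v ^ nat (e v) :: K) = (\<Prod>v\<in>UNIV. indet v powi e v) * (\<Prod>v\<in>UNIV. indet v ^ nat (- e v))"
    unfolding prod.distrib[symmetric]
    by (intro prod.cong refl) (auto simp: power_int_def indet_neq_0 simp flip: power_mult_distrib)
  ultimately have "Fract (Poly_Mapping.single (exponent (\<lambda>v. nat (e v))) (1 :: rat)) 1
      = Fract (Poly_Mapping.single (exponent (\<lambda>v. nat (- e v))) 1) 1"
    by (simp add: prod_indet_power)
  then have single: "Poly_Mapping.single (exponent (\<lambda>v. nat (e v))) (1 :: rat) = Poly_Mapping.single (exponent (\<lambda>v. nat (- e v))) 1"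
    by (simp add: eq_fract)
  then have "exponent (\<lambda>v. nat (e v)) = exponent (\<lambda>v. nat (- e v))"
    by (metis lookup_single_eq lookup_single_not_eq zero_neq_one)
  then have "nat (e v) = nat (- e v)" for v by (metis lookup_exponent)
  then have "e v = 0" for v by (metis add.inverse_neutral int_nat_eq neg_0_le_iff_le nle_le nat_0_iff neg_le_0_iff_le)
  from this[of 0] this[of 1] this[of 2] this[of 3] this[of 4] show ?thesis by (simp add: e_def)
qed

lemma par_ab_neq_1: "par_a * par_b \<noteq> 1"
proof
  assume "par_a * par_b = 1"
  then have "- (sqrt_mab ^ 2) = 1" by (simp add: par_a_def par_b_def indet_neq_0)
  \<comment> \<open>Squaring removes the sign, so that the monomial criterion applies.\<close>
  then have "(- (sqrt_mab ^ 2)) ^ 2 = 1" by simp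
  then have "sqrt_mab powi 4 = 1" by simp
  with K_monomial_eq_1[of 4 0 0 0 0] show False by simp
qed

lemma par_q_power: "par_q ^ n = q_half powi (2 * int n)"
  by (simp add: par_q_def power_int_mult flip: power_mult)

lemma par_q_power_inj: "par_q ^ n = par_q ^ m \<Longrightarrow> n = m"
proof -
  assume eq: "par_q ^ n = par_q ^ m"
  have "q_half powi (2 * int n - 2 * int m) = 1"
    using eq unfolding par_q_power by (simp add: power_int_diff q_half_neq_0)
  with K_monomial_eq_1[of 0 0 0 0 "2 * int n - 2 * int m"] show "n = m" by simp
qed

lemma AW_eigenvalue_inj: "AW_eigenvalue n = AW_eigenvalue m \<Longrightarrow> n = m"
proof -
  assume eq: "AW_eigenvalue n = AW_eigenvalue m"
  \<comment> \<open>The difference of two eigenvalues factors. In the second factor r^2 q^(n+m) is a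
    nontrivial monomial, namely a b c d q^(n+m-1).\<close>
  have "(par_q ^ n - par_q ^ m) * (AW_r ^ 2 * par_q ^ (n + m) - 1)
      = AW_r * par_q ^ n * par_q ^ m * (AW_eigenvalue n - AW_eigenvalue m)"
    using AW_r_neq_0 par_q_neq_0
    by (simp add: AW_eigenvalue_def field_simps power2_eq_square power_add)
  with eq have "(par_q ^ n - par_q ^ m) * (AW_r ^ 2 * par_q ^ (n + m) - 1) = 0" by simp
  moreover have "AW_r ^ 2 * par_q ^ (n + m) \<noteq> 1"
  proof
    assume "AW_r ^ 2 * par_q ^ (n + m) = 1"
    then have "sqrt_mab powi 2 * sqrt_mcd powi 2 * q_half powi (2 * int (n + m) - 2) = 1"
      unfolding par_q_power using q_half_neq_0
      by (simp add: AW_r_def sqrt_abcd_def power_int_diff power_mult_distrib power_divide field_simps)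
    with K_monomial_eq_1[of 2 0 2 0 "2 * int (n + m) - 2"] show False by simp
  qed
  ultimately show "n = m" using par_q_power_inj by simp
qed

section \<open>Askey--Wilson polynomials as eigenfunctions\<close>

definition sym_below :: "nat \<Rightarrow> laurent \<Rightarrow> bool" where
  "sym_below n f \<longleftrightarrow> f \<in> sym_laurent \<and> (\<forall>k. int n \<le> \<bar>k\<bar> \<longrightarrow> Poly_Mapping.lookup f k = 0)"

definition monic :: "nat \<Rightarrow> laurent \<Rightarrow> bool" where
  "monic n f \<longleftrightarrow> sym_below (Suc n) f \<and> Poly_Mapping.lookup f (int n) = 1"

lemma sym_lookup_minus: "f \<in> sym_laurent \<Longrightarrow> Poly_Mapping.lookup f (- k) = Poly_Mapping.lookup f k"
  using lookup_laurent_inv[of f k] by (simp add: sym_laurentD)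

lemma sym_below_lowest:
  assumes "f \<in> sym_laurent" "lowest (- int n) 0 f"
  shows "sym_below n f"
  unfolding sym_below_def
proof (intro conjI allI impI)
  fix k assume "int n \<le> \<bar>k\<bar>"
  then have "Poly_Mapping.lookup f (- \<bar>k\<bar>) = 0"
    using assms(2) by (cases "- \<bar>k\<bar> = - int n") (auto simp: lowest_def)
  then show "Poly_Mapping.lookup f k = 0"
    using sym_lookup_minus[OF assms(1), of k] by (cases "k \<ge> 0") simp_all
qed (rule assms)

lemma sym_below_closed:
  "sym_below n f \<Longrightarrow> sym_below n g \<Longrightarrow> sym_below n (f + g)"
  "sym_below n f \<Longrightarrow> sym_below n g \<Longrightarrow> sym_below n (f - g)"
  "sym_below n f \<Longrightarrow> sym_below n (laurent_const c * f)"
  "sym_below n 0" "sym_below n f \<Longrightarrow> n \<le> m \<Longrightarrow> sym_below m f"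
  by (auto simp: sym_below_def lookup_add lookup_minus intro!: sym_laurent_closed)

lemma sym_below_sum: "(\<And>x. x \<in> A \<Longrightarrow> sym_below n (f x)) \<Longrightarrow> sym_below n (sum f A)"
  by (induction A rule: infinite_finite_induct) (simp_all add: sym_below_closed)

lemma monic_diff:
  assumes "sym_below (Suc n) f" "monic n p"
  shows "sym_below n (f - laurent_const (Poly_Mapping.lookup f (int n)) * p)"
  unfolding sym_below_def
proof (intro conjI allI impI)
  let ?g = "f - laurent_const (Poly_Mapping.lookup f (int n)) * p"
  show sym: "?g \<in> sym_laurent" using assms by (auto simp: monic_def sym_below_def intro!: sym_laurent_closed)
  fix k assume k: "int n \<le> \<bar>k\<bar>"
  show "Poly_Mapping.lookup ?g k = 0"
  proof (cases "\<bar>k\<bar> = int n")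
    case True
    have "Poly_Mapping.lookup ?g (int n) = 0" using assms by (simp add: monic_def lookup_minus)
    then show ?thesis using True sym_lookup_minus[OF sym, of k] by (cases "k \<ge> 0") simp_all
  next
    case False
    then have "int (Suc n) \<le> \<bar>k\<bar>" using k by simp
    then show ?thesis using assms unfolding monic_def sym_below_def by (simp add: lookup_minus)
  qed
qed

lemma monic_span:
  assumes "\<And>j. j < n \<Longrightarrow> monic j (p j)" "sym_below n f"
  shows "\<exists>x. f = (\<Sum>j<n. laurent_const (x j) * p j)"
  using assms
proof (induction n arbitrary: f)
  case 0
  then have "f = 0" by (intro poly_mapping_eqI) (simp add: sym_below_def)
  then show ?case by simp
next
  case (Suc n)
  have "\<And>j. j < n \<Longrightarrow> monic j (p j)" using Suc.prems(1) by simp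
  from Suc.IH[OF this monic_diff[OF Suc.prems(2) Suc.prems(1)[OF lessI]]]
  obtain x where x: "f - laurent_const (Poly_Mapping.lookup f (int n)) * p n = (\<Sum>j<n. laurent_const (x j) * p j)"
    by blast
  have "f = (\<Sum>j<Suc n. laurent_const ((x(n := Poly_Mapping.lookup f (int n))) j) * p j)"
    using x by (simp add: algebra_simps)
  then show ?case by blast
qed

lemma monic_1: "monic 0 1"
  by (auto simp: monic_def sym_below_def sym_laurent_closed lookup_one)

lemma sym_below_msym: "sym_below (Suc n) (msym n)"
  unfolding sym_below_def
  by (intro conjI allI impI sym_laurent_closed) (auto simp: msym_def lookup_add lookup_single when_def)

lemma monic_msym: "n > 0 \<Longrightarrow> monic n (msym n)"
  by (auto simp: monic_def sym_below_msym) (simp add: msym_def lookup_add lookup_single when_def)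

text \<open>The error v = L m_n - lambda_n m_n lies in lower degree. It is corrected by a
  combination of the earlier eigenfunctions, whose coefficients have the nonzero denominators
  lambda_n - lambda_j.\<close>

lemma eigenfunction_exists:
  "\<exists>p. monic n p \<and> lau_L p = laurent_const (AW_eigenvalue n) * p"
proof (induction n rule: less_induct)
  case (less n)
  show ?case
  proof (cases "n = 0")
    case True
    then show ?thesis using monic_1 lau_L_1 by auto
  next
    case False
    then have n: "n > 0" by simp
    obtain p where p: "\<And>j. j < n \<Longrightarrow> monic j (p j)"
      "\<And>j. j < n \<Longrightarrow> lau_L (p j) = laurent_const (AW_eigenvalue j) * p j"
      using less by metis
    note C = is_ring_homD[OF laurent_const_hom]
    define v where "v = lau_L (msym n) - laurent_const (AW_eigenvalue n) * msym n"
    have "sym_below n v"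
    proof (rule sym_below_lowest)
      show "v \<in> sym_laurent" by (simp add: v_def sym_laurent_closed lau_L)
      show "lowest (- int n) 0 v"
        using lowest_lau_L_msym[OF n] n
        by (auto simp: v_def lowest_def lookup_minus msym_def lookup_add lookup_single when_def)
    qed
    then obtain x where x: "v = (\<Sum>j<n. laurent_const (x j) * p j)"
      using monic_span[OF p(1)] by blast
    define y where "y j = x j / (AW_eigenvalue n - AW_eigenvalue j)" for j
    define s where "s = (\<Sum>j<n. laurent_const (y j) * p j)"
    have y: "x j + y j * AW_eigenvalue j = AW_eigenvalue n * y j" if "j < n" for j
    proof -
      have "AW_eigenvalue n \<noteq> AW_eigenvalue j" using AW_eigenvalue_inj that by blast
      then show ?thesis by (simp add: y_def field_simps)
    qed
    have psym: "p j \<in> sym_laurent" if "j < n" for j using p(1)[OF that] by (simp add: monic_def sym_below_def)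
    have "sym_below n (p j)" if "j < n" for j
      using p(1)[OF that] sym_below_closed(5)[of "Suc j" "p j" n] that by (simp add: monic_def)
    then have s: "sym_below n s" unfolding s_def
      by (intro sym_below_sum sym_below_closed(3)) auto
    have "lau_L s = (\<Sum>j<n. laurent_const (y j * AW_eigenvalue j) * p j)"
      unfolding s_def by (subst lau_L_sum) (simp_all add: psym sym_laurent_closed lau_L_const p(2) C mult.assoc)
    then have "v + lau_L s = (\<Sum>j<n. laurent_const (x j + y j * AW_eigenvalue j) * p j)"
      unfolding x by (simp add: C distrib_right sum.distrib)
    also have "\<dots> = laurent_const (AW_eigenvalue n) * s"
      unfolding s_def sum_distrib_left by (intro sum.cong) (simp_all add: y C mult.assoc)
    finally have "lau_L (msym n + s) = laurent_const (AW_eigenvalue n) * (msym n + s)"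
      using s by (simp add: lau_L_add sym_laurent_closed sym_below_def v_def algebra_simps)
    moreover have "monic n (msym n + s)"
      using monic_msym[OF n] s sym_below_closed(5)[OF s, of "Suc n"]
      by (auto simp: monic_def lookup_add sym_below_closed) (simp add: sym_below_def)
    ultimately show ?thesis by blast
  qed
qed

definition AW_p :: "nat \<Rightarrow> laurent" where
  "AW_p n = (SOME p. monic n p \<and> lau_L p = laurent_const (AW_eigenvalue n) * p)"

lemma AW_p:
  shows monic_AW_p: "monic n (AW_p n)" and lau_L_AW_p: "lau_L (AW_p n) = laurent_const (AW_eigenvalue n) * AW_p n"
  using someI_ex[OF eigenfunction_exists[of n]] by (simp_all add: AW_p_def)

lemma AW_p_sym: "AW_p n \<in> sym_laurent"
  using monic_AW_p[of n] by (simp add: monic_def sym_below_def)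

lemma sym_laurent_below: assumes "f \<in> sym_laurent" obtains n where "sym_below n f"
proof
  let ?S = "(\<lambda>k. nat \<bar>k\<bar>) ` Poly_Mapping.keys f"
  show "sym_below (Suc (Max (insert 0 ?S))) f"
    unfolding sym_below_def
  proof (intro conjI allI impI assms)
    fix k assume k: "int (Suc (Max (insert 0 ?S))) \<le> \<bar>k\<bar>"
    show "Poly_Mapping.lookup f k = 0"
    proof (rule ccontr)
      assume "Poly_Mapping.lookup f k \<noteq> 0"
      then have "nat \<bar>k\<bar> \<le> Max (insert 0 ?S)" by (intro Max_ge) (auto simp: in_keys_iff)
      with k show False by linarith
    qed
  qed
qed

lemma sym_laurent_span:
  assumes "f \<in> sym_laurent"
  obtains n x where "f = (\<Sum>j<n. laurent_const (x j) * AW_p j)"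
  using sym_laurent_below[OF assms] monic_span[of _ AW_p f] monic_AW_p by metis

lemma ct_AW_p_orthogonal:
  assumes "i \<noteq> j"
  shows "ct AW_weight (AW_p i * AW_p j) = 0"
proof -
  have "K_expand (AW_eigenvalue i) * ct AW_weight (AW_p i * AW_p j) = ct AW_weight (lau_L (AW_p i) * AW_p j)"
    by (simp add: lau_L_AW_p mult.assoc ct_const)
  also have "\<dots> = ct AW_weight (AW_p i * lau_L (AW_p j))"
    by (rule lau_L_self_adjoint) (rule AW_p_sym)+
  also have "\<dots> = K_expand (AW_eigenvalue j) * ct AW_weight (AW_p i * AW_p j)"
    by (simp add: lau_L_AW_p mult.left_commute[of "AW_p i"] ct_const)
  finally have "(K_expand (AW_eigenvalue i) - K_expand (AW_eigenvalue j)) * ct AW_weight (AW_p i * AW_p j) = 0"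
    by (simp add: algebra_simps)
  moreover have "K_expand (AW_eigenvalue i) \<noteq> K_expand (AW_eigenvalue j)"
    using assms AW_eigenvalue_inj[of i j] by (auto simp: is_ring_hom_field(2)[OF is_ring_hom_K_expand])
  ultimately show ?thesis by simp
qed

section \<open>Nondegeneracy of the form by setting q^(1/2) = 0\<close>

definition weight_at_0 :: "int \<Rightarrow> coef" where "weight_at_0 n = fls_nth (weight_coeff AW_weight n) 0"

lemma weight_at_0_neg: "n < 0 \<Longrightarrow> weight_at_0 n = 0"
  by (simp add: weight_at_0_def weight_coeff_nth ext2_def)

text \<open>This is (1 - a z)(1 - b z) \<open>\<Delta>\<close> = 1 - z^2 at q^(1/2) = 0, read
  coefficientwise; the first invariant weight becomes 1 there.\<close>

lemma weight_at_0_rec: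
  "weight_at_0 n - (coef_a + coef_b) * weight_at_0 (n - 1) + coef_a * coef_b * weight_at_0 (n - 2)
    = (if n = 0 then 1 else 0) - (if n = 2 then 1 else 0)"
proof -
  have nth: "fls_nth (weight_coeff ((1 - mon x i 0) * F) n) 0
      = fls_nth (weight_coeff F n) 0 - x * fls_nth (weight_coeff F (n - int i)) 0" for x i F n
    by (simp add: left_diff_distrib weight_coeff_diff weight_coeff_mon)
  have "(1 - mon 1 2 0) * AW_weight_sym = (1 - mon coef_a 1 0) * ((1 - mon coef_b 1 0) * AW_weight)"
    unfolding AW_weight_sym_def AW_weight_half by (simp only: mult_ac)
  then have "fls_nth (weight_coeff ((1 - mon 1 2 0) * AW_weight_sym) n) 0
      = fls_nth (weight_coeff ((1 - mon coef_a 1 0) * ((1 - mon coef_b 1 0) * AW_weight)) n) 0" by simp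
  then show ?thesis unfolding nth AW_weight_sym_at_0 weight_at_0_def by (simp add: algebra_simps)
qed

lemma coef_ab_neq_1: "coef_a * coef_b \<noteq> 1"
proof
  assume "coef_a * coef_b = 1"
  then have "K_expand (par_a * par_b) = K_expand 1"
    by (simp add: is_ring_homD[OF is_ring_hom_K_expand] K_expand_par_a K_expand_par_b' fls_const_mult_const)
  then show False using par_ab_neq_1 by (simp only: is_ring_hom_field(2)[OF is_ring_hom_K_expand])
qed

text \<open>The product h of the weight with the Laurent polynomial phi satisfies (1 - a z)(1 - b z)
  h = (1 - z^2) phi. Orthogonality makes h antisymmetric in its exponents, so like phi it is
  supported between -d and d. The coefficients at z^-d and z^(d+2) give h(-d) = phi(d) and a b h(d)
  = - phi(d), hence (1 - a b) phi(d) = 0.\<close>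

lemma symmetric_weight_at_0_nondegenerate:
  fixes \<phi> :: "int \<Rightarrow> coef"
  assumes fin: "finite A" and A: "\<And>k. k \<notin> A \<Longrightarrow> \<phi> k = 0" and sym: "\<And>k. \<phi> (- k) = \<phi> k"
    and orth: "\<And>m. (\<Sum>k\<in>A. \<phi> k * (weight_at_0 (- k - m) + weight_at_0 (- k + m))) = 0"
  shows "\<phi> k = 0"
proof (rule ccontr)
  assume k: "\<phi> k \<noteq> 0"
  define h where "h m = (\<Sum>k\<in>A. \<phi> k * weight_at_0 (m - k))" for m
  have h_neg: "h (- m) = - h m" for m
  proof -
    have "- k - m = - m - k" "- k + m = m - k" for k by simp_all
    with orth[of m] have "h (- m) + h m = 0" by (simp only: h_def distrib_left sum.distrib)
    then show ?thesis by (simp add: eq_neg_iff_add_eq_0)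
  qed
  have delta: "(\<Sum>k\<in>A. \<phi> k * (if m - k = c then 1 else 0)) = \<phi> (m - c)" for m c
  proof -
    have "(\<Sum>k\<in>A. \<phi> k * (if m - k = c then 1 else 0)) = (\<Sum>k\<in>A. if k = m - c then \<phi> k else 0)"
      by (intro sum.cong) auto
    then show ?thesis using fin A[of "m - c"] by (simp add: sum.delta)
  qed
  have rec: "h m - (coef_a + coef_b) * h (m - 1) + coef_a * coef_b * h (m - 2) = \<phi> m - \<phi> (m - 2)" for m
  proof -
    have "h m - (coef_a + coef_b) * h (m - 1) + coef_a * coef_b * h (m - 2)
      = (\<Sum>k\<in>A. \<phi> k * (weight_at_0 (m - k) - (coef_a + coef_b) * weight_at_0 (m - k - 1) + coef_a * coef_b * weight_at_0 (m - k - 2)))"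
      unfolding h_def sum_distrib_left sum_subtractf[symmetric] sum.distrib[symmetric]
      by (intro sum.cong) (simp_all add: algebra_simps)
    also have "\<dots> = \<phi> m - \<phi> (m - 2)"
      unfolding weight_at_0_rec right_diff_distrib sum_subtractf delta by simp
    finally show ?thesis .
  qed
  define S where "S = {k. \<phi> k \<noteq> 0}"
  have S: "finite S" "k \<in> S" using k A by (auto simp: S_def intro!: finite_subset[OF _ fin])
  define d where "d = Max S"
  have d: "\<phi> d \<noteq> 0" using Max_in[OF S(1)] S(2) by (auto simp: d_def S_def)
  have above: "\<phi> j = 0" if "j > d" for j
    using Max_ge[OF S(1), of j] that by (auto simp: d_def S_def)
  have below: "\<phi> j = 0" if "j < - d" for j
    using above[of "- j"] sym[of j] that by simp
  have h_below: "h m = 0" if "m < - d" for m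
    unfolding h_def using that below by (intro sum.neutral ballI) (metis diff_less_0_iff_less less_le_trans linorder_not_le mult_eq_0_iff weight_at_0_neg)
  have h_above: "h m = 0" if "m > d" for m
    using h_below[of "- m"] h_neg[of m] that by simp
  have "h (- d) = \<phi> d"
    using rec[of "- d"] h_below[of "- d - 1"] h_below[of "- d - 2"] below[of "- d - 2"] by (simp add: sym)
  moreover have "coef_a * coef_b * h d = - \<phi> d"
    using rec[of "d + 2"] h_above[of "d + 2"] h_above[of "1 + d"] above[of "d + 2"] by simp
  ultimately have "coef_a * coef_b * - \<phi> d = - \<phi> d"
    using h_neg[of d] by (metis minus_minus)
  then show False using d coef_ab_neq_1 by simp
qed

lemma fls_nth_times_lowest:
  fixes F C :: "'a::field fls"
  assumes F: "v \<le> fls_subdegree F" and C: "0 \<le> fls_subdegree C"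
  shows "fls_nth (F * C) v = fls_nth F v * fls_nth C 0"
proof -
  obtain f where f: "F = fls_shift (- v) (fps_to_fls f)"
    using fls_as_fps'[of F "- v"] F by auto
  obtain c where c: "C = fls_shift 0 (fps_to_fls c)"
    using fls_as_fps'[of C 0] C by auto
  have "F * C = fls_shift (- v) (fps_to_fls (f * c))"
    unfolding f c by (simp add: fls_times_fps_to_fls fls_shifted_times_simps)
  then show ?thesis unfolding f c by simp
qed

text \<open>The comparison takes place at the smallest power \<open>v\<close> of q^(1/2) in the
  expanded coefficients of \<open>f\<close>. This amounts to setting q^(1/2) = 0 after a
  normalization under which \<open>f\<close> does not vanish there.\<close>

lemma ct_nondegenerate:
  assumes f: "f \<in> sym_laurent" and orth: "\<And>m. ct AW_weight (f * msym m) = 0"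
  shows "f = 0"
proof (rule ccontr)
  assume "f \<noteq> 0"
  let ?A = "Poly_Mapping.keys f"
  define F where "F k = K_expand (Poly_Mapping.lookup f k)" for k
  have F0: "F k = 0 \<longleftrightarrow> k \<notin> ?A" for k
    by (simp add: F_def is_ring_hom_field(1)[OF is_ring_hom_K_expand] in_keys_iff)
  define v where "v = Min ((\<lambda>k. fls_subdegree (F k)) ` ?A)"
  have v: "v \<le> fls_subdegree (F k)" if "k \<in> ?A" for k
    unfolding v_def using that by (intro Min_le) auto
  have "v \<in> (\<lambda>k. fls_subdegree (F k)) ` ?A"
    unfolding v_def using \<open>f \<noteq> 0\<close> by (intro Min_in) auto
  then obtain k0 where k0: "k0 \<in> ?A" "v = fls_subdegree (F k0)" by auto
  have wc: "0 \<le> fls_subdegree (weight_coeff AW_weight n)" for n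
    unfolding weight_coeff_def by (rule fls_subdegree_fls_to_fps_gt0)
  have ct_Z: "ct AW_weight (f * Z m) = (\<Sum>k\<in>?A. F k * weight_coeff AW_weight (- k - m))" for m
  proof -
    have "f * Z m = (\<Sum>k\<in>?A. Poly_Mapping.single (k + m) (Poly_Mapping.lookup f k))"
      by (subst poly_mapping_sum_single[of f]) (simp add: sum_distrib_right mult_single)
    then show ?thesis by (simp add: ct_sum ct_single F_def algebra_simps)
  qed
  have "fls_nth (F k0) v = 0"
  proof (rule symmetric_weight_at_0_nondegenerate[where \<phi> = "\<lambda>k. fls_nth (F k) v" and A = ?A])
    show "fls_nth (F k) v = 0" if "k \<notin> ?A" for k
    proof -
      have "F k = 0" using that F0 by blast
      then show ?thesis by simp
    qed
    show "fls_nth (F (- k)) v = fls_nth (F k) v" for k by (simp add: F_def sym_lookup_minus[OF f])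
    fix m
    \<comment> \<open>Orthogonality is given for natural \<open>m\<close> only, but the expression
      is unchanged when \<open>m\<close> is negated.\<close>
    have *: "(\<Sum>k\<in>?A. F k * (weight_coeff AW_weight (- k - m) + weight_coeff AW_weight (- k + m))) = 0" if "m \<ge> 0" for m
    proof -
      have "ct AW_weight (f * Z m) + ct AW_weight (f * Z (- m)) = ct AW_weight (f * msym (nat m))"
        using that by (simp add: msym_def distrib_left ct_add)
      then show ?thesis using orth[of "nat m"] by (simp add: ct_Z sum.distrib distrib_left)
    qed
    have "(\<Sum>k\<in>?A. F k * (weight_coeff AW_weight (- k - m) + weight_coeff AW_weight (- k + m))) = 0"
      using *[of m] *[of "- m"] by (cases "m \<ge> 0") (simp_all add: add.commute)
    then have "fls_nth (\<Sum>k\<in>?A. F k * (weight_coeff AW_weight (- k - m) + weight_coeff AW_weight (- k + m))) v = 0"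
      by simp
    moreover have "fls_nth (F k * (weight_coeff AW_weight (- k - m) + weight_coeff AW_weight (- k + m))) v
        = fls_nth (F k) v * (weight_at_0 (- k - m) + weight_at_0 (- k + m))" if "k \<in> ?A" for k
      unfolding distrib_left fls_plus_nth weight_at_0_def using v[OF that] wc by (simp add: fls_nth_times_lowest)
    ultimately show "(\<Sum>k\<in>?A. fls_nth (F k) v * (weight_at_0 (- k - m) + weight_at_0 (- k + m))) = 0"
      by (simp add: fls_nth_sum)
  qed simp
  then show False using k0 F0 nth_fls_subdegree_zero_iff by auto
qed

text \<open>A vanishing norm would make \<open>AW_p n\<close> orthogonal to the whole eigenbasis,
  against nondegeneracy.\<close>

lemma ct_AW_p_norm_neq_0: "ct AW_weight (AW_p n * AW_p n) \<noteq> 0"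
proof
  assume 0: "ct AW_weight (AW_p n * AW_p n) = 0"
  have "ct AW_weight (AW_p n * f) = 0" if f: "f \<in> sym_laurent" for f
  proof -
    obtain k x where f_eq: "f = (\<Sum>j<k. laurent_const (x j) * AW_p j)"
      by (rule sym_laurent_span[OF f])
    have "ct AW_weight (AW_p n * AW_p j) = 0" for j
      using 0 ct_AW_p_orthogonal[of n j] by (cases "n = j") auto
    then show ?thesis
      unfolding f_eq sum_distrib_left by (simp add: ct_sum mult.left_commute[of "AW_p n"] ct_const)
  qed
  then have "AW_p n = 0" by (intro ct_nondegenerate AW_p_sym) (simp add: sym_laurent_closed)
  then show False using monic_AW_p[of n] by (simp add: monic_def)
qed

section \<open>Identification of the eigenfunctions with the Askey-Wilson polynomials\<close>

lemma laurent_star_msym: "laurent_star (msym m) = msym m"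
proof -
  note S = is_ring_homD[OF is_ring_hom_K_star]
  have star: "laurent_star = eval_poly_mapping (\<lambda>c. Poly_Mapping.single 0 (K_star c)) (\<lambda>n. Poly_Mapping.single (- n) 1)"
    by (simp add: fun_eq_iff laurent_star_def eval_poly_mapping_def mult_single)
  have add: "laurent_star (f + g) = laurent_star f + laurent_star g" for f g
    unfolding star by (rule eval_poly_mapping_add) (simp add: S single_add)
  have "laurent_star (Poly_Mapping.single n 1) = Poly_Mapping.single (- n) 1" for n
    unfolding star by (simp add: S mult_single)
  then show ?thesis by (simp add: msym_def add add.commute)
qed

text \<open>\<open>msym 0\<close> is 2; replacing it by 1 gives a monic family, to which
  \<open>monic_span\<close> applies.\<close>

definition msym' :: "nat \<Rightarrow> laurent" where "msym' n = (if n = 0 then 1 else msym n)"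

lemma monic_msym': "monic n (msym' n)"
  by (simp add: msym'_def monic_1 monic_msym)

lemma msym'_eq: "msym' n = laurent_const (if n = 0 then 1 / 2 else 1) * msym n"
proof -
  have "msym 0 = Poly_Mapping.single 0 2"
    by (simp add: msym_def flip: single_add)
  then have "laurent_const (1 / 2) * msym 0 = 1"
    using ratfun_two_neq_0[where 'v = 5]
    by (simp add: laurent_const_def mult_single del: single_numeral)
  then show ?thesis by (simp add: msym'_def is_ring_homD[OF laurent_const_hom])
qed

lemma msym_span:
  assumes "sym_below n f"
  shows "\<exists>k. f = (\<Sum>j<n. laurent_const (k j) * msym j)"
proof -
  obtain x where x: "f = (\<Sum>j<n. laurent_const (x j) * msym' j)"
    using monic_span[of n msym' f] monic_msym' assms by blast
  show ?thesis
    by (rule exI[of _ "\<lambda>j. x j * (if j = 0 then 1 / 2 else 1)"])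
       (simp only: x msym'_eq is_ring_homD(3)[OF laurent_const_hom] mult.assoc)
qed

text \<open>As \<open>laurent_star\<close> fixes \<open>msym m\<close>, the pairing with it is the
  bilinear constant term. The lower \<open>msym\<close> and the lower \<open>AW_p\<close> span the
  same space, so the orthogonality conditions agree. The nonzero norms then force f -
  \<open>AW_p n\<close>, which has lower degree, to vanish.\<close>

lemma is_sym_AW_poly_iff: "is_sym_AW_poly n f \<longleftrightarrow> f = AW_p n"
proof (cases "n = 0")
  case True
  have "sym_below 0 (AW_p 0 - laurent_const 1 * 1)"
    using monic_diff[OF _ monic_1, of "AW_p 0"] monic_AW_p[of 0] by (simp add: monic_def)
  then have "AW_p 0 - 1 = 0"
    by (intro poly_mapping_eqI) (simp add: sym_below_def is_ring_homD[OF laurent_const_hom])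
  then show ?thesis using True by (auto simp: is_sym_AW_poly_def sym_laurent_closed)
next
  case False
  then have n: "n > 0" by simp
  have orth_iff: "(\<forall>m<n. AW_pairing f (msym m) = 0) \<longleftrightarrow> (\<forall>m<n. ct AW_weight (f * AW_p m) = 0)" for f
  proof
    assume *: "\<forall>m<n. AW_pairing f (msym m) = 0"
    show "\<forall>m<n. ct AW_weight (f * AW_p m) = 0"
    proof (intro allI impI)
      fix m assume m: "m < n"
      obtain k where k: "AW_p m = (\<Sum>j<Suc m. laurent_const (k j) * msym j)"
        using msym_span[of "Suc m" "AW_p m"] monic_AW_p[of m] unfolding monic_def by blast
      have "ct AW_weight (f * msym j) = 0" if "j < Suc m" for j
        using * that m by (auto simp: AW_pairing_eq_ct laurent_star_msym)
      then show "ct AW_weight (f * AW_p m) = 0"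
        unfolding k sum_distrib_left ct_sum mult.left_commute[of f] ct_const by (intro sum.neutral) auto
    qed
  next
    assume *: "\<forall>m<n. ct AW_weight (f * AW_p m) = 0"
    show "\<forall>m<n. AW_pairing f (msym m) = 0"
    proof (intro allI impI)
      fix m assume m: "m < n"
      obtain x where x: "msym m = (\<Sum>j<Suc m. laurent_const (x j) * AW_p j)"
        using monic_span[of "Suc m" AW_p] monic_AW_p sym_below_msym by blast
      have "ct AW_weight (f * AW_p j) = 0" if "j < Suc m" for j using * that m by auto
      then show "AW_pairing f (msym m) = 0"
        unfolding AW_pairing_eq_ct laurent_star_msym
        unfolding x sum_distrib_left ct_sum mult.left_commute[of f] ct_const by (intro sum.neutral) auto
    qed
  qed
  have expansion_iff: "(\<exists>k. f = msym n + (\<Sum>j<n. laurent_const (k j) * msym j)) \<longleftrightarrow> monic n f"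
    if f: "f \<in> sym_laurent" for f
  proof
    assume "\<exists>k. f = msym n + (\<Sum>j<n. laurent_const (k j) * msym j)"
    then obtain k where k: "f = msym n + (\<Sum>j<n. laurent_const (k j) * msym j)" by blast
    have s: "sym_below n (\<Sum>j<n. laurent_const (k j) * msym j)"
      by (intro sym_below_sum sym_below_closed(3) sym_below_closed(5)[OF sym_below_msym]) simp
    show "monic n f"
      using monic_msym[OF n] s sym_below_closed(5)[OF s, of "Suc n"] unfolding k
      by (auto simp: monic_def lookup_add sym_below_closed) (simp add: sym_below_def)
  next
    assume m: "monic n f"
    have "sym_below n (f - laurent_const 1 * msym n)"
      using monic_diff[OF _ monic_msym[OF n], of f] m by (simp add: monic_def)
    then obtain k where "f - laurent_const 1 * msym n = (\<Sum>j<n. laurent_const (k j) * msym j)"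
      using msym_span by blast
    then have "f = msym n + (\<Sum>j<n. laurent_const (k j) * msym j)"
      by (simp add: is_ring_homD[OF laurent_const_hom] algebra_simps)
    then show "\<exists>k. f = msym n + (\<Sum>j<n. laurent_const (k j) * msym j)" by blast
  qed
  show ?thesis
  proof
    assume "f = AW_p n"
    then show "is_sym_AW_poly n f"
      using n monic_AW_p[of n] AW_p_sym[of n] ct_AW_p_orthogonal[of n]
      by (simp add: is_sym_AW_poly_def orth_iff expansion_iff)
  next
    assume a: "is_sym_AW_poly n f"
    then have f: "f \<in> sym_laurent" by (simp add: is_sym_AW_poly_def)
    have fm: "monic n f" and orth: "\<And>m. m < n \<Longrightarrow> ct AW_weight (f * AW_p m) = 0"
      using a n by (simp_all add: is_sym_AW_poly_def expansion_iff[OF f] orth_iff)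
    have "sym_below n (f - laurent_const 1 * AW_p n)"
      using monic_diff[OF _ monic_AW_p[of n], of f] fm by (simp add: monic_def)
    then obtain x where "f - laurent_const 1 * AW_p n = (\<Sum>j<n. laurent_const (x j) * AW_p j)"
      using monic_span[of n AW_p] monic_AW_p by blast
    then have x: "f - AW_p n = (\<Sum>j<n. laurent_const (x j) * AW_p j)"
      by (simp add: is_ring_homD[OF laurent_const_hom])
    have "x m = 0" if m: "m < n" for m
    proof -
      have "0 = ct AW_weight ((f - AW_p n) * AW_p m)"
        using orth[OF m] ct_AW_p_orthogonal[of n m] m by (simp add: left_diff_distrib ct_diff)
      also have "\<dots> = (\<Sum>j<n. K_expand (x j) * ct AW_weight (AW_p j * AW_p m))"
        unfolding x sum_distrib_right ct_sum mult.assoc ct_const ..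
      also have "\<dots> = (\<Sum>j<n. if j = m then K_expand (x j) * ct AW_weight (AW_p j * AW_p m) else 0)"
        by (intro sum.cong) (auto simp: ct_AW_p_orthogonal)
      also have "\<dots> = K_expand (x m) * ct AW_weight (AW_p m * AW_p m)" using m by simp
      finally show ?thesis
        using ct_AW_p_norm_neq_0[of m] by (simp add: is_ring_hom_field(1)[OF is_ring_hom_K_expand])
    qed
    then have "f - AW_p n = 0" unfolding x by (simp add: is_ring_homD[OF laurent_const_hom])
    then show "f = AW_p n" by simp
  qed
qed

lemma sym_AW_poly_eq: "sym_AW_poly n = AW_p n"
  unfolding sym_AW_poly_def is_sym_AW_poly_iff by simp

lemma AW_L_sym_AW_poly: "AW_L (of_laurent (AW_p n)) = Kz_const (AW_eigenvalue n) * of_laurent (AW_p n)"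
  by (simp add: lau_L(1)[OF AW_p_sym] lau_L_AW_p is_ring_homD[OF is_ring_hom_of_laurent] Kz_const_def)

section \<open>Shift operators\<close>

text \<open>The window of shifts may exceed the support of \<open>c\<close>, so that operators of
  different order can be written with one common \<open>N\<close>.\<close>

definition diff_op :: "nat \<Rightarrow> (int \<Rightarrow> Kz) \<Rightarrow> Kz \<Rightarrow> Kz" where
  "diff_op N c f = (\<Sum>n=-int N..int N. c n * T_pow n f)"

definition order_le :: "nat \<Rightarrow> (int \<Rightarrow> Kz) \<Rightarrow> bool" where
  "order_le N c \<longleftrightarrow> (\<forall>n. \<bar>n\<bar> > int N \<longrightarrow> c n = 0)"

lemma diff_op_extend:
  assumes "order_le N c" "N \<le> M"
  shows "diff_op M c = diff_op N c"
  unfolding diff_op_def fun_eq_iff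
  using assms by (intro allI sum.mono_neutral_right) (auto simp: order_le_def)

lemma is_difference_operator_iff:
  "is_difference_operator S \<longleftrightarrow> (\<exists>N c. order_le N c \<and> S = diff_op N c)"
proof
  assume "is_difference_operator S"
  then obtain c where fin: "finite {n. c n \<noteq> 0}" and S: "S = (\<lambda>f. \<Sum>n \<in> {n. c n \<noteq> 0}. c n * T_pow n f)"
    by (auto simp: is_difference_operator_def)
  define N where "N = Max (insert 0 ((\<lambda>n. nat \<bar>n\<bar>) ` {n. c n \<noteq> 0}))"
  have bound: "nat \<bar>n\<bar> \<le> N" if "c n \<noteq> 0" for n
    unfolding N_def using that fin by (intro Max_ge) auto
  have N: "\<bar>n\<bar> \<le> int N" if "c n \<noteq> 0" for n
    using bound[OF that] by linarith
  then have "order_le N c" by (force simp: order_le_def)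
  moreover have "{n. c n \<noteq> 0} \<subseteq> {- int N..int N}"
  proof
    fix n assume "n \<in> {n. c n \<noteq> 0}"
    then have "\<bar>n\<bar> \<le> int N" using N by simp
    then show "n \<in> {- int N..int N}" unfolding atLeastAtMost_iff by linarith
  qed
  then have "S = diff_op N c"
    unfolding S diff_op_def fun_eq_iff by (intro allI sum.mono_neutral_left) auto
  ultimately show "\<exists>N c. order_le N c \<and> S = diff_op N c" by blast
next
  assume "\<exists>N c. order_le N c \<and> S = diff_op N c"
  then obtain N c where c: "order_le N c" and S: "S = diff_op N c" by blast
  have sub: "{n. c n \<noteq> 0} \<subseteq> {- int N..int N}"
    using c by (auto simp: order_le_def) (metis abs_ge_minus_self abs_ge_self le_less_linear minus_le_iff order_trans)+
  have "S = (\<lambda>f. \<Sum>n \<in> {n. c n \<noteq> 0}. c n * T_pow n f)"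
    unfolding S diff_op_def fun_eq_iff using sub
    by (intro allI sum.mono_neutral_right) auto
  then show "is_difference_operator S"
    unfolding is_difference_operator_def using finite_subset[OF sub] by blast
qed

lemma diff_op_linear:
  shows "diff_op N c (f + g) = diff_op N c f + diff_op N c g"
    and "diff_op N c (Kz_const k * f) = Kz_const k * diff_op N c f"
    and "diff_op N c 0 = 0"
    and "diff_op N c (\<Sum>x\<in>A. h x) = (\<Sum>x\<in>A. diff_op N c (h x))"
proof -
  show add: "diff_op N c (f + g) = diff_op N c f + diff_op N c g" for f g
    by (simp add: diff_op_def is_ring_homD[OF is_ring_hom_T_pow] distrib_left sum.distrib)
  show "diff_op N c (Kz_const k * f) = Kz_const k * diff_op N c f"
    by (simp add: diff_op_def is_ring_homD[OF is_ring_hom_T_pow] sum_distrib_left mult_ac)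
  show 0: "diff_op N c 0 = 0"
    by (simp add: diff_op_def is_ring_homD[OF is_ring_hom_T_pow])
  show "diff_op N c (\<Sum>x\<in>A. h x) = (\<Sum>x\<in>A. diff_op N c (h x))"
    by (induction A rule: infinite_finite_induct) (simp_all add: 0 add)
qed

lemma diff_op_coeffs:
  shows "diff_op N (\<lambda>n. c n - d n) f = diff_op N c f - diff_op N d f"
    and "diff_op N (\<lambda>n. c n + d n) f = diff_op N c f + diff_op N d f"
    and "diff_op N (\<lambda>n. x * c n) f = x * diff_op N c f"
  by (simp_all add: diff_op_def left_diff_distrib sum_subtractf distrib_right sum.distrib sum_distrib_left mult.assoc)

lemma is_difference_operator_add:
  assumes "is_difference_operator S" "is_difference_operator R"
  shows "is_difference_operator (\<lambda>f. S f + R f)"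
proof -
  obtain N c M d where c: "order_le N c" "S = diff_op N c" and d: "order_le M d" "R = diff_op M d"
    using assms by (auto simp: is_difference_operator_iff)
  let ?k = "max N M"
  have "S = diff_op ?k c" "R = diff_op ?k d"
    using diff_op_extend[OF c(1), of ?k] diff_op_extend[OF d(1), of ?k] c(2) d(2) by simp_all
  then have "(\<lambda>f. S f + R f) = diff_op ?k (\<lambda>n. c n + d n)"
    by (simp add: fun_eq_iff diff_op_coeffs)
  moreover have "order_le ?k (\<lambda>n. c n + d n)"
    using c(1) d(1) by (simp add: order_le_def)
  ultimately show ?thesis by (auto simp: is_difference_operator_iff)
qed

lemma is_difference_operator_mult:
  assumes "is_difference_operator S"
  shows "is_difference_operator (\<lambda>f. x * S f)"
proof -
  obtain N c where c: "order_le N c" "S = diff_op N c"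
    using assms by (auto simp: is_difference_operator_iff)
  have "(\<lambda>f. x * S f) = diff_op N (\<lambda>n. x * c n)"
    by (simp add: fun_eq_iff diff_op_coeffs c(2))
  moreover have "order_le N (\<lambda>n. x * c n)" using c(1) by (simp add: order_le_def)
  ultimately show ?thesis by (auto simp: is_difference_operator_iff)
qed

lemma is_difference_operator_sum:
  assumes "\<And>i. i \<in> A \<Longrightarrow> is_difference_operator (S i)"
  shows "is_difference_operator (\<lambda>f. \<Sum>i\<in>A. S i f)"
proof -
  have zero: "is_difference_operator (\<lambda>f. 0)"
    unfolding is_difference_operator_iff
    by (rule exI[of _ 0], rule exI[of _ "\<lambda>_. 0"]) (simp add: order_le_def diff_op_def fun_eq_iff)
  show ?thesis using assms
    by (induction A rule: infinite_finite_induct) (simp_all add: zero is_difference_operator_add)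
qed

text \<open>Coefficients of a composition, from (c T^n)(d T^m) = c T^n(d) T^(n+m).\<close>

definition diff_op_mult :: "nat \<Rightarrow> (int \<Rightarrow> Kz) \<Rightarrow> (int \<Rightarrow> Kz) \<Rightarrow> int \<Rightarrow> Kz" where
  "diff_op_mult N c d k = (\<Sum>n=-int N..int N. c n * T_pow n (d (k - n)))"

lemma order_le_diff_op_mult: "order_le M d \<Longrightarrow> order_le (N + M) (diff_op_mult N c d)"
  by (auto simp: order_le_def diff_op_mult_def is_ring_homD[OF is_ring_hom_T_pow] intro!: sum.neutral)

lemma diff_op_compose:
  assumes d: "order_le M d"
  shows "diff_op N c (diff_op M d f) = diff_op (N + M) (diff_op_mult N c d) f"
proof -
  note T = is_ring_homD[OF is_ring_hom_T_pow]
  have inner: "T_pow n (diff_op M d f) = (\<Sum>k=-int (N + M)..int (N + M). T_pow n (d (k - n)) * T_pow k f)"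
    if n: "n \<in> {-int N..int N}" for n
  proof -
    have "T_pow n (diff_op M d f) = (\<Sum>m=-int M..int M. T_pow n (d m) * T_pow (n + m) f)"
      by (simp add: diff_op_def T T_pow_T_pow)
    also have "\<dots> = (\<Sum>k=n-int M..n+int M. T_pow n (d (k - n)) * T_pow k f)"
      by (rule sum.reindex_bij_witness[of _ "\<lambda>k. k - n" "\<lambda>m. n + m"]) auto
    also have "\<dots> = (\<Sum>k=-int (N + M)..int (N + M). T_pow n (d (k - n)) * T_pow k f)"
      using n d by (intro sum.mono_neutral_left) (auto simp: order_le_def T)
    finally show ?thesis .
  qed
  have "diff_op N c (diff_op M d f)
      = (\<Sum>n=-int N..int N. \<Sum>k=-int (N + M)..int (N + M). c n * T_pow n (d (k - n)) * T_pow k f)"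
    unfolding diff_op_def[of N] by (intro sum.cong refl) (simp add: inner sum_distrib_left mult.assoc)
  also have "\<dots> = diff_op (N + M) (diff_op_mult N c d) f"
    unfolding diff_op_def diff_op_mult_def sum_distrib_right by (rule sum.swap)
  finally show ?thesis .
qed

lemma diff_op_mult_top:
  assumes d: "order_le M d"
  shows "diff_op_mult N c d (int (N + M)) = c (int N) * T_pow (int N) (d (int M))"
proof -
  have "diff_op_mult N c d (int (N + M)) = (\<Sum>n=-int N..int N. if n = int N then c n * T_pow n (d (int M)) else 0)"
    unfolding diff_op_mult_def using d
    by (intro sum.cong) (auto simp: order_le_def is_ring_homD[OF is_ring_hom_T_pow])
  then show ?thesis by simp
qed

text \<open>A Vandermonde argument: vanishing power sums extend to arbitrary polynomials in the
  nodes, and the product vanishing at all nodes except \<open>x i\<close> isolates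
  \<open>y i\<close>.\<close>

lemma power_sums_independent:
  fixes x y :: "'i \<Rightarrow> 'f::field"
  assumes fin: "finite I" and inj: "inj_on x I" and sum: "\<And>k::nat. (\<Sum>i\<in>I. y i * x i ^ k) = 0" and i: "i \<in> I"
  shows "y i = 0"
proof -
  have poly: "(\<Sum>i\<in>I. y i * poly p (x i)) = 0" for p
  proof -
    have "(\<Sum>i\<in>I. y i * poly p (x i)) = (\<Sum>k\<le>degree p. coeff p k * (\<Sum>i\<in>I. y i * x i ^ k))"
      unfolding poly_altdef sum_distrib_left by (subst sum.swap) (simp add: mult_ac)
    then show ?thesis by (simp add: sum)
  qed
  define p where "p = (\<Prod>j\<in>I - {i}. [:- x j, 1:])"
  have "(\<Sum>j\<in>I. y j * poly p (x j)) = (\<Sum>j\<in>I. if j = i then y i * poly p (x i) else 0)"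
    using fin by (intro sum.cong) (auto simp: p_def poly_prod)
  then have "y i * poly p (x i) = 0" using poly[of p] fin i by simp
  moreover have "poly p (x i) \<noteq> 0"
    using fin inj i by (auto simp: p_def poly_prod inj_on_def)
  ultimately show ?thesis by simp
qed

section \<open>Difference operators are determined by their action on symmetric Laurent
  polynomials\<close>

definition T_z :: "int \<Rightarrow> Kz" where "T_z n = Kz_const (q_half powi n) * Kz_z"

lemma Kz_const_eq_0_iff: "Kz_const c = 0 \<longleftrightarrow> c = 0"
  by (rule is_ring_hom_field(1)[OF is_ring_hom_Kz_const])

lemma q_half_powi_eq_1_iff: "q_half powi n = 1 \<longleftrightarrow> n = 0"
  using K_monomial_eq_1[of 0 0 0 0 n] by auto

lemma T_z_inj: "T_z n = T_z m \<longleftrightarrow> n = m"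
proof
  assume "T_z n = T_z m"
  then have "q_half powi n = q_half powi m"
    using Kz_z_neq_0 by (simp add: T_z_def is_ring_hom_field(2)[OF is_ring_hom_Kz_const])
  then have "q_half powi (n - m) = 1" by (simp add: power_int_diff q_half_neq_0)
  then show "n = m" by (simp add: q_half_powi_eq_1_iff)
qed simp

lemma T_z_neq_inverse: "T_z n \<noteq> inverse (T_z m)"
proof
  assume "T_z n = inverse (T_z m)"
  moreover have "T_z m \<noteq> 0" by (simp add: T_z_def Kz_const_eq_0_iff Kz_z_neq_0 q_half_neq_0)
  ultimately have "T_z n * T_z m = 1" by simp
  then have "1 - Kz_const (q_half powi n * q_half powi m) * Kz_z ^ 2 = 0"
    by (simp add: T_z_def is_ring_homD[OF is_ring_hom_Kz_const] power2_eq_square mult_ac)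
  with one_minus_Kz_z_squared_neq_0 show False by blast
qed

lemma T_pow_msym: "T_pow n (of_laurent (msym k)) = T_z n ^ k + inverse (T_z n) ^ k"
  by (simp add: msym_def is_ring_homD[OF is_ring_hom_of_laurent] is_ring_homD[OF is_ring_hom_T_pow]
      is_ring_hom_field[OF is_ring_hom_T_pow] of_laurent_single T_z_def power_int_minus power_inverse
      power_mult_distrib is_ring_homD[OF is_ring_hom_Kz_const])

text \<open>Applied to z^k + z^-k for all k, the operator yields power sums in the points q^(n/2) z
  and their inverses, which are pairwise distinct. Each coefficient belongs to two nodes, told apart
  by the boolean index.\<close>

lemma diff_op_vanishing:
  assumes c: "order_le N c" and zero: "\<And>f. f \<in> sym_laurent \<Longrightarrow> diff_op N c (of_laurent f) = 0"
  shows "c n = 0"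
proof (cases "n \<in> {-int N..int N}")
  case True
  let ?I = "{-int N..int N} \<times> (UNIV :: bool set)"
  define x where "x i = (if snd i then T_z (fst i) else inverse (T_z (fst i)))" for i :: "int \<times> bool"
  have "(c \<circ> fst) (n, True) = 0"
  proof (rule power_sums_independent[where x = x and I = ?I])
    show "inj_on x ?I"
      using T_z_inj T_z_neq_inverse T_z_neq_inverse[symmetric]
      by (auto simp: inj_on_def x_def split: if_splits)
    show "(\<Sum>i\<in>?I. (c \<circ> fst) i * x i ^ k) = 0" for k
    proof -
      have "(\<Sum>i\<in>?I. (c \<circ> fst) i * x i ^ k) = (\<Sum>n=-int N..int N. \<Sum>b\<in>UNIV. c n * x (n, b) ^ k)"
        by (simp add: sum.cartesian_product case_prod_beta)
      also have "\<dots> = diff_op N c (of_laurent (msym k))"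
        unfolding diff_op_def T_pow_msym by (intro sum.cong) (simp_all add: UNIV_bool x_def distrib_left)
      also have "\<dots> = 0" by (rule zero) (rule sym_laurent_closed)
      finally show ?thesis .
    qed
  qed (use True in auto)
  then show ?thesis by simp
next
  case False
  then have "\<bar>n\<bar> > int N" by auto
  then show ?thesis using c by (simp add: order_le_def)
qed

text \<open>Conjugation by z -> z^-1 does not change the action on symmetric elements, so the
  difference of the two coefficient families vanishes.\<close>

lemma diff_op_sym_coeffs:
  assumes c: "order_le N c" and sym: "\<And>f. f \<in> sym_laurent \<Longrightarrow> \<exists>g\<in>sym_laurent. diff_op N c (of_laurent f) = of_laurent g"
  shows "c (- n) = Kz_inv (c n)"
proof -
  note I = is_ring_homD[OF is_ring_hom_Kz_inv]
  let ?d = "\<lambda>n. Kz_inv (c (- n)) - c n"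
  have "?d (- n) = 0"
  proof (rule diff_op_vanishing)
    show "order_le N ?d" using c by (simp add: order_le_def I)
    fix f assume f: "f \<in> sym_laurent"
    then obtain g where g: "g \<in> sym_laurent" "diff_op N c (of_laurent f) = of_laurent g" using sym by blast
    have "diff_op N (\<lambda>n. Kz_inv (c (- n))) (of_laurent f) = (\<Sum>n=-int N..int N. Kz_inv (c n) * T_pow (- n) (of_laurent f))"
      unfolding diff_op_def by (rule sum.reindex_bij_witness[of _ uminus uminus]) auto
    also have "\<dots> = Kz_inv (diff_op N c (of_laurent f))"
      by (simp add: diff_op_def I Kz_inv_T_pow Kz_inv_of_laurent sym_laurentD[OF f])
    also have "\<dots> = diff_op N c (of_laurent f)"
      by (simp add: g Kz_inv_of_laurent sym_laurentD)
    finally show "diff_op N ?d (of_laurent f) = 0" by (simp add: diff_op_coeffs)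
  qed
  then show ?thesis by simp
qed

section \<open>Powers of L and their leading coefficients\<close>

definition AW_L_coeff :: "int \<Rightarrow> Kz" where
  "AW_L_coeff n = (if n = 2 then Kz_const (inverse AW_r) * AW_A Kz_z
     else if n = -2 then Kz_const (inverse AW_r) * AW_A (inverse Kz_z)
     else if n = 0 then Kz_const (AW_r + inverse AW_r) - Kz_const (inverse AW_r) * (AW_A Kz_z + AW_A (inverse Kz_z))
     else 0)"

lemma order_le_AW_L: "order_le 2 AW_L_coeff"
  by (auto simp: order_le_def AW_L_coeff_def)

lemma AW_L_eq_diff_op: "AW_L = diff_op 2 AW_L_coeff"
proof
  fix f
  have "{- int 2..int 2} = {-2, -1, 0, 1, 2}" by auto
  then show "AW_L f = diff_op 2 AW_L_coeff f"
    by (simp add: diff_op_def AW_L_def Let_def AW_L_coeff_def AW_r_def[symmetric] algebra_simps)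
qed

text \<open>Leading coefficient of L^k up to the factor r^-k, because
  \<open>T_pow (2 * int i)\<close> replaces z by q^i z.\<close>

definition AW_A_prod :: "nat \<Rightarrow> Kz" where
  "AW_A_prod k = (\<Prod>i<k. T_pow (2 * int i) (AW_A Kz_z))"

lemma T_pow_2_AW_A_prod: "AW_A Kz_z * T_pow 2 (AW_A_prod k) = AW_A_prod (Suc k)"
  unfolding AW_A_prod_def is_ring_hom_prod[OF is_ring_hom_T_pow] prod.lessThan_Suc_shift T_pow_T_pow
  by (simp add: algebra_simps)

lemma AW_L_power:
  "\<exists>e. order_le (2 * k) e \<and> AW_L ^^ k = diff_op (2 * k) e \<and> e (2 * int k) = Kz_const (inverse AW_r ^ k) * AW_A_prod k"
proof (induction k)
  case 0
  show ?case
    by (rule exI[of _ "\<lambda>n. if n = 0 then 1 else 0"])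
       (auto simp: order_le_def diff_op_def AW_A_prod_def is_ring_homD[OF is_ring_hom_Kz_const] fun_eq_iff)
next
  case (Suc k)
  then obtain e where e: "order_le (2 * k) e" "AW_L ^^ k = diff_op (2 * k) e"
    "e (2 * int k) = Kz_const (inverse AW_r ^ k) * AW_A_prod k" by blast
  let ?e = "diff_op_mult 2 AW_L_coeff e"
  have "AW_L ^^ Suc k = diff_op (2 * Suc k) ?e"
  proof -
    have "AW_L ((AW_L ^^ k) f) = diff_op (2 + 2 * k) ?e f" for f
      unfolding e(2) unfolding AW_L_eq_diff_op by (rule diff_op_compose[OF e(1)])
    then show ?thesis by (simp add: fun_eq_iff)
  qed
  moreover have "order_le (2 * Suc k) ?e"
    using order_le_diff_op_mult[OF e(1), of 2 AW_L_coeff] by simp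
  moreover have "?e (2 * int (Suc k)) = Kz_const (inverse AW_r ^ Suc k) * AW_A_prod (Suc k)"
  proof -
    have "?e (2 * int (Suc k)) = AW_L_coeff 2 * T_pow 2 (e (2 * int k))"
      using diff_op_mult_top[OF e(1), of 2 AW_L_coeff] by simp
    then show ?thesis
      unfolding e(3) T_pow_2_AW_A_prod[symmetric]
      by (simp add: AW_L_coeff_def is_ring_homD[OF is_ring_hom_T_pow] is_ring_homD[OF is_ring_hom_Kz_const] mult_ac)
  qed
  ultimately show ?case by blast
qed

section \<open>Rational functions invariant under z -> q z\<close>

lemma lowest_exists:
  assumes "u \<noteq> 0"
  obtains i x where "lowest i x u" "x \<noteq> 0"
proof
  let ?i = "Min (Poly_Mapping.keys u)"
  have "?i \<in> Poly_Mapping.keys u" using assms by (intro Min_in) auto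
  then show "Poly_Mapping.lookup u ?i \<noteq> 0" by (simp add: in_keys_iff)
  have "Poly_Mapping.lookup u k = 0" if "k < ?i" for k
  proof -
    have "k \<notin> Poly_Mapping.keys u"
    proof
      assume "k \<in> Poly_Mapping.keys u"
      then have "?i \<le> k" by (intro Min_le) simp_all
      with that show False by simp
    qed
    then show ?thesis by (simp add: in_keys_iff)
  qed
  then show "lowest ?i (Poly_Mapping.lookup u ?i) u" by (simp add: lowest_def)
qed

lemma lowest_tau: "lowest i x u \<Longrightarrow> lowest i (c powi i * x) (tau c u)"
  by (simp add: lowest_def lookup_tau)

lemma par_q_powi: "par_q powi n = q_half powi (2 * n)"
  by (simp only: par_q_def power_int_mult power_int_numeral)

text \<open>Comparison of lowest terms gives q^i = q^j, and q is not a root of unity.\<close>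

lemma q_invariant_ratio_lowest:
  assumes "tau par_q u * v = u * tau par_q v" "lowest i x u" "x \<noteq> 0" "lowest j y v" "y \<noteq> 0"
  shows "i = j"
proof -
  have "lowest (i + j) (par_q powi i * x * y) (tau par_q u * v)" "lowest (i + j) (x * (par_q powi j * y)) (u * tau par_q v)"
    by (intro lowest_mult lowest_tau assms)+
  then have "par_q powi i = par_q powi j" using assms(1,3,5) by (simp add: lowest_def)
  then have "q_half powi (2 * i - 2 * j) = 1" unfolding par_q_powi by (simp add: power_int_diff q_half_neq_0)
  then show "i = j" by (simp add: q_half_powi_eq_1_iff)
qed

text \<open>For g = u / v the lowest exponents of u and v agree. Subtracting the multiple of v that
  cancels the lowest term of u leaves an element w with the same invariance but a larger lowest
  exponent, so w = 0.\<close>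

lemma T_pow_2_invariant:
  assumes "T_pow 2 g = g"
  shows "\<exists>k. g = Kz_const k"
proof -
  note O = is_ring_homD[OF is_ring_hom_of_laurent] and T = is_ring_homD[OF is_ring_hom_tau[OF par_q_neq_0]]
  obtain u v where g: "g = of_laurent u / of_laurent v" "v \<noteq> 0"
    by (cases g) (auto simp: of_laurent_def)
  then have v: "of_laurent v \<noteq> 0" "of_laurent (tau par_q v) \<noteq> 0"
    by (simp_all add: of_laurent_eq_0_iff tau_eq_0_iff par_q_neq_0)
  have "of_laurent (tau par_q u) / of_laurent (tau par_q v) = of_laurent u / of_laurent v"
    using assms unfolding g is_ring_hom_field(4)[OF is_ring_hom_T_pow] T_pow_of_laurent q_half_powi_2 .
  then have "of_laurent (tau par_q u * v) = of_laurent (u * tau par_q v)"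
    using v by (simp add: O field_simps)
  then have uv: "tau par_q u * v = u * tau par_q v" by (simp only: of_laurent_eq_iff)
  show ?thesis
  proof (cases "u = 0")
    case True
    then show ?thesis using g by (auto simp: O intro!: exI[of _ 0] simp: is_ring_homD[OF is_ring_hom_Kz_const])
  next
    case False
    then obtain i x where u: "lowest i x u" "x \<noteq> 0" using lowest_exists by blast
    obtain j y where v': "lowest j y v" "y \<noteq> 0" using lowest_exists g(2) by blast
    have ij: "i = j" by (rule q_invariant_ratio_lowest[OF uv u v'])
    define w where "w = u - laurent_const (x / y) * v"
    have c: "tau par_q (laurent_const (x / y)) = laurent_const (x / y)" by (simp add: laurent_const_def)
    have wv: "tau par_q w * v = w * tau par_q v"
      unfolding w_def T c left_diff_distrib right_diff_distrib uv by (simp add: mult_ac)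
    have "lowest i 0 w" using u v' ij by (auto simp: lowest_def w_def lookup_minus)
    have "w = 0"
    proof (rule ccontr)
      assume "w \<noteq> 0"
      then obtain k t where w: "lowest k t w" "t \<noteq> 0" using lowest_exists by blast
      have "k = i" using q_invariant_ratio_lowest[OF wv w v'] ij by simp
      then show False using w \<open>lowest i 0 w\<close> by (simp add: lowest_def)
    qed
    then have "u = laurent_const (x / y) * v" by (simp add: w_def)
    then have "g = Kz_const (x / y)" using g v by (simp add: O Kz_const_def)
    then show ?thesis by blast
  qed
qed

section \<open>Rational functions as quotients of polynomials, for the study of vanishing
  orders\<close>

definition laurent_of_poly :: "K poly \<Rightarrow> laurent" where
  "laurent_of_poly p = fold_coeffs (\<lambda>a x. laurent_const a + Z 1 * x) p 0"

lemma laurent_of_poly_0 [simp]: "laurent_of_poly 0 = 0"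
  by (simp add: laurent_of_poly_def)

lemma laurent_of_poly_pCons [simp]: "laurent_of_poly (pCons a p) = laurent_const a + Z 1 * laurent_of_poly p"
  by (cases "p = 0 \<and> a = 0") (auto simp: laurent_of_poly_def laurent_const_def)

lemma lookup_laurent_of_poly: "Poly_Mapping.lookup (laurent_of_poly p) k = (if k \<ge> 0 then coeff p (nat k) else 0)"
proof (induction p arbitrary: k)
  case (pCons a p)
  show ?case
  proof (cases "k = 0")
    case True
    then show ?thesis by (simp add: lookup_add laurent_const_def lookup_single lookup_single_mult pCons)
  next
    case False
    then have "nat k = Suc (nat (k - 1))" if "k \<ge> 0" using that by simp
    then show ?thesis using False
      by (auto simp: lookup_add laurent_const_def lookup_single_not_eq lookup_single_mult pCons)
  qed
qed simp

lemma laurent_of_poly_eq_iff: "laurent_of_poly p = laurent_of_poly r \<longleftrightarrow> p = r"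
proof
  assume "laurent_of_poly p = laurent_of_poly r"
  then have "Poly_Mapping.lookup (laurent_of_poly p) (int n) = Poly_Mapping.lookup (laurent_of_poly r) (int n)" for n
    by simp
  then show "p = r" by (intro poly_eqI) (simp add: lookup_laurent_of_poly)
qed simp

lemma laurent_of_poly_smult: "laurent_of_poly (smult a p) = laurent_const a * laurent_of_poly p"
  by (rule poly_mapping_eqI) (simp add: lookup_laurent_of_poly)

lemma is_ring_hom_laurent_of_poly: "is_ring_hom laurent_of_poly"
proof -
  note C = is_ring_homD[OF laurent_const_hom]
  have add: "laurent_of_poly (p + r) = laurent_of_poly p + laurent_of_poly r" for p r
    by (rule poly_mapping_eqI) (simp add: lookup_laurent_of_poly lookup_add)
  have "laurent_of_poly (p * r) = laurent_of_poly p * laurent_of_poly r" for p r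
    by (induction p) (simp_all add: add laurent_of_poly_smult C distrib_right mult.assoc)
  moreover have "laurent_of_poly 1 = 1" by (simp add: one_pCons C)
  ultimately show ?thesis by (simp add: is_ring_hom_def add)
qed

lemma tau_laurent_of_poly:
  assumes "c \<noteq> 0"
  shows "tau c (laurent_of_poly p) = laurent_of_poly (pcompose p [:0, c:])"
proof (induction p)
  case (pCons a p)
  note L = is_ring_homD[OF is_ring_hom_laurent_of_poly] and T = is_ring_homD[OF is_ring_hom_tau[OF assms]]
  have "Z 1 * Poly_Mapping.single 0 c = Poly_Mapping.single 1 c"
    by (simp add: mult_single)
  then show ?case using pCons
    by (simp add: T L pcompose_pCons laurent_of_poly_smult) (auto simp: laurent_const_def)
qed (simp add: is_ring_homD[OF is_ring_hom_tau[OF assms]])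

lemma laurent_shift_poly: "\<exists>n p. Z (int n) * u = laurent_of_poly p"
proof (induction u rule: poly_mapping_additive_induct)
  case (single k c)
  have "Z (int (nat (- k))) * Poly_Mapping.single k c = laurent_of_poly (monom c (nat k))"
    by (rule poly_mapping_eqI) (auto simp: lookup_laurent_of_poly mult_single lookup_single when_def)
  then show ?case by blast
next
  case (add u v)
  then obtain n p m r where u: "Z (int n) * u = laurent_of_poly p" and v: "Z (int m) * v = laurent_of_poly r"
    by blast
  have Z: "Z (int n) = laurent_of_poly (monom 1 n)" for n
    by (rule poly_mapping_eqI) (auto simp: lookup_laurent_of_poly lookup_single when_def)
  have "Z (int (n + m)) * (u + v) = Z (int m) * (Z (int n) * u) + Z (int n) * (Z (int m) * v)"
    by (simp add: distrib_left mult_single add.commute flip: mult.assoc)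
  also have "\<dots> = Z (int m) * laurent_of_poly p + Z (int n) * laurent_of_poly r"
    by (simp only: u v)
  also have "\<dots> = laurent_of_poly (monom 1 m * p + monom 1 n * r)"
    unfolding Z by (simp only: is_ring_homD[OF is_ring_hom_laurent_of_poly])
  finally show ?case by blast
qed

definition Kz_of_poly :: "K poly \<Rightarrow> Kz" where "Kz_of_poly p = of_laurent (laurent_of_poly p)"

lemma is_ring_hom_Kz_of_poly: "is_ring_hom Kz_of_poly"
  unfolding Kz_of_poly_def by (rule is_ring_hom_compose[OF is_ring_hom_of_laurent is_ring_hom_laurent_of_poly])

lemma Kz_of_poly_eq_iff: "Kz_of_poly p = Kz_of_poly r \<longleftrightarrow> p = r"
  by (simp add: Kz_of_poly_def of_laurent_eq_iff laurent_of_poly_eq_iff)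

lemma Kz_of_poly_eq_0_iff: "Kz_of_poly p = 0 \<longleftrightarrow> p = 0"
  using Kz_of_poly_eq_iff[of p 0] by (simp add: is_ring_homD[OF is_ring_hom_Kz_of_poly])

lemma T_pow_Kz_of_poly: "T_pow n (Kz_of_poly p) = Kz_of_poly (pcompose p [:0, q_half powi n:])"
  by (simp add: Kz_of_poly_def T_pow_of_laurent tau_laurent_of_poly q_half_neq_0)

lemma Kz_quotient_of_polys:
  obtains p r where "c = Kz_of_poly p / Kz_of_poly r" "r \<noteq> 0"
proof -
  obtain u v where c: "c = of_laurent u / of_laurent v" "v \<noteq> 0"
    by (cases c) (auto simp: of_laurent_def)
  obtain n p where p: "Z (int n) * u = laurent_of_poly p" using laurent_shift_poly by blast
  obtain m r where r: "Z (int m) * v = laurent_of_poly r" using laurent_shift_poly by blast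
  have Z: "Z (int n) = laurent_of_poly (monom 1 n)" "Z n' \<noteq> 0" for n n'
    by (rule poly_mapping_eqI) (auto simp: lookup_laurent_of_poly lookup_single when_def Kz_z_neq_0
        dest: arg_cong[of _ _ "\<lambda>f. Poly_Mapping.lookup f n'"])
  have nz: "of_laurent (Z (int n)) \<noteq> 0" "of_laurent (Z (int m)) \<noteq> 0" "of_laurent v \<noteq> 0"
    using Z(2) c(2) by (simp_all add: of_laurent_eq_0_iff)
  note O = is_ring_homD[OF is_ring_hom_of_laurent]
  have "Kz_of_poly (monom 1 m * p) / Kz_of_poly (monom 1 n * r)
      = of_laurent (Z (int m) * (Z (int n) * u)) / of_laurent (Z (int n) * (Z (int m) * v))"
    unfolding p r unfolding Z(1) by (simp only: Kz_of_poly_def is_ring_homD[OF is_ring_hom_laurent_of_poly])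
  also have "\<dots> = c" using nz by (simp add: c(1) O field_simps)
  finally have "c = Kz_of_poly (monom 1 m * p) / Kz_of_poly (monom 1 n * r)" ..
  moreover have "r \<noteq> 0" using r Z(2) c(2) by auto
  ultimately show ?thesis by (intro that[of "monom 1 m * p" "monom 1 n * r"]) simp_all
qed

lemma pcompose_pow: "pcompose (p ^ n) r = pcompose p r ^ (n :: nat)"
  for p r :: "'a::comm_ring_1 poly"
  by (induction n) (simp_all add: pcompose_mult pcompose_1)

lemma order_pcompose_scale:
  fixes p :: "'a::field poly"
  assumes "c \<noteq> 0" "p \<noteq> 0"
  shows "order x (pcompose p [:0, c:]) = order (c * x) p"
proof -
  obtain r where p: "p = [:- (c * x), 1:] ^ order (c * x) p * r" and r: "\<not> [:- (c * x), 1:] dvd r"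
    using order_decomp[OF assms(2)] by blast
  let ?n = "order (c * x) p"
  have lin: "pcompose [:- (c * x), 1:] [:0, c:] = smult c [:- x, 1:]" by (simp add: pcompose_pCons)
  have eq: "pcompose p [:0, c:] = smult (c ^ ?n) ([:- x, 1:] ^ ?n * pcompose r [:0, c:])"
    by (subst p) (simp only: pcompose_mult pcompose_pow lin smult_power mult_smult_left)
  have nz: "poly (pcompose r [:0, c:]) x \<noteq> 0"
    using r by (simp add: poly_pcompose poly_eq_0_iff_dvd mult.commute)
  then have "pcompose r [:0, c:] \<noteq> 0" by auto
  then have "order x ([:- x, 1:] ^ ?n * pcompose r [:0, c:]) = ?n + order x (pcompose r [:0, c:])"
    by (subst order_mult) (auto simp: order_power_n_n)
  moreover have "order x (pcompose r [:0, c:]) = 0" using nz by (rule order_0I)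
  ultimately show ?thesis unfolding eq using assms(1) by (simp add: order_smult)
qed

definition AW_num :: "K poly" where
  "AW_num = [:1, - par_a:] * ([:1, - par_b:] * ([:1, - par_c:] * [:1, - par_d:]))"

definition AW_den :: "K poly" where
  "AW_den = [:1, 0, - 1:] * [:1, 0, - par_q:]"

lemma Kz_of_poly_linear: "Kz_of_poly [:x, y:] = Kz_const x + Kz_const y * Kz_z"
  and Kz_of_poly_quadratic: "Kz_of_poly [:x, 0, y:] = Kz_const x + Kz_const y * Kz_z ^ 2"
  by (simp_all add: Kz_of_poly_def is_ring_homD[OF is_ring_hom_of_laurent] Kz_const_def Kz_z_def power2_eq_square
      laurent_const_def[of 0] mult_ac)

lemma AW_A_eq_polys: "AW_A Kz_z = Kz_of_poly AW_num / Kz_of_poly AW_den"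
  unfolding AW_A_def AW_num_def AW_den_def is_ring_homD(3)[OF is_ring_hom_Kz_of_poly]
    Kz_of_poly_linear Kz_of_poly_quadratic
  by (simp add: is_ring_homD[OF is_ring_hom_Kz_const] mult.assoc)

text \<open>As a and c are defined with a minus sign, the values met below are monomials only up to
  sign; comparing squares avoids the sign.\<close>

lemma K_signed_monomial_neq_1:
  assumes "y ^ 2 = (sqrt_mab powi i * par_b powi j * sqrt_mcd powi k * par_d powi l * q_half powi m) ^ 2"
    and "i \<noteq> 0 \<or> j \<noteq> 0 \<or> k \<noteq> 0 \<or> l \<noteq> 0 \<or> m \<noteq> 0"
  shows "y \<noteq> 1"
proof
  assume "y = 1"
  then have "sqrt_mab powi (i * 2) * par_b powi (j * 2) * sqrt_mcd powi (k * 2) * par_d powi (l * 2) * q_half powi (m * 2) = 1"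
    using assms(1) by (simp add: power_mult_distrib power_int_mult)
  from K_monomial_eq_1[OF this] assms(2) show False by simp
qed

section \<open>Vanishing orders of A at the points a^-1 q^(t/2)\<close>

context
  fixes t :: int and x :: K
  defines "x \<equiv> inverse par_a * q_half powi t"
begin

lemma par_a_orbit: "par_a * x = q_half powi t"
  by (simp add: x_def par_a_def sqrt_mab_def par_b_def indet_neq_0)

text \<open>Since x = - b q^(t/2) / sqrt(-ab)^2, each value is, up to sign, a nontrivial monomial in
  the generators. Thus 1 - a z is the only factor of A that can vanish at x.\<close>

lemma other_orbits:
  "par_b * x \<noteq> 1" "par_c * x \<noteq> 1" "par_d * x \<noteq> 1" "x ^ 2 \<noteq> 1" "par_q * x ^ 2 \<noteq> 1"
proof -
  note nz = sqrt_mab_def par_b_def sqrt_mcd_def par_d_def indet_neq_0 q_half_neq_0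
  have x: "x = - (par_b / sqrt_mab ^ 2) * q_half powi t"
    by (simp add: x_def par_a_def)
  show "par_b * x \<noteq> 1"
    by (rule K_signed_monomial_neq_1[of _ "-2" 2 0 0 t])
       (simp_all add: x power_int_minus field_simps power2_eq_square nz)
  show "par_c * x \<noteq> 1"
    by (rule K_signed_monomial_neq_1[of _ "-2" 1 2 "-1" t])
       (simp_all add: x par_c_def power_int_minus field_simps power2_eq_square nz)
  show "par_d * x \<noteq> 1"
    by (rule K_signed_monomial_neq_1[of _ "-2" 1 0 1 t])
       (simp_all add: x power_int_minus field_simps power2_eq_square nz)
  show "x ^ 2 \<noteq> 1"
    by (rule K_signed_monomial_neq_1[of _ "-4" 2 0 0 "t * 2"])
       (simp_all add: x power_int_minus power_int_mult field_simps power2_eq_square eval_nat_numeral nz)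
  show "par_q * x ^ 2 \<noteq> 1"
    by (rule K_signed_monomial_neq_1[of _ "-4" 2 0 0 "t * 2 + 2"])
       (simp_all add: x par_q_def power_int_minus power_int_mult power_int_add field_simps power2_eq_square eval_nat_numeral nz)
qed

lemma order_AW_den: "order x AW_den = 0"
proof (rule order_0I)
  show "poly AW_den x \<noteq> 0"
    unfolding AW_den_def poly_mult mult_eq_0_iff
    using other_orbits(4,5) by (auto simp: power2_eq_square mult_ac)
qed

lemma order_AW_num: "order x AW_num = (if t = 0 then 1 else 0)"
proof (cases "t = 0")
  case True
  then have ax: "par_a * x = 1" by (simp add: par_a_orbit)
  then have lin: "[:1, - par_a:] = smult (- par_a) ([:- x, 1:] ^ 1)" by simp
  have 1: "order x [:1, - par_a:] = 1"
  proof -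
    have "par_a \<noteq> 0" using ax by auto
    then have "order x [:1, - par_a:] = order x ([:- x, 1:] ^ 1)"
      unfolding lin by (subst order_smult) simp_all
    then show ?thesis by (simp only: order_power_n_n)
  qed
  have "order x ([:1, - par_b:] * ([:1, - par_c:] * [:1, - par_d:])) = 0"
    using other_orbits(1-3)
    by (intro order_0I) (unfold poly_mult mult_eq_0_iff, auto simp: mult_ac)
  then show ?thesis
    unfolding AW_num_def using True 1 by (subst order_mult) simp_all
next
  case False
  then have "par_a * x \<noteq> 1" by (simp add: par_a_orbit q_half_powi_eq_1_iff)
  then have "poly AW_num x \<noteq> 0"
    unfolding AW_num_def poly_mult mult_eq_0_iff using other_orbits(1-3) by (auto simp: mult_ac)
  then show ?thesis using False by (simp add: order_0I)
qed

end

text \<open>For odd N the zero a^-1 q^(-N/2) of A(q^(N/2) z) lies between the points a^-1 q^k,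
  whereas A(z) vanishes to order 1 at k = 0. So the order \<open>ord k\<close> of c would drop by 1
  from k = 0 to k = 1 and be constant on either side, although it is 0 for all large |k|.\<close>

lemma no_odd_solution:
  assumes eq: "c * T_pow N (AW_A Kz_z) = AW_A Kz_z * T_pow 2 c" and c: "c \<noteq> 0" and N: "odd N"
  shows False
proof -
  obtain P R where PR: "c = Kz_of_poly P / Kz_of_poly R" "R \<noteq> 0"
    using Kz_quotient_of_polys by blast
  have P: "P \<noteq> 0" using c PR by (auto simp: is_ring_homD[OF is_ring_hom_Kz_of_poly])
  let ?h = "\<lambda>n p. pcompose p [:0, q_half powi n:]"
  have h0: "?h n p \<noteq> 0" if "p \<noteq> 0" for n p
    using that T_pow_Kz_of_poly[of n p] is_ring_hom_field(1)[OF is_ring_hom_T_pow, of n "Kz_of_poly p"]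
    by (metis Kz_of_poly_eq_0_iff)
  have nz: "AW_num \<noteq> 0" "AW_den \<noteq> 0" by (simp_all add: AW_num_def AW_den_def)
  note T = is_ring_hom_field(4)[OF is_ring_hom_T_pow]
  define NN DN P2 R2 where shifts: "NN = ?h N AW_num" "DN = ?h N AW_den" "P2 = ?h 2 P" "R2 = ?h 2 R"
  have "DN \<noteq> 0" "R2 \<noteq> 0" using h0 nz PR(2) by (simp_all only: shifts not_False_eq_True)
  moreover have "Kz_of_poly P / Kz_of_poly R * (Kz_of_poly NN / Kz_of_poly DN)
      = Kz_of_poly AW_num / Kz_of_poly AW_den * (Kz_of_poly P2 / Kz_of_poly R2)"
    using eq unfolding PR(1) AW_A_eq_polys T T_pow_Kz_of_poly shifts .
  ultimately have "Kz_of_poly (P * (NN * (AW_den * R2))) = Kz_of_poly (AW_num * (P2 * (DN * R)))"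
    using PR(2) nz by (simp add: is_ring_homD(3)[OF is_ring_hom_Kz_of_poly] Kz_of_poly_eq_0_iff field_simps)
  then have poly_eq: "P * (?h N AW_num * (AW_den * ?h 2 R)) = AW_num * (?h 2 P * (?h N AW_den * R))"
    by (simp only: Kz_of_poly_eq_iff shifts)
  define x where "x k = inverse par_a * q_half powi (2 * k)" for k
  have scale: "order (x k) (?h n p) = order (inverse par_a * q_half powi (2 * k + n)) p" if "p \<noteq> 0" for k n p
    unfolding x_def using that
    by (subst order_pcompose_scale) (simp_all add: q_half_neq_0 power_int_add mult_ac)
  define ord where "ord k = int (order (x k) P) - int (order (x k) R)" for k
  have rec: "ord k = ord (k + 1) + (if k = 0 then 1 else 0)" for k
  proof -
    have "2 * k + N \<noteq> 0" using N by presburger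
    then have "order (x k) (?h N AW_num) = 0" "order (x k) (?h N AW_den) = 0" "order (x k) AW_den = 0"
      by (simp_all add: scale nz order_AW_num order_AW_den) (simp add: x_def order_AW_den)
    moreover have "order (x k) AW_num = (if k = 0 then 1 else 0)"
      unfolding x_def order_AW_num by simp
    moreover have "order (x k) (?h 2 P) = order (x (k + 1)) P" "order (x k) (?h 2 R) = order (x (k + 1)) R"
      using scale[OF P, of k 2] scale[OF PR(2), of k 2] by (simp_all add: x_def algebra_simps)
    moreover have "order (x k) (P * (?h N AW_num * (AW_den * ?h 2 R)))
        = order (x k) P + (order (x k) (?h N AW_num) + (order (x k) AW_den + order (x k) (?h 2 R)))"
      "order (x k) (AW_num * (?h 2 P * (?h N AW_den * R)))
        = order (x k) AW_num + (order (x k) (?h 2 P) + (order (x k) (?h N AW_den) + order (x k) R))"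
      by (simp_all only: order_mult no_zero_divisors h0 nz P PR(2) simp_thms not_False_eq_True)
    ultimately show ?thesis using poly_eq unfolding ord_def by auto
  qed
  have x_inj: "inj x"
  proof (rule injI)
    fix k l assume "x k = x l"
    then have "par_a * x k = par_a * x l" by (simp only:)
    then have "q_half powi (2 * k) = q_half powi (2 * l)" by (simp only: x_def par_a_orbit)
    then have "q_half powi (2 * k - 2 * l) = 1" by (simp add: power_int_diff q_half_neq_0)
    then show "k = l" by (simp add: q_half_powi_eq_1_iff)
  qed
  have "finite (x -` ({y. poly P y = 0} \<union> {y. poly R y = 0}))"
    using P PR(2) by (intro finite_vimageI x_inj) (simp add: poly_roots_finite)
  then obtain B where B: "abs ` (x -` ({y. poly P y = 0} \<union> {y. poly R y = 0})) \<subseteq> {..<B}"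
    unfolding finite_int_iff_bounded by blast
  have far: "ord k = 0" if "\<bar>k\<bar> \<ge> B" for k
  proof -
    have "k \<notin> x -` ({y. poly P y = 0} \<union> {y. poly R y = 0})" using B that by fastforce
    then show ?thesis by (simp add: ord_def order_0I)
  qed
  have "ord 1 = ord (1 + int n)" for n
  proof (induction n)
    case (Suc n)
    have "1 + int (Suc n) = 1 + int n + 1" by simp
    then show ?case using Suc rec[of "1 + int n"] by simp
  qed simp
  from this[of "nat \<bar>B\<bar>"] have "ord 1 = 0" using far[of "1 + int (nat \<bar>B\<bar>)"] by simp
  have "ord 0 = ord (- int n)" for n
  proof (induction n)
    case (Suc n)
    then show ?case using rec[of "- int (Suc n)"] by simp
  qed simp
  from this[of "nat \<bar>B\<bar>"] have "ord 0 = 0" using far[of "- int (nat \<bar>B\<bar>)"] by simp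
  with \<open>ord 1 = 0\<close> rec[of 0] show False by simp
qed

lemma AW_A_neq_0: "AW_A Kz_z \<noteq> 0"
  unfolding AW_A_eq_polys by (simp add: Kz_of_poly_eq_0_iff AW_num_def AW_den_def)

text \<open>\<open>AW_A_prod k\<close> solves the same equation by telescoping, so its quotient with
  \<open>c\<close> is invariant under z -> q z and hence constant.\<close>

lemma even_solution:
  assumes eq: "c * T_pow (2 * int k) (AW_A Kz_z) = AW_A Kz_z * T_pow 2 c"
  shows "\<exists>x. c = Kz_const x * AW_A_prod k"
proof -
  have nz: "AW_A_prod k \<noteq> 0"
    by (simp add: AW_A_prod_def is_ring_hom_field(1)[OF is_ring_hom_T_pow] AW_A_neq_0)
  have prod: "AW_A_prod k * T_pow (2 * int k) (AW_A Kz_z) = AW_A Kz_z * T_pow 2 (AW_A_prod k)"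
    unfolding T_pow_2_AW_A_prod by (simp add: AW_A_prod_def)
  have "T_pow 2 (c / AW_A_prod k) = c / AW_A_prod k"
  proof -
    have "T_pow 2 c * AW_A_prod k * (AW_A Kz_z * T_pow (2 * int k) (AW_A Kz_z))
        = c * T_pow 2 (AW_A_prod k) * (AW_A Kz_z * T_pow (2 * int k) (AW_A Kz_z))"
    proof -
      have "T_pow 2 c * AW_A_prod k * (AW_A Kz_z * T_pow (2 * int k) (AW_A Kz_z))
          = (AW_A Kz_z * T_pow 2 c) * (AW_A_prod k * T_pow (2 * int k) (AW_A Kz_z))" by (simp only: mult_ac)
      also have "\<dots> = c * T_pow 2 (AW_A_prod k) * (AW_A Kz_z * T_pow (2 * int k) (AW_A Kz_z))"
        unfolding eq[symmetric] prod by (simp only: mult_ac)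
      finally show ?thesis .
    qed
    then have "T_pow 2 c * AW_A_prod k = c * T_pow 2 (AW_A_prod k)"
      using AW_A_neq_0 by (simp add: is_ring_hom_field(1)[OF is_ring_hom_T_pow])
    then show ?thesis
      using nz by (simp add: is_ring_hom_field(1,4)[OF is_ring_hom_T_pow] field_simps)
  qed
  then obtain x where "c / AW_A_prod k = Kz_const x" using T_pow_2_invariant by blast
  then have "c = Kz_const x * AW_A_prod k" using nz by (simp add: field_simps)
  then show ?thesis by blast
qed

section \<open>Shift operators as polynomials in L\<close>

lemma shift_operators_0_iff:
  "S \<in> shift_operators_0 \<longleftrightarrow> is_difference_operator S \<and>
     (\<forall>f\<in>sym_laurent. \<exists>g\<in>sym_laurent. S (of_laurent f) = of_laurent g) \<and>
     (\<forall>m. \<exists>C. S (of_laurent (AW_p m)) = Kz_const C * of_laurent (AW_p m))"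
  unfolding shift_operators_0_def is_sym_difference_operator_def sym_AW_poly_eq by blast

lemma shift_operators_0_diff:
  assumes "S \<in> shift_operators_0" "R \<in> shift_operators_0"
  shows "(\<lambda>f. S f - R f) \<in> shift_operators_0"
  unfolding shift_operators_0_iff
proof (intro conjI ballI allI)
  have "is_difference_operator (\<lambda>f. S f + (- 1) * R f)"
    using assms by (intro is_difference_operator_add is_difference_operator_mult) (simp_all add: shift_operators_0_iff)
  then show "is_difference_operator (\<lambda>f. S f - R f)" by simp
next
  fix f assume "f \<in> sym_laurent"
  then obtain g h where "g \<in> sym_laurent" "h \<in> sym_laurent" "S (of_laurent f) = of_laurent g" "R (of_laurent f) = of_laurent h"
    using assms unfolding shift_operators_0_iff by meson
  then have "S (of_laurent f) - R (of_laurent f) = of_laurent (g - h)" "g - h \<in> sym_laurent"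
    by (simp_all add: is_ring_homD[OF is_ring_hom_of_laurent] sym_laurent_closed)
  then show "\<exists>g\<in>sym_laurent. S (of_laurent f) - R (of_laurent f) = of_laurent g" by blast
next
  fix m
  obtain C D where "S (of_laurent (AW_p m)) = Kz_const C * of_laurent (AW_p m)"
    "R (of_laurent (AW_p m)) = Kz_const D * of_laurent (AW_p m)"
    using assms unfolding shift_operators_0_iff by meson
  then have "S (of_laurent (AW_p m)) - R (of_laurent (AW_p m)) = Kz_const (C - D) * of_laurent (AW_p m)"
    by (simp add: is_ring_homD[OF is_ring_hom_Kz_const] left_diff_distrib)
  then show "\<exists>C. S (of_laurent (AW_p m)) - R (of_laurent (AW_p m)) = Kz_const C * of_laurent (AW_p m)" by blast
qed

definition poly_op :: "K poly \<Rightarrow> Kz \<Rightarrow> Kz" where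
  "poly_op p f = (\<Sum>i\<le>degree p. Kz_const (coeff p i) * (AW_L ^^ i) f)"

lemma polys_in_operator_AW_L: "polys_in_operator AW_L = range poly_op"
  unfolding polys_in_operator_def poly_op_def[abs_def] ..

lemma poly_op_bound: "degree p \<le> n \<Longrightarrow> poly_op p f = (\<Sum>i\<le>n. Kz_const (coeff p i) * (AW_L ^^ i) f)"
  unfolding poly_op_def
  by (intro sum.mono_neutral_left) (auto simp: coeff_eq_0 is_ring_homD[OF is_ring_hom_Kz_const])

lemma poly_op_add: "poly_op (p + r) f = poly_op p f + poly_op r f"
proof -
  let ?n = "max (degree p) (degree r)"
  have "degree (p + r) \<le> ?n" by (rule degree_add_le_max)
  then show ?thesis
    using poly_op_bound[of p ?n f] poly_op_bound[of r ?n f] poly_op_bound[of "p + r" ?n f]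
    by (simp add: is_ring_homD[OF is_ring_hom_Kz_const] distrib_right sum.distrib)
qed

lemma poly_op_monom: "poly_op (monom x k) f = Kz_const x * (AW_L ^^ k) f"
proof -
  have "poly_op (monom x k) f = (\<Sum>i\<le>k. if i = k then Kz_const x * (AW_L ^^ k) f else 0)"
    unfolding poly_op_bound[OF degree_monom_le]
    by (intro sum.cong) (auto simp: is_ring_homD[OF is_ring_hom_Kz_const])
  then show ?thesis by simp
qed

lemma poly_op_shift_operator: "poly_op p \<in> shift_operators_0"
  unfolding shift_operators_0_iff
proof (intro conjI ballI allI)
  have "is_difference_operator (AW_L ^^ i)" for i
    using AW_L_power[of i] unfolding is_difference_operator_iff by blast
  then show "is_difference_operator (poly_op p)"
    unfolding poly_op_def[abs_def] by (intro is_difference_operator_sum is_difference_operator_mult)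
next
  fix f assume f: "f \<in> sym_laurent"
  have pow: "(AW_L ^^ i) (of_laurent f) = of_laurent ((lau_L ^^ i) f) \<and> (lau_L ^^ i) f \<in> sym_laurent" for i
    by (induction i) (simp_all add: f lau_L)
  have "poly_op p (of_laurent f) = of_laurent (\<Sum>i\<le>degree p. laurent_const (coeff p i) * (lau_L ^^ i) f)"
    unfolding poly_op_def by (simp add: pow is_ring_homD[OF is_ring_hom_of_laurent] Kz_const_def)
  moreover have "(\<Sum>i\<le>degree p. laurent_const (coeff p i) * (lau_L ^^ i) f) \<in> sym_laurent"
    by (intro sym_laurent_sum sym_laurent_closed) (simp add: pow)
  ultimately show "\<exists>g\<in>sym_laurent. poly_op p (of_laurent f) = of_laurent g" by blast
next
  fix m
  have pow: "(AW_L ^^ i) (of_laurent (AW_p m)) = Kz_const (AW_eigenvalue m ^ i) * of_laurent (AW_p m)" for i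
  proof (induction i)
    case (Suc i)
    then have "(AW_L ^^ Suc i) (of_laurent (AW_p m))
        = Kz_const (AW_eigenvalue m ^ i) * (Kz_const (AW_eigenvalue m) * of_laurent (AW_p m))"
      by (simp only: funpow.simps o_apply AW_L_const AW_L_sym_AW_poly)
    then show ?case by (simp add: is_ring_homD[OF is_ring_hom_Kz_const] mult_ac)
  qed (simp add: is_ring_homD[OF is_ring_hom_Kz_const])
  have "poly_op p (of_laurent (AW_p m))
      = Kz_const (\<Sum>i\<le>degree p. coeff p i * AW_eigenvalue m ^ i) * of_laurent (AW_p m)"
    unfolding poly_op_def pow by (simp add: is_ring_homD[OF is_ring_hom_Kz_const] sum_distrib_right mult.assoc)
  then show "\<exists>C. poly_op p (of_laurent (AW_p m)) = Kz_const C * of_laurent (AW_p m)" by blast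
qed

text \<open>Both operators are diagonal on the basis \<open>AW_p\<close>; the conclusion is
  therefore confined to symmetric elements.\<close>

lemma shift_operator_commutes:
  assumes S: "S \<in> shift_operators_0" "S = diff_op N c" and f: "f \<in> sym_laurent"
  shows "S (AW_L (of_laurent f)) = AW_L (S (of_laurent f))"
proof -
  note O = is_ring_homD[OF is_ring_hom_of_laurent]
  have p: "S (AW_L (of_laurent (AW_p m))) = AW_L (S (of_laurent (AW_p m)))" for m
  proof -
    obtain C where "S (of_laurent (AW_p m)) = Kz_const C * of_laurent (AW_p m)"
      using S(1) unfolding shift_operators_0_iff by blast
    then show ?thesis
      by (simp add: AW_L_sym_AW_poly AW_L_const S(2) diff_op_linear mult_ac)
  qed
  obtain n x where "f = (\<Sum>j<n. laurent_const (x j) * AW_p j)" using sym_laurent_span[OF f] .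
  then have "of_laurent f = (\<Sum>j<n. Kz_const (x j) * of_laurent (AW_p j))"
    by (simp add: O Kz_const_def)
  then show ?thesis
    using p unfolding AW_L_eq_diff_op S(2) by (simp add: diff_op_linear)
qed

text \<open>The commutator with L kills all symmetric elements, hence all its coefficients vanish.
  This is the one at T^(N+2), after cancellation of r^-1.\<close>

lemma shift_operator_top_coeff:
  assumes S: "S \<in> shift_operators_0" "S = diff_op N c" and c: "order_le N c"
  shows "c (int N) * T_pow (int N) (AW_A Kz_z) = AW_A Kz_z * T_pow 2 (c (int N))"
proof -
  let ?e = "diff_op_mult N c AW_L_coeff" and ?d = "diff_op_mult 2 AW_L_coeff c"
  have eo: "order_le (N + 2) ?e" "order_le (N + 2) ?d"
    using order_le_diff_op_mult[OF order_le_AW_L, of N c] order_le_diff_op_mult[OF c, of 2 AW_L_coeff]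
    by (simp_all add: add.commute)
  have "?e (int (N + 2)) - ?d (int (N + 2)) = 0"
  proof (rule diff_op_vanishing[where c = "\<lambda>n. ?e n - ?d n"])
    show "order_le (N + 2) (\<lambda>n. ?e n - ?d n)" using eo by (simp add: order_le_def)
    fix f assume "f \<in> sym_laurent"
    from shift_operator_commutes[OF S this]
    have "diff_op N c (diff_op 2 AW_L_coeff (of_laurent f)) = diff_op 2 AW_L_coeff (diff_op N c (of_laurent f))"
      unfolding S(2) AW_L_eq_diff_op .
    then show "diff_op (N + 2) (\<lambda>n. ?e n - ?d n) (of_laurent f) = 0"
      unfolding diff_op_compose[OF order_le_AW_L] diff_op_compose[OF c] diff_op_coeffs
      by (simp add: add.commute)
  qed
  then have "c (int N) * T_pow (int N) (AW_L_coeff 2) = AW_L_coeff 2 * T_pow 2 (c (int N))"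
    using diff_op_mult_top[OF order_le_AW_L, of N c] diff_op_mult_top[OF c, of 2 AW_L_coeff]
    by (simp add: add.commute)
  moreover have "AW_L_coeff 2 = Kz_const (inverse AW_r) * AW_A Kz_z" by (simp add: AW_L_coeff_def)
  ultimately have "Kz_const (inverse AW_r) * (c (int N) * T_pow (int N) (AW_A Kz_z))
      = Kz_const (inverse AW_r) * (AW_A Kz_z * T_pow 2 (c (int N)))"
    by (simp add: is_ring_homD[OF is_ring_hom_T_pow] mult_ac)
  then show ?thesis using AW_r_neq_0 by (simp add: Kz_const_eq_0_iff)
qed

text \<open>The coefficient at -N is the image of the one at N under z -> z^-1, so both ends of the
  window vanish together.\<close>

lemma shift_operator_order_reduce:
  assumes S: "S \<in> shift_operators_0" "S = diff_op N c" and c: "order_le N c" "c (int N) = 0"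
  shows "c = (\<lambda>_. 0) \<or> (N > 0 \<and> order_le (N - 1) c)"
proof -
  have "c (- int N) = Kz_inv (c (int N))"
    using S c(1) by (intro diff_op_sym_coeffs[of N]) (auto simp: shift_operators_0_iff)
  then have "c (- int N) = 0" using c(2) by (simp add: is_ring_homD[OF is_ring_hom_Kz_inv])
  then have zero: "c n = 0" if "\<bar>n\<bar> \<ge> int N" for n
  proof -
    consider "n = int N" | "n = - int N" | "\<bar>n\<bar> > int N" using \<open>\<bar>n\<bar> \<ge> int N\<close> by linarith
    then show ?thesis using \<open>c (- int N) = 0\<close> c by cases (simp_all add: order_le_def)
  qed
  show ?thesis
  proof (cases "N = 0")
    case True
    then show ?thesis using zero by (auto simp: fun_eq_iff)
  next
    case False
    then show ?thesis using zero by (auto simp: order_le_def)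
  qed
qed

lemma shift_operator_poly:
  "S \<in> shift_operators_0 \<Longrightarrow> order_le N c \<Longrightarrow> S = diff_op N c \<Longrightarrow> \<exists>p. S = poly_op p"
proof (induction N arbitrary: S c rule: less_induct)
  case (less N)
  have reduce: "\<exists>p. R = poly_op p"
    if R: "R \<in> shift_operators_0" "R = diff_op N d" and d: "order_le N d" "d (int N) = 0" for R d
    using shift_operator_order_reduce[OF R d]
  proof
    assume "d = (\<lambda>_. 0)"
    then have "R = poly_op 0" by (simp add: R(2) diff_op_def poly_op_def fun_eq_iff is_ring_homD[OF is_ring_hom_Kz_const])
    then show ?thesis by blast
  next
    assume N: "N > 0 \<and> order_le (N - 1) d"
    then have "R = diff_op (N - 1) d" using diff_op_extend[of "N - 1" d N] R(2) by simp
    then show ?thesis using less.IH[of "N - 1" R d] N R(1) by simp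
  qed
  show ?case
  proof (cases "c (int N) = 0")
    case True
    then show ?thesis using reduce less.prems by blast
  next
    case False
    note top = shift_operator_top_coeff[OF less.prems(1,3,2)]
    have "even N" using no_odd_solution[OF top False] by auto
    then obtain k where k: "N = 2 * k" by (auto elim: evenE)
    then obtain x where x: "c (int N) = Kz_const x * AW_A_prod k" using even_solution[of "c (int N)" k] top by auto
    obtain e where e: "order_le N e" "AW_L ^^ k = diff_op N e" "e (int N) = Kz_const (inverse AW_r ^ k) * AW_A_prod k"
      using AW_L_power[of k] unfolding k by auto
    \<comment> \<open>The power of \<open>AW_r\<close> compensates the factor r^-k in the leading
      coefficient of L^k.\<close>
    define y where "y = x * AW_r ^ k"
    define R where "R = (\<lambda>f. S f - poly_op (monom y k) f)"
    have "\<exists>p. R = poly_op p"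
    proof (rule reduce)
      show "R \<in> shift_operators_0"
        unfolding R_def by (intro shift_operators_0_diff less.prems poly_op_shift_operator)
      show "R = diff_op N (\<lambda>n. c n - Kz_const y * e n)"
        by (simp add: R_def less.prems(3) poly_op_monom e(2) fun_eq_iff diff_op_coeffs)
      show "order_le N (\<lambda>n. c n - Kz_const y * e n)"
        using less.prems(2) e(1) by (simp add: order_le_def)
      have "y * inverse AW_r ^ k = x" using AW_r_neq_0 by (simp add: y_def field_simps)
      then show "c (int N) - Kz_const y * e (int N) = 0"
        unfolding x e(3) mult.assoc[symmetric] is_ring_homD(3)[OF is_ring_hom_Kz_const, symmetric] by simp
    qed
    then obtain p where "R = poly_op p" by blast
    then have "S = poly_op (p + monom y k)"
      by (simp add: fun_eq_iff poly_op_add R_def) (metis diff_add_cancel)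
    then show ?thesis by blast
  qed
qed

theorem theorem3p10:
  shows "shift_operators_0 = polys_in_operator AW_L"
proof (intro subset_antisym subsetI)
  fix S assume S: "S \<in> shift_operators_0"
  then obtain N c where "order_le N c" "S = diff_op N c"
    by (auto simp: shift_operators_0_iff is_difference_operator_iff)
  then obtain p where "S = poly_op p" using shift_operator_poly[OF S] by blast
  then show "S \<in> polys_in_operator AW_L" by (simp add: polys_in_operator_AW_L)
next
  fix S assume "S \<in> polys_in_operator AW_L"
  then show "S \<in> shift_operators_0"
    by (auto simp: polys_in_operator_AW_L poly_op_shift_operator)
qed

end
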